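(* Let $\bar\mu$ be a Borel probability measure on $H$ with $\int_H\|u_0\|_{L^2}^2\,d\bar\mu(u_0)<\infty$, and let $\{\mu_t\}_{0\le t\le T}$ be a phase space statistical solution of the 2D incompressible Euler equations with initial distribution $\bar\mu$. Let $\mathcal F(t,v)=\int_H e^{i(u,v)_{L^2}}d\mu_t(u)$ and $\bar{\mathcal F}(v)=\int_He^{i(u,v)_{L^2}}d\bar\mu(u)$. Then for all $v\in H^L$ and every $0\le t\le T$, $$\mathcal F(t,v)=\bar{\mathcal F}(v)+\int_0^t\int_H i\,(u\otimes u,\nabla v)_{L^2}\,e^{i(u,v)_{L^2}}\,d\mu_s(u)\,ds .$$
   Context: $\mathbb T^2$ is the 2-torus; $H$ is the closed subspace of $L^2(\mathbb T^2;\mathbb R^2)$ of weakly divergence-free fields, with inner product $(\cdot,\cdot)_{L^2}$; $H_w$ is $H$ with its weak topology. For matrix fields $(A,B)_{L^2}=\int_{\mathbb T^2}A:B\,dx$, $A:B=\sum_{ij}A_{ij}B_{ij}$, and $(\nabla v)_{ij}=\partial_jv_i$. Fix $L>2$ and let $H^L:=H^L(\mathbb T^2;\mathbb R^2)\cap H$. Let $\mathcal T$ be the set of functionals $\Phi:H\to\mathbb R$ of the form $\Phi(u)=\phi((u,g_1)_{L^2},\dots,(u,g_k)_{L^2})$ with $k\in\mathbb N$, $\phi\in C^1_c(\mathbb R^k)$, $g_1,\dots,g_k\in H^L$; set $\Phi'(u):=\sum_{j=1}^k\partial_j\phi((u,g_1)_{L^2},\dots,(u,g_k)_{L^2})\,g_j\in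 H^L$. A phase space statistical solution of the 2D incompressible Euler equations on $[0,T]$ with initial distribution $\bar\mu$ (a Borel probability measure on $H$ with $\int\|u_0\|^2_{L^2}d\bar\mu<\infty$) is a family $\{\mu_t\}_{0\le t\le T}$ of Borel probability measures on $H$ with $\mu_0=\bar\mu$ such that: (i) $t\mapsto\int_H\varphi\,d\mu_t$ is Lebesgue measurable on $[0,T]$ for every $\varphi\in C_b(H_w)$; (ii) $\int_H\|u\|_{L^2}^2d\mu_t(u)\le\int_H\|u\|_{L^2}^2d\bar\mu(u)$ for a.e. $t$; (iii) for every $\Phi\in\mathcal T$ and all $0\le t'\le t\le T$: $\int_H\Phi\,d\mu_t=\int_H\Phi\,d\mu_{t'}+\int_{t'}^t\int_H(\nabla\Phi'(u),u\otimes u)_{L^2}\,d\mu_s(u)\,ds$. *)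

theory Defs
  imports "HOL-Probability.Probability"
begin

text \<open>Points of the 2-torus are represented by points of the plane; fields on the
 torus by 1-periodic functions on the plane. The fundamental cell is Q = [0,1]^2.\<close>

type_synonym field = "real^2 \<Rightarrow> real^2"

definition Qcell :: "(real^2) set" where
  "Qcell = {x. \<forall>i. 0 \<le> x$i \<and> x$i \<le> 1}"

definition periodic :: "(real^2 \<Rightarrow> 'b) \<Rightarrow> bool" where
  "periodic f \<longleftrightarrow> (\<forall>x i. f (x + axis i 1) = f x)"

text \<open>C-infinity scalar functions on the plane: all iterated partial derivatives
 exist and are continuous. F xs is the iterated partial derivative along the
 coordinate directions listed in xs (applied from the end of the list).\<close>
definition smooth_scalar :: "(real^2 \<Rightarrow> real) \<Rightarrow> bool" where
  "smooth_scalar \<phi> \<longleftrightarrow>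
     (\<exists>F :: 2 list \<Rightarrow> real^2 \<Rightarrow> real.
        F [] = \<phi> \<and> (\<forall>xs. continuous_on UNIV (F xs)) \<and>
        (\<forall>xs i x. ((\<lambda>h. F xs (x + h *\<^sub>R axis i 1)) has_real_derivative F (i # xs) x) (at 0)))"

definition test_fun :: "(real^2 \<Rightarrow> real) \<Rightarrow> bool" where
  "test_fun \<phi> \<longleftrightarrow> smooth_scalar \<phi> \<and> periodic \<phi>"

definition pderiv2 :: "2 \<Rightarrow> (real^2 \<Rightarrow> real) \<Rightarrow> real^2 \<Rightarrow> real" where
  "pderiv2 j \<phi> x = deriv (\<lambda>h. \<phi> (x + h *\<^sub>R axis j 1)) 0"

definition L2field :: "field \<Rightarrow> bool" where
  "L2field u \<longleftrightarrow> periodic u \<and> u \<in> borel_measurable (lebesgue_on Qcell) \<and>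
     integrable (lebesgue_on Qcell) (\<lambda>x. (norm (u x))^2)"

definition l2inner :: "field \<Rightarrow> field \<Rightarrow> real" where
  "l2inner u v = (\<integral>x. inner (u x) (v x) \<partial>lebesgue_on Qcell)"

definition l2norm :: "field \<Rightarrow> real" where
  "l2norm u = sqrt (l2inner u u)"

definition div_free :: "field \<Rightarrow> bool" where
  "div_free u \<longleftrightarrow> (\<forall>\<phi>. test_fun \<phi> \<longrightarrow>
     (\<integral>x. (\<Sum>j\<in>UNIV. u x $ j * pderiv2 j \<phi> x) \<partial>lebesgue_on Qcell) = 0)"

definition Hsp :: "field set" where
  "Hsp = {u. L2field u \<and> div_free u}"

definition fourier_coeff :: "field \<Rightarrow> int \<times> int \<Rightarrow> 2 \<Rightarrow> complex" where
  "fourier_coeff u k j = (\<integral>x. complex_of_real (u x $ j) *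
      cis (- 2 * pi * (real_of_int (fst k) * x$1 + real_of_int (snd k) * x$2)) \<partial>lebesgue_on Qcell)"

definition HL :: "real \<Rightarrow> field set" where
  "HL L = {v \<in> Hsp. (\<lambda>k. (1 + real_of_int ((fst k)^2 + (snd k)^2)) powr L *
              (\<Sum>j\<in>UNIV. (cmod (fourier_coeff v k j))^2)) summable_on UNIV}"

definition weak_grad :: "field \<Rightarrow> real^2 \<Rightarrow> real^2^2" where
  "weak_grad v = (SOME G. (\<forall>i j. integrable (lebesgue_on Qcell) (\<lambda>x. G x $ i $ j)) \<and>
     (\<forall>\<phi> i j. test_fun \<phi> \<longrightarrow>
        (\<integral>x. v x $ i * pderiv2 j \<phi> x \<partial>lebesgue_on Qcell) =
        - (\<integral>x. G x $ i $ j * \<phi> x \<partial>lebesgue_on Qcell)))"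

definition nonlin :: "field \<Rightarrow> field \<Rightarrow> real" where
  "nonlin w u = (\<integral>x. (\<Sum>i\<in>UNIV. \<Sum>j\<in>UNIV. weak_grad w x $ i $ j * (u x $ i * u x $ j))
                   \<partial>lebesgue_on Qcell)"

definition H_open :: "field set \<Rightarrow> bool" where
  "H_open U \<longleftrightarrow> U \<subseteq> Hsp \<and>
     (\<forall>u\<in>U. \<exists>e>0. \<forall>w\<in>Hsp. l2norm (w - u) < e \<longrightarrow> w \<in> U)"

definition H_borel :: "field set set" where
  "H_borel = sigma_sets Hsp {U. H_open U}"

definition borel_prob_H :: "field measure \<Rightarrow> bool" where
  "borel_prob_H M \<longleftrightarrow> prob_space M \<and> space M = Hsp \<and> sets M = H_borel"

definition H_weak :: "field topology" where
  "H_weak = topology_generated_by {{u \<in> Hsp. l2inner u g \<in> U} | g U. g \<in> Hsp \<and> open U}"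

text \<open>C^1_c(R^k): functions of (nat => real) depending on coordinates < k;
 D gives the partial derivatives, which must exist and be continuous on R^k,
 and phi has compact support in R^k.\<close>
definition vec_k :: "nat \<Rightarrow> (nat \<Rightarrow> real) \<Rightarrow> bool" where
  "vec_k k y \<longleftrightarrow> (\<forall>i\<ge>k. y i = 0)"

definition C1c :: "nat \<Rightarrow> ((nat \<Rightarrow> real) \<Rightarrow> real) \<Rightarrow> ((nat \<Rightarrow> real) \<Rightarrow> nat \<Rightarrow> real) \<Rightarrow> bool" where
  "C1c k \<phi> D \<longleftrightarrow>
     (\<forall>y j. vec_k k y \<and> j < k \<longrightarrow> ((\<lambda>h. \<phi> (y(j := h))) has_real_derivative D y j) (at (y j))) \<and>
     (\<forall>y j. vec_k k y \<and> j < k \<longrightarrow> (\<forall>e>0. \<exists>d>0. \<forall>z. vec_k k z \<and> (\<forall>i<k. \<bar>z i - y i\<bar> < d)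
              \<longrightarrow> \<bar>D z j - D y j\<bar> < e)) \<and>
     (\<exists>R. \<forall>y. vec_k k y \<and> (\<exists>i<k. \<bar>y i\<bar> > R) \<longrightarrow> \<phi> y = 0)"

definition coords :: "nat \<Rightarrow> (nat \<Rightarrow> field) \<Rightarrow> field \<Rightarrow> nat \<Rightarrow> real" where
  "coords k g u = (\<lambda>j. if j < k then l2inner u (g j) else 0)"

definition cyl :: "nat \<Rightarrow> ((nat \<Rightarrow> real) \<Rightarrow> real) \<Rightarrow> (nat \<Rightarrow> field) \<Rightarrow> field \<Rightarrow> real" where
  "cyl k \<phi> g u = \<phi> (coords k g u)"

definition cyl_deriv :: "nat \<Rightarrow> ((nat \<Rightarrow> real) \<Rightarrow> nat \<Rightarrow> real) \<Rightarrow> (nat \<Rightarrow> field) \<Rightarrow> field \<Rightarrow> field" where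
  "cyl_deriv k D g u = (\<lambda>x. \<Sum>j<k. D (coords k g u) j *\<^sub>R g j x)"

definition stat_sol :: "real \<Rightarrow> real \<Rightarrow> field measure \<Rightarrow> (real \<Rightarrow> field measure) \<Rightarrow> bool" where
  "stat_sol L T \<mu>bar \<mu> \<longleftrightarrow>
     (\<forall>t\<in>{0..T}. borel_prob_H (\<mu> t)) \<and> \<mu> 0 = \<mu>bar \<and>
     (\<forall>\<phi>. continuous_map H_weak euclideanreal \<phi> \<and> bounded (\<phi> ` Hsp) \<longrightarrow>
        (\<lambda>t. \<integral>u. \<phi> u \<partial>\<mu> t) \<in> borel_measurable (lebesgue_on {0..T})) \<and>
     (AE t in lebesgue_on {0..T}.
        (\<integral>\<^sup>+u. ennreal ((l2norm u)^2) \<partial>\<mu> t) \<le> (\<integral>\<^sup>+u. ennreal ((l2norm u)^2) \<partial>\<mu>bar)) \<and>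
     (\<forall>k \<phi> D g. C1c k \<phi> D \<and> (\<forall>j<k. g j \<in> HL L) \<longrightarrow>
        (\<forall>t' t. 0 \<le> t' \<and> t' \<le> t \<and> t \<le> T \<longrightarrow>
          (\<integral>u. cyl k \<phi> g u \<partial>\<mu> t) = (\<integral>u. cyl k \<phi> g u \<partial>\<mu> t') +
            (\<integral>s\<in>{t'..t}. (\<integral>u. nonlin (cyl_deriv k D g u) u \<partial>\<mu> s) \<partial>lebesgue)))"

end

theory Submission
  imports Defs
begin

text \<open>Testing the evolution equation with the cut-offs of \<open>u \<mapsto> h ((u, v))\<close>, \<open>h = cos\<close> or \<open>h = sin\<close>, produces
  \<open>h' ((u, v)) (\<nabla>v, u \<otimes> u)\<close> in the limit. For \<open>L > 2\<close> the Fourier series of \<open>\<nabla>v\<close> converges absolutely, so the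
  quadratic term is bounded by \<open>C \<parallel>u\<parallel>\<^sup>2\<close> and the energy bound (ii) allows dominated convergence.
  The quadratic term is not weakly continuous, so measurability in time does not follow from (i) at once: replacing
  \<open>u\<close> by its Fourier partial sums gives weakly continuous functionals that converge to it pointwise on \<open>H\<close>. Uniqueness
  of Fourier coefficients in \<open>L\<^sup>1\<close>, by Stone--Weierstrass on the torus, shows that the weak gradient, defined by a choice
  operator, is determined almost everywhere.\<close>

section \<open>Trigonometric functions on the cell\<close>

text \<open>The cut-offs must come off with bounds uniform in their scale: for
  \<open>\<bar>h\<bar> \<le> 1\<close> the product rule adds a term of size at most
  \<open>4 / (n + 1)\<close>. Two features of the definitions shape the rest. In the evolution
  equation the gradient is that of a multiple of \<open>v\<close> whose scalar depends on
  \<open>u\<close>, and the choice operator selects a gradient anew for each multiple; only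
  uniqueness almost everywhere lets the scalar out of the integral. Moreover the weak topology tests
  against divergence-free fields only, while a Fourier coefficient of one component pairs
  \<open>u\<close> with a field that need not be divergence-free; the Leray projection of that field
  has the same pairing with every \<open>u\<close> in \<open>Hsp\<close>. Since condition (i) admits
  bounded functionals only, the quadratic term is clipped before the limit in the frequencies and
  unclipped afterwards; in this measurability argument the energy bound enters with the second
  limit. Measurability is no formality: a Bochner integral without integrability is 0 by convention,
  so limits and sums of time integrals cannot be formed without it.\<close>

abbreviation cell_measure :: "(real^2) measure" where
  "cell_measure \<equiv> lebesgue_on Qcell"

definition freq :: "int \<times> int \<Rightarrow> 2 \<Rightarrow> real" where
  "freq k j = real_of_int (if j = 1 then fst k else snd k)"

definition phase :: "int \<times> int \<Rightarrow> real^2 \<Rightarrow> real" where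
  "phase k x = 2 * pi * (\<Sum>j\<in>UNIV. freq k j * x $ j)"

text \<open>The offset \<open>b\<close> keeps sines and cosines in one real family that
  differentiation preserves: each derivative advances \<open>b\<close> by
  \<open>pi/2\<close>.\<close>

definition trig :: "int \<times> int \<Rightarrow> real \<Rightarrow> real^2 \<Rightarrow> real" where
  "trig k b x = cos (phase k x + b)"

definition mode :: "int \<times> int \<Rightarrow> real^2 \<Rightarrow> complex" where
  "mode k x = cis (phase k x)"

lemma Qcell_eq_cbox: "Qcell = cbox 0 1"
  by (auto simp: Qcell_def mem_box_cart)

lemma Qcell_lmeasurable [simp, intro]: "Qcell \<in> lmeasurable"
  by (simp add: Qcell_eq_cbox)

lemma Qcell_sets [simp, intro]: "Qcell \<in> sets lebesgue"
  by (simp add: Qcell_eq_cbox)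

lemma measure_Qcell [simp]: "measure lebesgue Qcell = 1"
proof -
  have "measure lborel (cbox 0 (1::real^2)) = (\<Prod>i\<in>UNIV. (1::real^2)$i - (0::real^2)$i)"
    by (rule content_cbox_cart) (auto simp: interval_ne_empty_cart)
  then show ?thesis by (simp add: Qcell_eq_cbox measure_completion)
qed

lemma emeasure_Qcell: "emeasure lebesgue Qcell = 1"
  using emeasure_eq_measure2[OF Qcell_lmeasurable] by simp

lemma prob_space_cell: "prob_space cell_measure"
  by standard (simp add: emeasure_restrict_space emeasure_Qcell)

interpretation cell: prob_space cell_measure
  by (rule prob_space_cell)

lemma measurable_cell_continuous:
  fixes f :: "real^2 \<Rightarrow> 'b::euclidean_space"
  assumes "continuous_on UNIV f"
  shows "f \<in> borel_measurable cell_measure"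
  using continuous_imp_measurable_on_sets_lebesgue[of Qcell f] assms continuous_on_subset by blast

lemma integrable_cell_continuous:
  fixes f :: "real^2 \<Rightarrow> 'b::euclidean_space"
  assumes "continuous_on UNIV f"
  shows "integrable cell_measure f"
proof -
  have "f absolutely_integrable_on cbox 0 1"
    by (rule absolutely_integrable_continuous) (use assms continuous_on_subset in blast)
  then show ?thesis
    by (simp add: Qcell_eq_cbox integrable_restrict_space set_integrable_def)
qed

lemma integral_cell_continuous:
  fixes f :: "real^2 \<Rightarrow> real"
  assumes "continuous_on UNIV f"
  shows "(\<integral>x. f x \<partial>cell_measure) = integral (cbox 0 1) f"
  using lebesgue_integral_eq_integral[OF integrable_cell_continuous[OF assms]]
  by (simp add: Qcell_eq_cbox)

lemma bounded_continuous_cell: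
  fixes f :: "real^2 \<Rightarrow> 'b::real_normed_vector"
  assumes "continuous_on UNIV f"
  obtains B where "B > 0" "\<And>x. x \<in> Qcell \<Longrightarrow> norm (f x) \<le> B"
proof -
  have "compact (f ` Qcell)"
    unfolding Qcell_eq_cbox
    by (intro compact_continuous_image compact_cbox continuous_on_subset[OF assms]) auto
  then show ?thesis
    using that compact_imp_bounded bounded_pos by (metis imageI)
qed

lemma phase_shift: "phase k (x + h *\<^sub>R axis j 1) = phase k x + 2 * pi * freq k j * h"
  by (auto simp: phase_def sum_2 axis_def algebra_simps) (use exhaust_2 in force)+

lemma phase_add: "phase (k + l) x = phase k x + phase l x"
  by (simp add: phase_def freq_def sum_2 algebra_simps)

lemma phase_uminus: "phase (- k) x = - phase k x"
  by (simp add: phase_def freq_def sum_2 algebra_simps)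

lemma continuous_phase [continuous_intros]: "continuous_on S (phase k)"
  unfolding phase_def by (intro continuous_intros)

lemma continuous_trig [continuous_intros]: "continuous_on S (trig k b)"
  unfolding trig_def by (intro continuous_intros)

lemma continuous_mode [continuous_intros]: "continuous_on S (mode k)"
  unfolding mode_def by (intro continuous_intros)

lemma norm_mode [simp]: "cmod (mode k x) = 1"
  by (simp add: mode_def)

lemma mode_0 [simp]: "mode 0 x = 1"
  by (simp add: mode_def phase_def freq_def zero_prod_def if_distrib[of real_of_int] sum_2)

lemma mode_add: "mode (k + l) x = mode k x * mode l x"
  by (simp add: mode_def phase_add cis_mult)

lemma mode_uminus: "mode (- k) x = cnj (mode k x)"
  by (simp add: mode_def phase_uminus cis_cnj)

lemma mode_trig: "mode k x = Complex (trig k 0 x) (trig k (- (pi/2)) x)"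
  by (simp add: mode_def trig_def complex_eq_iff cos_diff)

lemma trig_periodic: "periodic (trig k b)"
  unfolding periodic_def
proof (intro allI)
  fix x :: "real^2" and i
  have "trig k b (x + axis i 1) = cos (phase k x + b + 2 * pi * freq k i)"
    using phase_shift[of k x 1 i] by (simp add: trig_def algebra_simps)
  also have "\<dots> = cos (phase k x + b)"
    unfolding cos_add freq_def by simp
  finally show "trig k b (x + axis i 1) = trig k b x" by (simp add: trig_def)
qed

lemma has_real_derivative_trig:
  "((\<lambda>h. trig k b (x + h *\<^sub>R axis j 1)) has_real_derivative
     2 * pi * freq k j * trig k (b + pi/2) x) (at 0)"
  unfolding trig_def phase_shift
  by (auto intro!: derivative_eq_intros simp: cos_add sin_add algebra_simps)

lemma test_fun_trig: "test_fun (trig k b)"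
proof -
  \<comment> \<open>The iterated derivatives of a mode are explicit, so one formula supplies the
    whole family that \<open>smooth_scalar\<close> asks for.\<close>
  define F where "F xs x = (\<Prod>j\<leftarrow>xs. 2 * pi * freq k j) * trig k (b + real (length xs) * (pi/2)) x"
    for xs x
  have "((\<lambda>h. F xs (x + h *\<^sub>R axis i 1)) has_real_derivative F (i # xs) x) (at 0)" for xs i x
  proof -
    have e: "F (i # xs) x = (\<Prod>j\<leftarrow>xs. 2 * pi * freq k j) *
       (2 * pi * freq k i * trig k ((b + real (length xs) * (pi/2)) + pi/2) x)"
      by (simp add: F_def algebra_simps add_divide_distrib)
    show ?thesis
      unfolding e unfolding F_def
      by (intro DERIV_cmult has_real_derivative_trig)
  qed
  moreover have "continuous_on UNIV (F xs)" for xs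
    unfolding F_def by (intro continuous_intros)
  moreover have "F [] = trig k b"
    by (auto simp: F_def)
  ultimately show ?thesis
    unfolding test_fun_def smooth_scalar_def using trig_periodic by blast
qed

lemma pderiv2_trig: "pderiv2 j (trig k b) x = 2 * pi * freq k j * trig k (b + pi/2) x"
  unfolding pderiv2_def by (rule DERIV_imp_deriv[OF has_real_derivative_trig])

section \<open>Test functions and integration by parts on the torus\<close>

lemma test_fun_continuous: "test_fun \<phi> \<Longrightarrow> continuous_on UNIV \<phi>"
  unfolding test_fun_def smooth_scalar_def by metis

lemma test_fun_derivative:
  assumes "test_fun \<phi>"
  shows "((\<lambda>h. \<phi> (x + h *\<^sub>R axis j 1)) has_real_derivative pderiv2 j \<phi> x) (at 0)"
    and "continuous_on UNIV (pderiv2 j \<phi>)"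
proof -
  obtain F where F: "F [] = \<phi>" "\<And>xs. continuous_on UNIV (F xs)"
    "\<And>xs i x. ((\<lambda>h. F xs (x + h *\<^sub>R axis i 1)) has_real_derivative F (i # xs) x) (at 0)"
    using assms unfolding test_fun_def smooth_scalar_def by blast
  have *: "((\<lambda>h. \<phi> (x + h *\<^sub>R axis j 1)) has_real_derivative F [j] x) (at 0)" for x
    using F(3)[of "[]"] F(1) by simp
  then have eq: "pderiv2 j \<phi> = F [j]"
    unfolding pderiv2_def by (auto intro: DERIV_imp_deriv)
  show "((\<lambda>h. \<phi> (x + h *\<^sub>R axis j 1)) has_real_derivative pderiv2 j \<phi> x) (at 0)"
    using * eq by simp
  show "continuous_on UNIV (pderiv2 j \<phi>)" using F(2) eq by simp
qed

text \<open>The translated cell is cut along \<open>x $ j = 1\<close>. The piece beyond the cut,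
  moved back by one period, fills exactly the slab that the translation has uncovered.\<close>

lemma integral_cbox_translation_periodic:
  fixes f :: "real^2 \<Rightarrow> real"
  assumes f: "continuous_on UNIV f" and per: "periodic f" and s: "0 \<le> s" "s \<le> 1"
  shows "integral (cbox 0 1) (\<lambda>x. f (x + s *\<^sub>R axis j 1)) = integral (cbox 0 1) f"
proof -
  let ?e = "axis j (1::real) :: real^2"
  have int: "f integrable_on cbox a b" for a b
    by (rule integrable_continuous[OF continuous_on_subset[OF f]]) auto
  have basis: "?e \<in> Basis" by (simp add: axis_in_Basis_iff)
  have inner: "x \<bullet> ?e = x $ j" for x :: "real^2" by (simp add: inner_axis)
  have mem: "x \<in> cbox (a *\<^sub>R ?e) (1 + b *\<^sub>R ?e) \<longleftrightarrow>
      (a \<le> x $ j \<and> x $ j \<le> 1 + b) \<and> (\<forall>i. i \<noteq> j \<longrightarrow> 0 \<le> x $ i \<and> x $ i \<le> 1)" for a b x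
  proof -
    have all: "(\<forall>i. P i) \<longleftrightarrow> P j \<and> (\<forall>i. i \<noteq> j \<longrightarrow> P i)" for P by metis
    show ?thesis
      unfolding mem_box_cart by (subst all) (simp add: axis_def)
  qed
  note mem' = mem[where a=0 and b=0, simplified] mem[where a=1, simplified] mem
  have "integral (cbox 0 1) (\<lambda>x. f (x + s *\<^sub>R ?e)) = integral (cbox (s *\<^sub>R ?e) (1 + s *\<^sub>R ?e)) f"
    using integral_shift_cbox[of "s *\<^sub>R ?e" "s *\<^sub>R ?e" "1 + s *\<^sub>R ?e" f] by simp
  also have "\<dots> = integral (cbox (s *\<^sub>R ?e) (1 + s *\<^sub>R ?e) \<inter> {x. x \<bullet> ?e \<le> 1}) f
      + integral (cbox (s *\<^sub>R ?e) (1 + s *\<^sub>R ?e) \<inter> {x. x \<bullet> ?e \<ge> 1}) f"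
    by (rule integral_split[OF int basis])
  also have "cbox (s *\<^sub>R ?e) (1 + s *\<^sub>R ?e) \<inter> {x. x \<bullet> ?e \<le> 1} = cbox 0 1 \<inter> {x. x \<bullet> ?e \<ge> s}"
    using s by (auto simp: mem' inner)
  also have "cbox (s *\<^sub>R ?e) (1 + s *\<^sub>R ?e) \<inter> {x. x \<bullet> ?e \<ge> 1} = cbox ?e (1 + s *\<^sub>R ?e)"
    using s by (auto simp: mem' inner)
  also have "integral (cbox ?e (1 + s *\<^sub>R ?e)) f
      = integral (cbox (?e - ?e) (1 + s *\<^sub>R ?e - ?e)) (\<lambda>x. f (x + ?e))"
    by (rule integral_shift_cbox[symmetric])
  also have "(\<lambda>x. f (x + ?e)) = f"
    using per by (simp add: periodic_def)
  \<comment> \<open>In direction \<open>j\<close> this box reaches from 0 to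
    \<open>s = 1 + (s - 1)\<close>, hence the instance \<open>b = s - 1\<close> of
    \<open>mem\<close>.\<close>
  also have "cbox (?e - ?e) (1 + s *\<^sub>R ?e - ?e) = cbox 0 1 \<inter> {x. x \<bullet> ?e \<le> s}"
    using s mem[where a=0 and b="s - 1"] by (auto simp: mem' inner algebra_simps)
  also have "integral (cbox 0 1 \<inter> {x. x \<bullet> ?e \<ge> s}) f + integral (cbox 0 1 \<inter> {x. x \<bullet> ?e \<le> s}) f
      = integral (cbox 0 1) f"
    using integral_split[OF int basis, of 0 1 s] by simp
  finally show ?thesis .
qed

text \<open>Averaging the derivative over all translates in direction \<open>j\<close> and exchanging the
  integrals turns the claim into \<open>\<psi> (x + e\<^sub>j) = \<psi> x\<close>.\<close>

lemma integral_cell_derivative_periodic: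
  fixes \<psi> \<psi>' :: "real^2 \<Rightarrow> real"
  assumes cont: "continuous_on UNIV \<psi>'" and per: "periodic \<psi>"
    and der: "\<And>x. ((\<lambda>h. \<psi> (x + h *\<^sub>R axis j 1)) has_real_derivative \<psi>' x) (at 0)"
  shows "(\<integral>x. \<psi>' x \<partial>cell_measure) = 0"
proof -
  let ?e = "axis j (1::real) :: real^2"
  \<comment> \<open>The translation lemma is applied to the derivative, so its periodicity is
    derived here, from uniqueness of derivatives.\<close>
  have per': "periodic \<psi>'"
    unfolding periodic_def
  proof (intro allI)
    fix x :: "real^2" and i
    have "(\<lambda>h. \<psi> (x + axis i 1 + h *\<^sub>R ?e)) = (\<lambda>h. \<psi> (x + h *\<^sub>R ?e))"
    proof
      fix h
      have "x + axis i 1 + h *\<^sub>R ?e = (x + h *\<^sub>R ?e) + axis i 1" by simp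
      then show "\<psi> (x + axis i 1 + h *\<^sub>R ?e) = \<psi> (x + h *\<^sub>R ?e)"
        using per by (simp only: periodic_def)
    qed
    then show "\<psi>' (x + axis i 1) = \<psi>' x"
      using der[of "x + axis i 1"] der[of x] by (metis DERIV_unique)
  qed
  have zero: "integral (cbox 0 1) (\<lambda>s::real. \<psi>' (x + s *\<^sub>R ?e)) = 0" for x
  proof -
    have "((\<lambda>s. \<psi> (x + s *\<^sub>R ?e)) has_real_derivative \<psi>' (x + s *\<^sub>R ?e)) (at s)" for s
      using der[of "x + s *\<^sub>R ?e"] DERIV_shift[of "\<lambda>t. \<psi> (x + t *\<^sub>R ?e)" _ 0 s]
      by (simp add: algebra_simps)
    then have "((\<lambda>s. \<psi> (x + s *\<^sub>R ?e)) has_vector_derivative \<psi>' (x + s *\<^sub>R ?e)) (at s within {0..1})" for s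
      using has_real_derivative_iff_has_vector_derivative has_vector_derivative_at_within by blast
    then have "((\<lambda>s. \<psi>' (x + s *\<^sub>R ?e)) has_integral
       (\<psi> (x + 1 *\<^sub>R ?e) - \<psi> (x + 0 *\<^sub>R ?e))) {0..1}"
      by (intro fundamental_theorem_of_calculus) auto
    then show ?thesis
      using per by (auto simp: periodic_def integral_unique)
  qed
  have "integral (cbox 0 1) \<psi>' = integral (cbox 0 (1::real)) (\<lambda>s. integral (cbox 0 1) \<psi>')"
    by simp
  also have "\<dots> = integral (cbox 0 (1::real)) (\<lambda>s. integral (cbox 0 1) (\<lambda>x. \<psi>' (x + s *\<^sub>R ?e)))"
    by (rule integral_cong) (simp add: integral_cbox_translation_periodic[OF cont per'])
  also have "\<dots> = integral (cbox 0 1) (\<lambda>x. integral (cbox 0 (1::real)) (\<lambda>s. \<psi>' (x + s *\<^sub>R ?e)))"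
    by (rule integral_swap_continuous)
      (auto intro!: continuous_intros continuous_on_compose2[OF cont] simp: split_beta)
  also have "\<dots> = 0"
    by (simp only: zero integral_0)
  finally show ?thesis
    by (simp add: integral_cell_continuous[OF cont])
qed

text \<open>The product of a mode and a test function is periodic, so its derivative integrates to 0
  and no boundary term appears.\<close>

lemma integral_trig_parts:
  assumes "test_fun \<phi>"
  shows "(\<integral>x. trig k b x * pderiv2 j \<phi> x \<partial>cell_measure) =
    - (2 * pi * freq k j) * (\<integral>x. trig k (b + pi/2) x * \<phi> x \<partial>cell_measure)"
proof -
  note cont = test_fun_continuous[OF assms] test_fun_derivative(2)[OF assms]
  let ?\<psi>' = "\<lambda>x. trig k b x * pderiv2 j \<phi> x + 2 * pi * freq k j * (trig k (b + pi/2) x * \<phi> x)"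
  have "(\<integral>x. ?\<psi>' x \<partial>cell_measure) = 0"
  proof (rule integral_cell_derivative_periodic)
    show "continuous_on UNIV ?\<psi>'"
      by (intro continuous_intros cont)
    show "periodic (\<lambda>x. trig k b x * \<phi> x)"
      using assms trig_periodic by (auto simp: test_fun_def periodic_def)
    show "((\<lambda>h. trig k b (x + h *\<^sub>R axis j 1) * \<phi> (x + h *\<^sub>R axis j 1)) has_real_derivative ?\<psi>' x) (at 0)"
      for x
      using DERIV_mult[OF has_real_derivative_trig[of k b x j] test_fun_derivative(1)[OF assms, of x j]]
      by (simp add: algebra_simps)
  qed
  moreover have "(\<integral>x. ?\<psi>' x \<partial>cell_measure) = (\<integral>x. trig k b x * pderiv2 j \<phi> x \<partial>cell_measure) +
     2 * pi * freq k j * (\<integral>x. trig k (b + pi/2) x * \<phi> x \<partial>cell_measure)"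
    by (subst Bochner_Integration.integral_add)
       (auto intro!: integrable_cell_continuous continuous_intros cont)
  ultimately show ?thesis by simp
qed

lemma integral_trig:
  assumes "k \<noteq> 0"
  shows "(\<integral>x. trig k b x \<partial>cell_measure) = 0"
proof -
  obtain j where j: "freq k j \<noteq> 0"
  proof (cases "fst k = 0")
    case True
    then have "freq k 2 \<noteq> 0" using assms by (simp add: freq_def prod_eq_iff)
    then show ?thesis by (rule that)
  next
    case False
    then have "freq k 1 \<noteq> 0" by (simp add: freq_def)
    then show ?thesis by (rule that)
  qed
  \<comment> \<open>Up to the nonzero factor \<open>2 * pi * freq k j\<close>, the mode is itself a
    derivative, namely that of the mode with offset \<open>b - pi/2\<close>.\<close>
  have "(\<integral>x. 2 * pi * freq k j * trig k ((b - pi/2) + pi/2) x \<partial>cell_measure) = 0"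
    by (rule integral_cell_derivative_periodic[OF _ trig_periodic has_real_derivative_trig])
       (intro continuous_intros)
  then show ?thesis using j by simp
qed

lemma integral_Complex:
  fixes f g :: "'a \<Rightarrow> real"
  assumes "integrable M f" "integrable M g"
  shows "(\<integral>x. Complex (f x) (g x) \<partial>M) = Complex (\<integral>x. f x \<partial>M) (\<integral>x. g x \<partial>M)"
    and "integrable M (\<lambda>x. Complex (f x) (g x))"
  using assms by (simp_all add: Complex_eq)

lemma integral_mode: "(\<integral>x. mode k x \<partial>cell_measure) = (if k = 0 then 1 else 0)"
proof (cases "k = 0")
  case True
  then show ?thesis using cell.prob_space by simp
next
  case False
  then show ?thesis
    unfolding mode_trig
    by (subst integral_Complex)
       (auto simp: integral_trig complex_eq_iff intro!: integrable_cell_continuous continuous_intros)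
qed

lemma integral_mode_parts:
  assumes "test_fun \<phi>"
  shows "(\<integral>x. mode k x * of_real (pderiv2 j \<phi> x) \<partial>cell_measure) =
    - (2 * pi * \<i> * freq k j) * (\<integral>x. mode k x * of_real (\<phi> x) \<partial>cell_measure)"
proof -
  note cont = test_fun_continuous[OF assms] test_fun_derivative(2)[OF assms]
  have 1: "mode k x * of_real (pderiv2 j \<phi> x) =
     Complex (trig k 0 x * pderiv2 j \<phi> x) (trig k (- (pi/2)) x * pderiv2 j \<phi> x)" for x
    by (simp add: mode_trig complex_eq_iff)
  \<comment> \<open>The offsets 0 and \<open>pi/2\<close> are those that integration by parts
    produces from \<open>- (pi/2)\<close> and 0; hence the sign in the imaginary part.\<close>
  have 2: "mode k x * of_real (\<phi> x) =
     Complex (trig k 0 x * \<phi> x) (- (trig k (pi/2) x * \<phi> x))" for x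
    by (simp add: mode_trig complex_eq_iff trig_def cos_add cos_diff)
  note int = integrable_cell_continuous continuous_intros cont
  show ?thesis
    unfolding 1 2
    apply (subst integral_Complex, (auto intro!: int)[2])+
    using integral_trig_parts[OF assms, of k 0 j] integral_trig_parts[OF assms, of k "-(pi/2)" j]
    by (simp add: complex_eq_iff)
qed

section \<open>Stone--Weierstrass on the torus and uniqueness of Fourier coefficients\<close>

definition trig_poly :: "(real^2 \<Rightarrow> complex) \<Rightarrow> bool" where
  "trig_poly p \<longleftrightarrow> (\<exists>K c. finite K \<and> p = (\<lambda>x. \<Sum>k\<in>K. c k * mode k x))"

lemma trig_poly_cmult_mode: "trig_poly (\<lambda>x. c * mode k x)"
  unfolding trig_poly_def by (rule exI[of _ "{k}"], rule exI[of _ "\<lambda>_. c"]) simp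

lemma trig_poly_add:
  assumes "trig_poly p" "trig_poly q"
  shows "trig_poly (\<lambda>x. p x + q x)"
proof -
  obtain K c L d where "finite K" "finite L"
    and p: "p = (\<lambda>x. \<Sum>k\<in>K. c k * mode k x)" and q: "q = (\<lambda>x. \<Sum>k\<in>L. d k * mode k x)"
    using assms unfolding trig_poly_def by blast
  \<comment> \<open>Extension by 0 to the union of the frequency sets allows addition term by
    term.\<close>
  define c' d' where "c' k = (if k \<in> K then c k else 0)" and "d' k = (if k \<in> L then d k else 0)" for k
  have "p x = (\<Sum>k\<in>K \<union> L. c' k * mode k x)" "q x = (\<Sum>k\<in>K \<union> L. d' k * mode k x)" for x
    unfolding p q c'_def d'_def using \<open>finite K\<close> \<open>finite L\<close>
    by (auto intro!: sum.mono_neutral_cong_left)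
  then have "(\<lambda>x. p x + q x) = (\<lambda>x. \<Sum>k\<in>K \<union> L. (c' k + d' k) * mode k x)"
    by (simp add: sum.distrib algebra_simps)
  then show ?thesis
    unfolding trig_poly_def using \<open>finite K\<close> \<open>finite L\<close> by (metis finite_UnI)
qed

lemma trig_poly_sum:
  "finite I \<Longrightarrow> (\<And>i. i \<in> I \<Longrightarrow> trig_poly (p i)) \<Longrightarrow> trig_poly (\<lambda>x. \<Sum>i\<in>I. p i x)"
proof (induction I rule: finite_induct)
  case empty
  show ?case using trig_poly_cmult_mode[of 0] by simp
next
  case (insert i I)
  then show ?case by (auto intro: trig_poly_add)
qed

lemma trig_poly_mult:
  assumes "trig_poly p" "trig_poly q"
  shows "trig_poly (\<lambda>x. p x * q x)"
proof -
  obtain K c L d where fin: "finite K" "finite L"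
    and p: "p = (\<lambda>x. \<Sum>k\<in>K. c k * mode k x)" and q: "q = (\<lambda>x. \<Sum>k\<in>L. d k * mode k x)"
    using assms unfolding trig_poly_def by blast
  have "(\<lambda>x. p x * q x) = (\<lambda>x. \<Sum>k\<in>K. \<Sum>l\<in>L. (c k * d l) * mode (k + l) x)"
    unfolding p q by (simp add: sum_product mode_add algebra_simps)
  then show ?thesis
    using fin by (auto intro!: trig_poly_sum trig_poly_cmult_mode)
qed

lemma trig_poly_const: "trig_poly (\<lambda>x. c)"
  using trig_poly_cmult_mode[of c 0] by simp

lemma trig_poly_cmult: "trig_poly p \<Longrightarrow> trig_poly (\<lambda>x. c * p x)"
  by (intro trig_poly_mult trig_poly_const)

lemma continuous_trig_poly: "trig_poly p \<Longrightarrow> continuous_on S p"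
  unfolding trig_poly_def by (auto intro!: continuous_intros)

text \<open>The torus as a compact subset of a Euclidean space, where the Stone--Weierstrass theorem
  applies.\<close>

definition torus_map :: "real^2 \<Rightarrow> complex \<times> complex" where
  "torus_map x = (mode (1, 0) x, mode (0, 1) x)"

lemma continuous_torus_map: "continuous_on S torus_map"
  unfolding torus_map_def by (intro continuous_intros)

text \<open>A linear functional on \<open>complex \<times> complex\<close> is a real combination of
  real and imaginary parts. On the torus these are combinations of a mode and its conjugate, which
  is the mode of opposite frequency; products of modes add frequencies.\<close>

lemma trig_poly_polynomial_torus:
  assumes "real_polynomial_function P"
  shows "trig_poly (\<lambda>x. of_real (P (torus_map x)))"
  using assms
proof (induction rule: real_polynomial_function.induct)
  case (linear f)
  interpret bounded_linear f by fact
  have lin: "f (z, w) = Re z * f (1, 0) + Im z * f (\<i>, 0) + Re w * f (0, 1) + Im w * f (0, \<i>)" for z w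
  proof -
    have "(z, w) = Re z *\<^sub>R (1, 0) + Im z *\<^sub>R (\<i>, 0) + Re w *\<^sub>R (0, 1) + Im w *\<^sub>R (0, \<i>)"
      by (simp add: complex_eq_iff)
    then have "f (z, w) = f (Re z *\<^sub>R (1, 0) + Im z *\<^sub>R (\<i>, 0) + Re w *\<^sub>R (0, 1) + Im w *\<^sub>R (0, \<i>))"
      by (rule arg_cong)
    then show ?thesis
      by (simp only: add scaleR real_scaleR_def)
  qed
  have re: "complex_of_real (Re z * r) = (of_real r / 2) * z + (of_real r / 2) * cnj z"
    and im: "complex_of_real (Im z * r) = (- \<i> * of_real r / 2) * z + (\<i> * of_real r / 2) * cnj z" for z r
    by (simp_all add: complex_eq_iff)
  have eq: "f (torus_map x) = Re (mode (1, 0) x) * f (1, 0) + Im (mode (1, 0) x) * f (\<i>, 0)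
      + Re (mode (0, 1) x) * f (0, 1) + Im (mode (0, 1) x) * f (0, \<i>)" for x
    unfolding torus_map_def by (rule lin)
  show ?case
    unfolding eq of_real_add re im mode_uminus[symmetric]
    by (intro trig_poly_add trig_poly_cmult_mode)
next
  case (const c)
  show ?case by (rule trig_poly_const)
next
  case (add f g)
  then show ?case using trig_poly_add[OF add.IH] by simp
next
  case (mult f g)
  then show ?case using trig_poly_mult[OF mult.IH] by simp
qed

text \<open>On the closed cell opposite edges have the same image under \<open>torus_map\<close>.
  Dropping one edge of each pair makes the map injective and costs only a null set.\<close>

definition half_open_cell :: "(real^2) set" where
  "half_open_cell = {x. \<forall>i. 0 \<le> x $ i \<and> x $ i < 1}"

lemma half_open_cell_sets [simp]: "half_open_cell \<in> sets lebesgue"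
proof -
  have "half_open_cell = (\<Inter>i\<in>UNIV. {x. 0 \<le> x $ i} \<inter> {x. x $ i < 1})"
    by (auto simp: half_open_cell_def)
  moreover have "(\<Inter>i\<in>UNIV. {x. 0 \<le> x $ i} \<inter> {x::real^2. x $ i < 1}) \<in> sets borel"
    by (intro sets.finite_INT sets.Int borel_closed borel_open closed_Collect_le open_Collect_less
        continuous_intros) auto
  ultimately show ?thesis
    by (simp add: sets_completionI_sets)
qed

lemma half_open_cell_subset: "half_open_cell \<subseteq> Qcell"
  by (auto simp: half_open_cell_def Qcell_def intro: less_imp_le)

lemma AE_half_open_cell: "AE x in cell_measure. x \<in> half_open_cell"
proof -
  have "Qcell - half_open_cell \<subseteq> cbox 0 1 - box 0 1"
    by (auto simp: Qcell_eq_cbox half_open_cell_def mem_box_cart)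
  then have "negligible (Qcell - half_open_cell)"
    using negligible_frontier_interval[of "0::real^2" 1] negligible_subset by blast
  then have "Qcell - half_open_cell \<in> null_sets lebesgue"
    by (simp add: negligible_iff_null_sets)
  then have "AE x in lebesgue. x \<in> Qcell \<longrightarrow> x \<in> half_open_cell"
    by (rule AE_I') auto
  then show ?thesis
    by (simp add: AE_restrict_space_iff)
qed

lemma inj_torus_map: "inj_on torus_map half_open_cell"
proof
  fix x y
  assume xy: "x \<in> half_open_cell" "y \<in> half_open_cell" "torus_map x = torus_map y"
  have *: "a = b" if eq: "cis (2 * pi * a) = cis (2 * pi * b)" "0 \<le> a" "a < 1" "0 \<le> b" "b < 1" for a b
  proof -
    obtain n :: int where n: "2 * pi * a = 2 * pi * b + 2 * pi * n"
      using eq sin_cos_eq_iff[of "2*pi*a" "2*pi*b"] by (metis cis.sel)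
    then have "2 * pi * a = 2 * pi * (b + n)" by (simp add: algebra_simps)
    then have "a = b + n" by simp
    then have "n = 0" using that by linarith
    then show ?thesis using \<open>a = b + n\<close> by simp
  qed
  have "x $ 1 = y $ 1" "x $ 2 = y $ 2"
    using xy by (intro *; simp add: torus_map_def mode_def phase_def freq_def sum_2 half_open_cell_def)+
  then show "x = y" by (simp add: vec_eq_iff forall_2)
qed

text \<open>The tent \<open>F n\<close> is 1 on the compact image of \<open>K\<close> and 0 at
  distance \<open>1/n\<close> or more from it. Stone--Weierstrass on the product of two circles
  replaces it by a polynomial with error below \<open>1 / (n + 1)\<close>, which gives the bound
  \<open>2 = 1 + 1\<close>. Injectivity of \<open>torus_map\<close> keeps the other points of the
  half-open cell off the image of \<open>K\<close>.\<close>

lemma trig_poly_tendsto_indicator: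
  assumes K: "compact K" "K \<subseteq> half_open_cell"
  obtains p :: "nat \<Rightarrow> real^2 \<Rightarrow> real" where
    "\<And>n. trig_poly (\<lambda>x. of_real (p n x))" "\<And>n x. \<bar>p n x\<bar> \<le> 2"
    "\<And>x. x \<in> half_open_cell \<Longrightarrow> (\<lambda>n. p n x) \<longlonglongrightarrow> indicator K x"
proof (cases "K = {}")
  \<comment> \<open>The empty set is treated apart because \<open>infdist\<close> to it is 0 by
    convention, so that the tent would be 1 everywhere.\<close>
  case True
  show thesis
    by (rule that[of "\<lambda>_ _. 0"]) (use True trig_poly_const[of 0] in auto)
next
  case False
  define C where "C = torus_map ` K"
  define S where "S = sphere (0::complex) 1 \<times> sphere (0::complex) 1"
  define F where "F n z = max 0 (1 - real n * infdist z C)" for n z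
  have C: "closed C" "C \<noteq> {}"
    using K False unfolding C_def
    by (auto intro!: compact_imp_closed compact_continuous_image continuous_torus_map)
  have S: "compact S"
    unfolding S_def by (intro compact_Times compact_sphere)
  have "continuous_on S (F n)" for n
    unfolding F_def by (intro continuous_intros)
  then have "\<exists>g. real_polynomial_function g \<and> (\<forall>z\<in>S. \<bar>F n z - g z\<bar> < 1 / real (Suc n))" for n
    using Stone_Weierstrass_real_polynomial_function[OF S, of "F n" "1 / real (Suc n)"]
    by (metis of_nat_0_less_iff zero_less_Suc zero_less_divide_1_iff)
  then obtain g where g: "\<And>n. real_polynomial_function (g n)"
    "\<And>n z. z \<in> S \<Longrightarrow> \<bar>F n z - g n z\<bar> < 1 / real (Suc n)"
    by metis
  have inS: "torus_map x \<in> S" for x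
    by (simp add: S_def torus_map_def)
  have F01: "0 \<le> F n z" "F n z \<le> 1" for n z
    unfolding F_def by (auto simp: infdist_nonneg)
  show thesis
  proof (rule that[of "\<lambda>n x. g n (torus_map x)"])
    show "trig_poly (\<lambda>x. of_real (g n (torus_map x)))" for n
      by (rule trig_poly_polynomial_torus[OF g(1)])
    show "\<bar>g n (torus_map x)\<bar> \<le> 2" for n x
    proof -
      have "1 / real (Suc n) \<le> 1" by simp
      then show ?thesis
        using g(2)[OF inS[of x], of n] F01[of n "torus_map x"] by linarith
    qed
    show "(\<lambda>n. g n (torus_map x)) \<longlonglongrightarrow> indicator K x" if x: "x \<in> half_open_cell" for x
    proof -
      have "(\<lambda>n. F n (torus_map x)) \<longlonglongrightarrow> indicator K x"
      proof (cases "x \<in> K")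
        case True
        then show ?thesis by (simp add: F_def C_def)
      next
        case False
        then have "torus_map x \<notin> C"
          using x K inj_torus_map unfolding C_def by (meson inj_on_image_mem_iff)
        then have d: "infdist (torus_map x) C > 0"
          using C by (metis in_closed_iff_infdist_zero infdist_nonneg less_eq_real_def)
        obtain m :: nat where m: "1 / infdist (torus_map x) C < m"
          using reals_Archimedean2 by blast
        have "F n (torus_map x) = 0" if "n \<ge> m" for n
        proof -
          have "1 / infdist (torus_map x) C < n" using m that by linarith
          then show ?thesis using d by (simp add: F_def field_simps)
        qed
        then have "\<forall>\<^sub>F n in sequentially. F n (torus_map x) = 0"
          using eventually_sequentially by blast
        then show ?thesis using False by (simp add: tendsto_eventually)
      qed
      moreover have "(\<lambda>n. F n (torus_map x) - g n (torus_map x)) \<longlonglongrightarrow> 0"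
      proof (rule Lim_null_comparison)
        show "\<forall>\<^sub>F n in sequentially. norm (F n (torus_map x) - g n (torus_map x)) \<le> 1 / real (Suc n)"
          using g(2)[OF inS] by (intro always_eventually allI) (simp only: real_norm_def less_imp_le)
        show "(\<lambda>n. 1 / real (Suc n)) \<longlonglongrightarrow> 0"
          using LIMSEQ_inverse_real_of_nat by (simp add: inverse_eq_divide)
      qed
      ultimately show ?thesis
        using tendsto_diff by fastforce
    qed
  qed
qed

section \<open>Uniqueness of Fourier coefficients for integrable functions\<close>

lemma integrable_cell_mult_bounded:
  fixes f g :: "real^2 \<Rightarrow> 'a::{real_normed_field, euclidean_space}"
  assumes f: "integrable cell_measure f" and g: "g \<in> borel_measurable cell_measure"
    and B: "\<And>x. x \<in> Qcell \<Longrightarrow> norm (g x) \<le> B"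
  shows "integrable cell_measure (\<lambda>x. f x * g x)"
proof (rule Bochner_Integration.integrable_bound)
  show "integrable cell_measure (\<lambda>x. B * norm (f x))"
    using f by auto
  show "(\<lambda>x. f x * g x) \<in> borel_measurable cell_measure"
    using f g by (intro borel_measurable_times) auto
  show "AE x in cell_measure. norm (f x * g x) \<le> norm (B * norm (f x))"
  proof (rule AE_I2)
    fix x assume "x \<in> space cell_measure"
    then have B': "norm (g x) \<le> B" using B by simp
    then have "B \<ge> 0" using norm_ge_zero order_trans by blast
    then show "norm (f x * g x) \<le> norm (B * norm (f x))"
      using mult_right_mono[OF B', of "norm (f x)"]
      by (simp add: norm_mult mult.commute abs_of_nonneg)
  qed
qed

lemma integrable_cell_mult_continuous:
  fixes f g :: "real^2 \<Rightarrow> 'a::{real_normed_field, euclidean_space}"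
  assumes "integrable cell_measure f" "continuous_on UNIV g"
  shows "integrable cell_measure (\<lambda>x. f x * g x)"
  using bounded_continuous_cell[OF assms(2)] integrable_cell_mult_bounded[OF assms(1)]
    measurable_cell_continuous[OF assms(2)] by metis

text \<open>Bounded trigonometric approximations of indicators show that \<open>f\<close> has
  integral 0 over every compact subset of the half-open cell. Were \<open>{f > 0}\<close> of
  positive measure, inner regularity would give such a subset of positive measure on which
  \<open>f\<close> is positive.\<close>

lemma AE_nonpos_if_trig_coeffs_zero:
  fixes f :: "real^2 \<Rightarrow> real"
  assumes f: "integrable cell_measure f"
    and zero: "\<And>k b. (\<integral>x. f x * trig k b x \<partial>cell_measure) = 0"
  shows "AE x in cell_measure. f x \<le> 0"
proof -
  have mode0: "(\<integral>x. of_real (f x) * (c * mode k x) \<partial>cell_measure) = 0" for c k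
  proof -
    have e: "of_real (f x) * mode k x = Complex (f x * trig k 0 x) (f x * trig k (-(pi/2)) x)" for x
      by (simp add: mode_trig complex_eq_iff)
    have "(\<integral>x. of_real (f x) * mode k x \<partial>cell_measure) = 0"
      unfolding e by (subst integral_Complex)
        (auto simp: zero complex_eq_iff intro!: integrable_cell_mult_continuous f continuous_intros)
    then show ?thesis
      by (simp add: mult.left_commute)
  qed
  have f': "integrable cell_measure (\<lambda>x. complex_of_real (f x))"
    using f by simp
  have poly0: "(\<integral>x. of_real (f x) * p x \<partial>cell_measure) = 0" if tp: "trig_poly p" for p
  proof -
    obtain K c where "finite K" and p: "p = (\<lambda>x. \<Sum>k\<in>K. c k * mode k x)"
      using tp unfolding trig_poly_def by blast
    have "integrable cell_measure (\<lambda>x. of_real (f x) * (c k * mode k x))" for k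
      by (rule integrable_cell_mult_continuous[OF f']) (intro continuous_intros)
    then show ?thesis
      unfolding p sum_distrib_left by (simp only: Bochner_Integration.integral_sum mode0 sum.neutral_const)
  qed
  have compact0: "(\<integral>x. f x * indicator K x \<partial>cell_measure) = 0"
    if K: "compact K" "K \<subseteq> half_open_cell" for K
  proof -
    obtain p where p: "\<And>n. trig_poly (\<lambda>x. of_real (p n x))" "\<And>n x. \<bar>p n x\<bar> \<le> 2"
      "\<And>x. x \<in> half_open_cell \<Longrightarrow> (\<lambda>n. p n x) \<longlonglongrightarrow> indicator K x"
      using trig_poly_tendsto_indicator[OF K] by blast
    have cont: "continuous_on UNIV (p n)" for n
      using continuous_on_Re[OF continuous_trig_poly[OF p(1)[of n], of UNIV]] by simp
    have "(\<lambda>n. \<integral>x. f x * p n x \<partial>cell_measure) \<longlonglongrightarrow> (\<integral>x. f x * indicator K x \<partial>cell_measure)"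
    proof (rule integral_dominated_convergence[where w = "\<lambda>x. 2 * \<bar>f x\<bar>"])
      show "(\<lambda>x. f x * indicator K x) \<in> borel_measurable cell_measure"
        using f K(1) by (intro borel_measurable_times borel_measurable_indicator)
          (auto simp: sets_restrict_space_iff half_open_cell_subset[THEN subsetD]
             intro!: sets_completionI_sets borel_compact subset_trans[OF K(2)])
      show "(\<lambda>x. f x * p n x) \<in> borel_measurable cell_measure" for n
        using f measurable_cell_continuous[OF cont] by (intro borel_measurable_times) auto
      show "integrable cell_measure (\<lambda>x. 2 * \<bar>f x\<bar>)"
        using f by auto
      show "AE x in cell_measure. (\<lambda>n. f x * p n x) \<longlonglongrightarrow> f x * indicator K x"
        using AE_half_open_cell by eventually_elim (auto intro!: tendsto_intros p(3))
      show "AE x in cell_measure. norm (f x * p n x) \<le> 2 * \<bar>f x\<bar>" for n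
        using p(2)[of n] by (auto simp: abs_mult mult.commute intro!: mult_left_mono)
    qed
    moreover have "(\<integral>x. f x * p n x \<partial>cell_measure) = 0" for n
    proof -
      have "complex_of_real (\<integral>x. f x * p n x \<partial>cell_measure) = 0"
        using poly0[OF p(1)[of n]] unfolding of_real_mult[symmetric] integral_complex_of_real .
      then show ?thesis by simp
    qed
    ultimately show ?thesis
      using LIMSEQ_unique[OF _ tendsto_const] by fastforce
  qed
  define A where "A = {x \<in> half_open_cell. f x > 0}"
  have "{x \<in> Qcell. f x > 0} \<in> sets cell_measure"
    using borel_measurable_less[OF borel_measurable_const[of 0] borel_measurable_integrable[OF f]] by simp
  then have "{x \<in> Qcell. f x > 0} \<in> sets lebesgue"
    by (simp add: sets_restrict_space_iff)
  moreover have "A = {x \<in> Qcell. f x > 0} \<inter> half_open_cell"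
    using half_open_cell_subset by (auto simp: A_def)
  ultimately have A: "A \<in> sets lebesgue"
    by (simp add: sets.Int)
  have "emeasure lebesgue A = 0"
  proof (rule ccontr)
    assume "emeasure lebesgue A \<noteq> 0"
    moreover have "emeasure lebesgue A \<le> 1"
      using emeasure_mono[of A Qcell lebesgue] half_open_cell_subset
      by (auto simp: A_def emeasure_Qcell)
    ultimately obtain e where e: "e > 0" "emeasure lebesgue A = ennreal e"
      by (metis ennreal_cases ennreal_less_zero_iff ennreal_one_less_top leD le_zero_eq not_gr_zero)
    \<comment> \<open>The tolerance is the full measure \<open>e\<close> of \<open>A\<close>, so the
      closed set \<open>T\<close> cannot be null.\<close>
    obtain T where T: "closed T" "T \<subseteq> A" "emeasure lebesgue (A - T) < ennreal e"
      using sets_lebesgue_inner_closed[OF A e(1)] by metis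
    have TQ: "T \<subseteq> half_open_cell" "T \<subseteq> Qcell"
      using T half_open_cell_subset by (auto simp: A_def)
    have "compact T"
      using T(1) TQ(2) bounded_subset[OF bounded_cbox] by (auto simp: Qcell_eq_cbox compact_eq_bounded_closed)
    have Tm: "T \<in> sets lebesgue" using T(1) by (simp add: borel_closed sets_completionI_sets)
    have Tm': "T \<in> sets cell_measure" using Tm TQ by (simp add: sets_restrict_space_iff)
    have "AE x in cell_measure. f x * indicator T x = 0"
    proof (subst integral_nonneg_eq_0_iff_AE[symmetric])
      show "integrable cell_measure (\<lambda>x. f x * indicator T x)"
        using integrable_real_mult_indicator[OF Tm' f] .
      show "AE x in cell_measure. 0 \<le> f x * indicator T x"
        using T(2) by (intro AE_I2) (auto simp: A_def indicator_def)
    qed (rule compact0[OF \<open>compact T\<close> TQ(1)])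
    then have "AE x in cell_measure. x \<notin> T"
      by eventually_elim (use T(2) in \<open>auto simp: A_def indicator_def split: if_splits\<close>)
    then have "AE x in lebesgue. x \<notin> T"
      using TQ(2) by (auto simp: AE_restrict_space_iff)
    then have "emeasure lebesgue T = 0"
      using AE_iff_measurable[OF Tm, of "\<lambda>x. x \<notin> T"] by simp
    then have "emeasure lebesgue A \<le> emeasure lebesgue (A - T)"
      using emeasure_subadditive[of T lebesgue "A - T"] Tm A T(2)
      by (simp add: Un_absorb1)
    then show False using T(3) e by simp
  qed
  then have "A \<in> null_sets lebesgue" using A by blast
  then have "AE x in lebesgue. x \<notin> A" by (rule AE_not_in)
  then have "AE x in cell_measure. x \<notin> A"
    by (auto simp: AE_restrict_space_iff elim!: eventually_mono)
  then show ?thesis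
    using AE_half_open_cell by eventually_elim (auto simp: A_def)
qed

lemma AE_zero_if_trig_coeffs_zero:
  fixes f :: "real^2 \<Rightarrow> real"
  assumes f: "integrable cell_measure f"
    and zero: "\<And>k b. (\<integral>x. f x * trig k b x \<partial>cell_measure) = 0"
  shows "AE x in cell_measure. f x = 0"
proof -
  have "AE x in cell_measure. - f x \<le> 0"
    by (rule AE_nonpos_if_trig_coeffs_zero) (use f zero in auto)
  with AE_nonpos_if_trig_coeffs_zero[OF assms] show ?thesis
    by eventually_elim auto
qed

section \<open>Square-integrable functions and Fourier partial sums\<close>

definition L2_cell :: "(real^2 \<Rightarrow> complex) \<Rightarrow> bool" where
  "L2_cell f \<longleftrightarrow> f \<in> borel_measurable cell_measure \<and> integrable cell_measure (\<lambda>x. (cmod (f x))\<^sup>2)"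

lemma L2_cell_bounded:
  assumes "f \<in> borel_measurable cell_measure" "\<And>x. x \<in> Qcell \<Longrightarrow> cmod (f x) \<le> B"
  shows "L2_cell f"
  unfolding L2_cell_def
proof
  have "(cmod (f x))\<^sup>2 \<le> B\<^sup>2" if "x \<in> Qcell" for x
    using assms(2)[OF that] by (intro power_mono) auto
  then show "integrable cell_measure (\<lambda>x. (cmod (f x))\<^sup>2)"
    using assms(1) by (intro cell.integrable_const_bound[where B = "B\<^sup>2"]) auto
qed fact

lemma L2_cell_continuous: "continuous_on UNIV f \<Longrightarrow> L2_cell f"
  using L2_cell_bounded bounded_continuous_cell measurable_cell_continuous by metis

lemma L2_cell_mode: "L2_cell (mode k)"
  by (intro L2_cell_continuous continuous_intros)

lemma norm_sq_add_le: "(norm (a + b))\<^sup>2 \<le> 2 * (norm a)\<^sup>2 + 2 * (norm (b :: 'a :: real_normed_vector))\<^sup>2"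
proof -
  have "(norm (a + b))\<^sup>2 \<le> (norm a + norm b)\<^sup>2"
    by (intro power_mono norm_triangle_ineq) auto
  also have "\<dots> \<le> 2 * (norm a)\<^sup>2 + 2 * (norm b)\<^sup>2"
    using sum_squares_bound[of "norm a" "norm b"] by (simp add: power2_sum)
  finally show ?thesis .
qed

lemma L2_cell_add:
  assumes "L2_cell f" "L2_cell g"
  shows "L2_cell (\<lambda>x. f x + g x)"
  unfolding L2_cell_def
proof
  have m: "f \<in> borel_measurable cell_measure" "g \<in> borel_measurable cell_measure"
    using assms by (auto simp: L2_cell_def)
  show "(\<lambda>x. f x + g x) \<in> borel_measurable cell_measure"
    by (intro borel_measurable_add m)
  show "integrable cell_measure (\<lambda>x. (cmod (f x + g x))\<^sup>2)"
  proof (rule Bochner_Integration.integrable_bound)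
    show "integrable cell_measure (\<lambda>x. 2 * (cmod (f x))\<^sup>2 + 2 * (cmod (g x))\<^sup>2)"
      using assms by (auto simp: L2_cell_def)
    show "(\<lambda>x. (cmod (f x + g x))\<^sup>2) \<in> borel_measurable cell_measure"
      using borel_measurable_add[OF m] by auto
  qed (use norm_sq_add_le in \<open>auto intro!: AE_I2\<close>)
qed

lemma L2_cell_cmult: "L2_cell f \<Longrightarrow> L2_cell (\<lambda>x. c * f x)"
  by (auto simp: L2_cell_def norm_mult power_mult_distrib)

lemma L2_cell_diff: "L2_cell f \<Longrightarrow> L2_cell g \<Longrightarrow> L2_cell (\<lambda>x. f x - g x)"
  using L2_cell_add[of f "\<lambda>x. (-1) * g x"] L2_cell_cmult[of g "-1"] by simp

lemma L2_cell_cnj: "L2_cell f \<Longrightarrow> L2_cell (\<lambda>x. cnj (f x))"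
  using borel_measurable_continuous_on[OF continuous_on_cnj[OF continuous_on_id], of f]
  by (auto simp: L2_cell_def)

lemma L2_cell_sum: "finite I \<Longrightarrow> (\<And>i. i \<in> I \<Longrightarrow> L2_cell (f i)) \<Longrightarrow> L2_cell (\<lambda>x. \<Sum>i\<in>I. f i x)"
proof (induction I rule: finite_induct)
  case empty
  show ?case by (simp add: L2_cell_def)
next
  case (insert i I)
  then show ?case by (simp add: L2_cell_add)
qed

lemma integrable_L2_mult:
  assumes "L2_cell f" "L2_cell g"
  shows "integrable cell_measure (\<lambda>x. f x * g x)"
proof (rule Bochner_Integration.integrable_bound)
  show "integrable cell_measure (\<lambda>x. (cmod (f x))\<^sup>2 + (cmod (g x))\<^sup>2)"
    using assms by (auto simp: L2_cell_def)
  show "(\<lambda>x. f x * g x) \<in> borel_measurable cell_measure"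
    using assms by (auto simp: L2_cell_def)
  have "a * b \<le> a\<^sup>2 + b\<^sup>2" if "a \<ge> 0" "b \<ge> 0" for a b :: real
    using sum_squares_bound[of a b] mult_nonneg_nonneg[OF that] by linarith
  then show "AE x in cell_measure. norm (f x * g x) \<le> norm ((cmod (f x))\<^sup>2 + (cmod (g x))\<^sup>2)"
    by (intro AE_I2) (simp add: norm_mult)
qed

text \<open>Taken against the zero function this also serves as the norm.\<close>

definition L2_dist :: "(real^2 \<Rightarrow> complex) \<Rightarrow> (real^2 \<Rightarrow> complex) \<Rightarrow> real" where
  "L2_dist f g = sqrt (\<integral>x. (cmod (f x - g x))\<^sup>2 \<partial>cell_measure)"

lemma L2_dist_nonneg: "0 \<le> L2_dist f g"
  by (simp add: L2_dist_def)

lemma Cauchy_Schwarz_cell: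
  assumes f: "L2_cell f" and g: "L2_cell g"
  shows "(\<integral>x. cmod (f x) * cmod (g x) \<partial>cell_measure) \<le> L2_dist f (\<lambda>_. 0) * L2_dist g (\<lambda>_. 0)"
proof -
  have m: "(\<lambda>x. ennreal (cmod (f x))) \<in> borel_measurable cell_measure"
    "(\<lambda>x. ennreal (cmod (g x))) \<in> borel_measurable cell_measure"
    using f g by (auto simp: L2_cell_def)
  have fg: "integrable cell_measure (\<lambda>x. cmod (f x) * cmod (g x))"
    using integrable_norm[OF integrable_L2_mult[OF f g]] by (simp add: norm_mult)
  have f2: "integrable cell_measure (\<lambda>x. (cmod (f x))\<^sup>2)" and g2: "integrable cell_measure (\<lambda>x. (cmod (g x))\<^sup>2)"
    using f g by (auto simp: L2_cell_def)
  define A B C where "A = (\<integral>x. cmod (f x) * cmod (g x) \<partial>cell_measure)"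
    and "B = (\<integral>x. (cmod (f x))\<^sup>2 \<partial>cell_measure)" and "C = (\<integral>x. (cmod (g x))\<^sup>2 \<partial>cell_measure)"
  have pos: "A \<ge> 0" "B \<ge> 0" "C \<ge> 0"
    by (auto simp: A_def B_def C_def)
  have "(ennreal A)\<^sup>2 \<le> ennreal B * ennreal C"
    using Cauchy_Schwarz_nn_integral[OF m] nn_integral_eq_integral[OF fg]
      nn_integral_eq_integral[OF f2] nn_integral_eq_integral[OF g2]
    by (simp add: A_def B_def C_def ennreal_mult ennreal_power)
  then have "ennreal (A\<^sup>2) \<le> ennreal (B * C)"
    using pos by (simp add: ennreal_mult ennreal_power)
  then have "A\<^sup>2 \<le> B * C"
    using pos by (subst (asm) ennreal_le_iff) auto
  then have "A \<le> sqrt (B * C)"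
    by (rule real_le_rsqrt)
  then show ?thesis
    by (simp add: A_def B_def C_def L2_dist_def real_sqrt_mult)
qed

lemma norm_integral_L2_mult_le:
  assumes f: "L2_cell f" and g: "L2_cell g"
  shows "cmod (\<integral>x. f x * g x \<partial>cell_measure) \<le> L2_dist f (\<lambda>_. 0) * L2_dist g (\<lambda>_. 0)"
  using integral_norm_bound[of cell_measure "\<lambda>x. f x * g x"] Cauchy_Schwarz_cell[OF f g]
  by (simp add: norm_mult)

section \<open>Density of trigonometric polynomials in \<open>L^2\<close>\<close>

definition trig_approximable :: "(real^2 \<Rightarrow> complex) \<Rightarrow> bool" where
  "trig_approximable f \<longleftrightarrow> L2_cell f \<and>
     (\<forall>e>0. \<exists>p. trig_poly p \<and> (\<integral>x. (cmod (f x - p x))\<^sup>2 \<partial>cell_measure) < e)"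

text \<open>Closedness under \<open>L^2\<close> limits lets the class grow from compact sets to
  measurable sets, simple functions and finally all real square-integrable functions. Each error is
  taken below \<open>e/4\<close> because \<open>norm_sq_add_le\<close> doubles both.\<close>

lemma trig_approximable_approx:
  assumes f: "L2_cell f"
    and ex: "\<And>e. e > 0 \<Longrightarrow> \<exists>g. trig_approximable g \<and> (\<integral>x. (cmod (f x - g x))\<^sup>2 \<partial>cell_measure) < e"
  shows "trig_approximable f"
  unfolding trig_approximable_def
proof (intro conjI allI impI f)
  fix e :: real assume "e > 0"
  then obtain g where g: "trig_approximable g" "(\<integral>x. (cmod (f x - g x))\<^sup>2 \<partial>cell_measure) < e / 4"
    using ex[of "e / 4"] by auto
  then obtain p where p: "trig_poly p" "(\<integral>x. (cmod (g x - p x))\<^sup>2 \<partial>cell_measure) < e / 4"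
    using \<open>e > 0\<close> unfolding trig_approximable_def by (metis zero_less_divide_iff zero_less_numeral)
  have L: "L2_cell g" "L2_cell p"
    using g(1) p(1) by (auto simp: trig_approximable_def intro: L2_cell_continuous continuous_trig_poly)
  have int: "integrable cell_measure (\<lambda>x. (cmod (f x - g x))\<^sup>2)" "integrable cell_measure (\<lambda>x. (cmod (g x - p x))\<^sup>2)"
    "integrable cell_measure (\<lambda>x. (cmod (f x - p x))\<^sup>2)"
    using L2_cell_diff f L unfolding L2_cell_def by blast+
  have "(\<integral>x. (cmod (f x - p x))\<^sup>2 \<partial>cell_measure)
      \<le> (\<integral>x. 2 * (cmod (f x - g x))\<^sup>2 + 2 * (cmod (g x - p x))\<^sup>2 \<partial>cell_measure)"
    using int norm_sq_add_le[of "f x - g x" "g x - p x" for x] by (intro integral_mono) auto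
  also have "\<dots> < e"
    using int g p by simp
  finally show "\<exists>p. trig_poly p \<and> (\<integral>x. (cmod (f x - p x))\<^sup>2 \<partial>cell_measure) < e"
    using p(1) by blast
qed

lemma trig_approximable_add:
  assumes "trig_approximable f" "trig_approximable g"
  shows "trig_approximable (\<lambda>x. f x + g x)"
  unfolding trig_approximable_def
proof (intro conjI allI impI)
  show "L2_cell (\<lambda>x. f x + g x)"
    using assms L2_cell_add by (auto simp: trig_approximable_def)
  fix e :: real assume "e > 0"
  then have "e / 4 > 0" by simp
  obtain p where p: "trig_poly p" "(\<integral>x. (cmod (f x - p x))\<^sup>2 \<partial>cell_measure) < e / 4"
    using assms(1) \<open>e / 4 > 0\<close> unfolding trig_approximable_def by meson
  obtain q where q: "trig_poly q" "(\<integral>x. (cmod (g x - q x))\<^sup>2 \<partial>cell_measure) < e / 4"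
    using assms(2) \<open>e / 4 > 0\<close> unfolding trig_approximable_def by meson
  have L: "L2_cell f" "L2_cell g" "L2_cell q" "L2_cell p"
    using assms p(1) q(1) by (auto simp: trig_approximable_def intro: L2_cell_continuous continuous_trig_poly)
  have int: "integrable cell_measure (\<lambda>x. (cmod (f x - p x))\<^sup>2)" "integrable cell_measure (\<lambda>x. (cmod (g x - q x))\<^sup>2)"
    "integrable cell_measure (\<lambda>x. (cmod ((f x + g x) - (p x + q x)))\<^sup>2)"
    using L2_cell_diff[OF L(1,4)] L2_cell_diff[OF L(2,3)]
      L2_cell_diff[OF L2_cell_add[OF L(1,2)] L2_cell_add[OF L(4,3)]]
    by (simp_all add: L2_cell_def)
  have "(\<integral>x. (cmod ((f x + g x) - (p x + q x)))\<^sup>2 \<partial>cell_measure)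
      \<le> (\<integral>x. 2 * (cmod (f x - p x))\<^sup>2 + 2 * (cmod (g x - q x))\<^sup>2 \<partial>cell_measure)"
    using int norm_sq_add_le[of "f x - p x" "g x - q x" for x]
    by (intro integral_mono) (auto simp: algebra_simps)
  also have "\<dots> < e"
    using int p q by simp
  finally show "\<exists>p. trig_poly p \<and> (\<integral>x. (cmod ((f x + g x) - p x))\<^sup>2 \<partial>cell_measure) < e"
    using trig_poly_add[OF p(1) q(1)] by blast
qed

lemma trig_approximable_trig_poly: "trig_poly p \<Longrightarrow> trig_approximable p"
  unfolding trig_approximable_def
  by (auto intro: L2_cell_continuous continuous_trig_poly exI[of _ p])

lemma trig_approximable_cmult:
  assumes "trig_approximable f"
  shows "trig_approximable (\<lambda>x. c * f x)"
proof (cases "c = 0")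
  case True
  then show ?thesis using trig_approximable_trig_poly[OF trig_poly_const[of 0]] by simp
next
  case False
  show ?thesis
    unfolding trig_approximable_def
  proof (intro conjI allI impI)
    show "L2_cell (\<lambda>x. c * f x)"
      using assms L2_cell_cmult by (auto simp: trig_approximable_def)
    fix e :: real assume "e > 0"
    then have "e / (cmod c)\<^sup>2 > 0" using False by simp
    then obtain p where p: "trig_poly p" "(\<integral>x. (cmod (f x - p x))\<^sup>2 \<partial>cell_measure) < e / (cmod c)\<^sup>2"
      using assms unfolding trig_approximable_def by blast
    have "(cmod (c * f x - c * p x))\<^sup>2 = (cmod c)\<^sup>2 * (cmod (f x - p x))\<^sup>2" for x
      by (simp add: norm_mult power_mult_distrib flip: right_diff_distrib)
    then have "(\<integral>x. (cmod (c * f x - c * p x))\<^sup>2 \<partial>cell_measure) < e"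
      using p(2) False by (simp add: field_simps)
    then show "\<exists>p. trig_poly p \<and> (\<integral>x. (cmod (c * f x - p x))\<^sup>2 \<partial>cell_measure) < e"
      using trig_poly_cmult[OF p(1)] by blast
  qed
qed

lemma trig_approximable_sum:
  "finite I \<Longrightarrow> (\<And>i. i \<in> I \<Longrightarrow> trig_approximable (f i)) \<Longrightarrow> trig_approximable (\<lambda>x. \<Sum>i\<in>I. f i x)"
proof (induction I rule: finite_induct)
  case empty
  show ?case using trig_approximable_trig_poly[OF trig_poly_const[of 0]] by simp
next
  case (insert i I)
  then show ?case by (simp add: trig_approximable_add)
qed

lemma trig_approximable_compact:
  assumes K: "compact K" "K \<subseteq> half_open_cell"
  shows "trig_approximable (\<lambda>x. of_real (indicator K x))"
proof -
  obtain p where p: "\<And>n. trig_poly (\<lambda>x. of_real (p n x))" "\<And>n x. \<bar>p n x\<bar> \<le> 2"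
    "\<And>x. x \<in> half_open_cell \<Longrightarrow> (\<lambda>n. p n x) \<longlonglongrightarrow> indicator K x"
    using trig_poly_tendsto_indicator[OF K] by blast
  have Ks: "K \<in> sets cell_measure"
    using K half_open_cell_subset by (auto simp: sets_restrict_space_iff intro!: sets_completionI_sets borel_compact)
  have cont: "continuous_on UNIV (p n)" for n
    using continuous_on_Re[OF continuous_trig_poly[OF p(1)[of n], of UNIV]] by simp
  have pm: "p n \<in> borel_measurable cell_measure" for n
    by (rule measurable_cell_continuous[OF cont])
  have ind: "L2_cell (\<lambda>x. of_real (indicator K x))"
    using Ks by (intro L2_cell_bounded[where B = 1]) (auto simp: indicator_def)
  show ?thesis
  proof (rule trig_approximable_approx[OF ind])
    fix e :: real assume "e > 0"
    have "(\<lambda>n. \<integral>x. (indicator K x - p n x)\<^sup>2 \<partial>cell_measure) \<longlonglongrightarrow> (\<integral>x. 0 \<partial>cell_measure)"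
    \<comment> \<open>The indicator is at most 1 and \<open>\<bar>p n x\<bar> \<le> 2\<close>, so
      the squared difference is at most \<open>3^2\<close>.\<close>
    proof (rule integral_dominated_convergence[where w = "\<lambda>x. 9"])
      show "(\<lambda>x. (indicator K x - p n x)\<^sup>2) \<in> borel_measurable cell_measure" for n
        using Ks pm by auto
      show "AE x in cell_measure. (\<lambda>n. (indicator K x - p n x)\<^sup>2) \<longlonglongrightarrow> 0"
        using AE_half_open_cell
      proof eventually_elim
        case (elim x)
        have "(\<lambda>n. (indicator K x - p n x)\<^sup>2) \<longlonglongrightarrow> (indicator K x - indicator K x)\<^sup>2"
          by (intro tendsto_intros p elim)
        then show ?case by simp
      qed
      show "AE x in cell_measure. norm ((indicator K x - p n x)\<^sup>2) \<le> 9" for n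
      proof (rule AE_I2)
        fix x
        have "\<bar>indicator K x - p n x\<bar> \<le> \<bar>3::real\<bar>"
          using p(2)[of n x] by (auto simp: indicator_def)
        then have "(indicator K x - p n x)\<^sup>2 \<le> 3\<^sup>2"
          by (simp only: abs_le_square_iff)
        then show "norm ((indicator K x - p n x)\<^sup>2) \<le> 9" by simp
      qed
    qed auto
    then have "\<forall>\<^sub>F n in sequentially. (\<integral>x. (indicator K x - p n x)\<^sup>2 \<partial>cell_measure) < e"
      using \<open>e > 0\<close> by (simp add: order_tendstoD(2))
    then obtain n where n: "(\<integral>x. (indicator K x - p n x)\<^sup>2 \<partial>cell_measure) < e"
      using eventually_happens'[OF sequentially_bot] by blast
    have "(cmod (of_real (indicator K x) - of_real (p n x)))\<^sup>2 = (indicator K x - p n x)\<^sup>2" for x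
      by (simp flip: of_real_diff)
    then show "\<exists>g. trig_approximable g \<and> (\<integral>x. (cmod (of_real (indicator K x) - g x))\<^sup>2 \<partial>cell_measure) < e"
      using n trig_approximable_trig_poly[OF p(1)[of n]] by (intro exI[of _ "\<lambda>x. of_real (p n x)"]) simp
  qed
qed

text \<open>The squared \<open>L^2\<close> distance between the indicators of nested sets is the
  measure of their difference, which inner regularity makes small.\<close>

lemma trig_approximable_indicator:
  assumes A: "A \<in> sets cell_measure"
  shows "trig_approximable (\<lambda>x. of_real (indicator A x))"
proof (rule trig_approximable_approx)
  show "L2_cell (\<lambda>x. of_real (indicator A x))"
    using A by (intro L2_cell_bounded[where B = 1]) (auto simp: indicator_def)
  fix e :: real assume "e > 0"
  have "A \<inter> half_open_cell \<in> sets lebesgue"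
    using A by (simp add: sets_restrict_space_iff sets.Int)
  then obtain T where T: "closed T" "T \<subseteq> A \<inter> half_open_cell"
    "emeasure lebesgue (A \<inter> half_open_cell - T) < ennreal e"
    using sets_lebesgue_inner_closed \<open>e > 0\<close> by metis
  have "T \<subseteq> cbox 0 1"
    using T(2) half_open_cell_subset by (auto simp: Qcell_eq_cbox)
  then have "compact T"
    using T(1) bounded_subset[OF bounded_cbox] compact_eq_bounded_closed by blast
  define D where "D = A \<inter> half_open_cell - T"
  have Ts: "T \<in> sets lebesgue" using T(1) by (simp add: borel_closed sets_completionI_sets)
  have D: "D \<in> sets lebesgue" "D \<subseteq> Qcell"
    using A Ts half_open_cell_subset
    by (auto simp: D_def sets_restrict_space_iff intro!: sets.Diff sets.Int)
  have Ds: "D \<in> sets cell_measure" and Ts': "T \<in> sets cell_measure"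
    using D Ts T(2) half_open_cell_subset by (auto simp: sets_restrict_space_iff)
  have "(\<integral>x. (cmod (of_real (indicator A x) - of_real (indicator T x)))\<^sup>2 \<partial>cell_measure)
      = (\<integral>x. indicator D x \<partial>cell_measure)"
  proof (rule integral_cong_AE)
    show "AE x in cell_measure. (cmod (of_real (indicator A x) - of_real (indicator T x)))\<^sup>2 = indicator D x"
      using AE_half_open_cell
    proof eventually_elim
      case (elim x)
      then show ?case using T(2) by (auto simp: D_def indicator_def)
    qed
  qed (use A Ds Ts' in simp_all)
  also have "\<dots> = measure lebesgue D"
    using D by (simp add: measure_restrict_space Int_absorb2)
  also have "\<dots> < e"
    using T(3) \<open>e > 0\<close> by (simp add: D_def[symmetric] measure_def) (metis enn2real_less_iff ennreal_less_top order_less_trans)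
  finally show "\<exists>g. trig_approximable g \<and> (\<integral>x. (cmod (of_real (indicator A x) - g x))\<^sup>2 \<partial>cell_measure) < e"
    using trig_approximable_compact[OF \<open>compact T\<close>] T(2) by blast
qed

lemma trig_approximable_real:
  fixes f :: "real^2 \<Rightarrow> real"
  assumes "L2_cell (\<lambda>x. of_real (f x))"
  shows "trig_approximable (\<lambda>x. of_real (f x))"
proof (rule trig_approximable_approx[OF assms])
  fix e :: real assume "e > 0"
  have "(\<lambda>x. Re (of_real (f x))) \<in> borel_measurable cell_measure"
    by (rule measurable_compose[where N = borel and g = Re]) (use assms in \<open>auto simp: L2_cell_def\<close>)
  then have m: "f \<in> borel_measurable cell_measure" by simp
  have f2: "integrable cell_measure (\<lambda>x. (f x)\<^sup>2)"
    using assms by (simp add: L2_cell_def)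
  obtain s where s: "\<And>i. simple_function cell_measure (s i)"
    "\<And>x. x \<in> space cell_measure \<Longrightarrow> (\<lambda>i. s i x) \<longlonglongrightarrow> f x"
    "\<And>i x. x \<in> space cell_measure \<Longrightarrow> dist (s i x) 0 \<le> 2 * dist (f x) 0"
    using borel_measurable_implies_sequence_metric[OF m, of 0] by blast
  have sm: "s i \<in> borel_measurable cell_measure" for i
    by (rule borel_measurable_simple_function[OF s(1)])
  have "(\<lambda>i. \<integral>x. (f x - s i x)\<^sup>2 \<partial>cell_measure) \<longlonglongrightarrow> (\<integral>x. 0 \<partial>cell_measure)"
  \<comment> \<open>The simple functions satisfy
    \<open>\<bar>s n x\<bar> \<le> 2 * \<bar>f x\<bar>\<close>, so the difference is at most
    \<open>3 * \<bar>f x\<bar>\<close>.\<close>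
  proof (rule integral_dominated_convergence[where w = "\<lambda>x. 9 * (f x)\<^sup>2"])
    show "(\<lambda>x. (f x - s i x)\<^sup>2) \<in> borel_measurable cell_measure" for i
      using m sm by auto
    show "AE x in cell_measure. (\<lambda>n. (f x - s n x)\<^sup>2) \<longlonglongrightarrow> 0"
    proof (rule AE_I2)
      fix x assume "x \<in> space cell_measure"
      then have "(\<lambda>n. (f x - s n x)\<^sup>2) \<longlonglongrightarrow> (f x - f x)\<^sup>2"
        by (intro tendsto_intros s)
      then show "(\<lambda>n. (f x - s n x)\<^sup>2) \<longlonglongrightarrow> 0" by simp
    qed
    show "AE x in cell_measure. norm ((f x - s n x)\<^sup>2) \<le> 9 * (f x)\<^sup>2" for n
    proof (rule AE_I2)
      fix x assume "x \<in> space cell_measure"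
      then have "\<bar>f x - s n x\<bar> \<le> \<bar>3 * f x\<bar>"
        using s(3)[of x n] by (simp add: dist_real_def)
      then have "(f x - s n x)\<^sup>2 \<le> (3 * f x)\<^sup>2"
        by (simp only: abs_le_square_iff)
      then show "norm ((f x - s n x)\<^sup>2) \<le> 9 * (f x)\<^sup>2" by (simp add: power_mult_distrib)
    qed
  qed (use f2 in auto)
  then have "\<forall>\<^sub>F n in sequentially. (\<integral>x. (f x - s n x)\<^sup>2 \<partial>cell_measure) < e"
    using \<open>e > 0\<close> by (simp add: order_tendstoD(2))
  then obtain n where n: "(\<integral>x. (f x - s n x)\<^sup>2 \<partial>cell_measure) < e"
    using eventually_happens'[OF sequentially_bot] by blast
  \<comment> \<open>The simple function is rewritten as a finite combination of indicators of its
    level sets, a form that the closure lemmas accept.\<close>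
  define g where "g x = (\<Sum>y\<in>s n ` space cell_measure.
      complex_of_real y * of_real (indicator (s n -` {y} \<inter> space cell_measure) x))" for x
  have "trig_approximable g"
    unfolding g_def using s(1)[of n]
    by (intro trig_approximable_sum trig_approximable_cmult trig_approximable_indicator)
      (auto simp: simple_function_def)
  moreover have "(cmod (of_real (f x) - g x))\<^sup>2 = (f x - s n x)\<^sup>2" if "x \<in> Qcell" for x
  proof -
    have "g x = (\<Sum>y\<in>s n ` space cell_measure. if y = s n x then complex_of_real y else 0)"
      unfolding g_def using that by (intro sum.cong) (auto simp: indicator_def)
    also have "\<dots> = of_real (s n x)"
      using s(1)[of n] that by (simp add: simple_function_def)
    finally show ?thesis by (simp flip: of_real_diff)
  qed
  then have "(\<integral>x. (cmod (of_real (f x) - g x))\<^sup>2 \<partial>cell_measure) = (\<integral>x. (f x - s n x)\<^sup>2 \<partial>cell_measure)"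
    by (intro Bochner_Integration.integral_cong) auto
  ultimately show "\<exists>g. trig_approximable g \<and> (\<integral>x. (cmod (of_real (f x) - g x))\<^sup>2 \<partial>cell_measure) < e"
    using n by auto
qed

section \<open>Fourier partial sums as best approximations\<close>

definition fcoeff :: "(real^2 \<Rightarrow> complex) \<Rightarrow> int \<times> int \<Rightarrow> complex" where
  "fcoeff f k = (\<integral>x. f x * cnj (mode k x) \<partial>cell_measure)"

definition freqs :: "nat \<Rightarrow> (int \<times> int) set" where
  "freqs N = {- int N..int N} \<times> {- int N..int N}"

definition fourier_sum :: "nat \<Rightarrow> (real^2 \<Rightarrow> complex) \<Rightarrow> real^2 \<Rightarrow> complex" where
  "fourier_sum N f x = (\<Sum>k\<in>freqs N. fcoeff f k * mode k x)"

lemma finite_freqs [simp]: "finite (freqs N)"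
  by (simp add: freqs_def)

lemma subset_freqs:
  assumes "finite K"
  obtains N where "\<And>n. n \<ge> N \<Longrightarrow> K \<subseteq> freqs n"
proof -
  define A where "A = (\<lambda>k. nat \<bar>fst k\<bar>) ` K \<union> (\<lambda>k. nat \<bar>snd k\<bar>) ` K"
  have "finite A" using assms by (simp add: A_def)
  then obtain N where N: "\<And>a. a \<in> A \<Longrightarrow> a \<le> N"
    using Max_ge by blast
  have "k \<in> freqs n" if "n \<ge> N" "k \<in> K" for n k
  proof -
    have "nat \<bar>fst k\<bar> \<le> N" "nat \<bar>snd k\<bar> \<le> N"
      using that by (auto intro!: N simp: A_def)
    then show ?thesis using that(1) by (auto simp: freqs_def mem_Times_iff)
  qed
  then show thesis using that by blast
qed

lemma trig_poly_fourier_sum: "trig_poly (fourier_sum N f)"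
  unfolding trig_poly_def fourier_sum_def[abs_def] by (intro exI[of _ "freqs N"] exI[of _ "fcoeff f"]) simp

lemma L2_cell_fourier_sum: "L2_cell (fourier_sum N f)"
  by (intro L2_cell_continuous continuous_trig_poly trig_poly_fourier_sum)

lemma integral_mode_cnj_mode:
  "(\<integral>x. mode k x * cnj (mode l x) \<partial>cell_measure) = (if k = l then 1 else 0)"
  by (simp add: integral_mode flip: mode_uminus mode_add)

text \<open>Completing the square: the coefficients \<open>c\<close> enter only the last sum, so the
  Fourier coefficients are optimal and Bessel's inequality is contained as well. The identity is
  stated between complex numbers because the proof expands \<open>\<bar>z\<bar>^2\<close> as
  \<open>z * cnj z\<close>; injectivity of \<open>of_real\<close> returns the real one.\<close>

lemma L2_error_trig_sum:
  assumes f: "L2_cell f" and K: "finite K"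
  shows "complex_of_real (\<integral>x. (cmod (f x - (\<Sum>k\<in>K. c k * mode k x)))\<^sup>2 \<partial>cell_measure) =
    complex_of_real ((\<integral>x. (cmod (f x))\<^sup>2 \<partial>cell_measure) - (\<Sum>k\<in>K. (cmod (fcoeff f k))\<^sup>2)
      + (\<Sum>k\<in>K. (cmod (fcoeff f k - c k))\<^sup>2))"
proof -
  define p where "p x = (\<Sum>k\<in>K. c k * mode k x)" for x
  have p: "L2_cell p"
    unfolding p_def[abs_def] by (intro L2_cell_sum K L2_cell_cmult L2_cell_mode)
  note int = integrable_L2_mult L2_cell_cnj f p L2_cell_mode L2_cell_cmult
  have fp: "(\<integral>x. f x * cnj (p x) \<partial>cell_measure) = (\<Sum>k\<in>K. cnj (c k) * fcoeff f k)"
  proof -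
    have "f x * cnj (p x) = (\<Sum>k\<in>K. cnj (c k) * (f x * cnj (mode k x)))" for x
      by (simp add: p_def sum_distrib_left mult_ac)
    then have "(\<integral>x. f x * cnj (p x) \<partial>cell_measure) = (\<integral>x. (\<Sum>k\<in>K. cnj (c k) * (f x * cnj (mode k x))) \<partial>cell_measure)"
      by simp
    also have "\<dots> = (\<Sum>k\<in>K. \<integral>x. cnj (c k) * (f x * cnj (mode k x)) \<partial>cell_measure)"
      by (intro Bochner_Integration.integral_sum integrable_mult_right int)
    finally show ?thesis by (simp add: fcoeff_def)
  qed
  have pf: "(\<integral>x. p x * cnj (f x) \<partial>cell_measure) = (\<Sum>k\<in>K. c k * cnj (fcoeff f k))"
  proof -
    have "(\<integral>x. p x * cnj (f x) \<partial>cell_measure) = (\<integral>x. cnj (f x * cnj (p x)) \<partial>cell_measure)"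
      by (simp add: mult.commute)
    also have "\<dots> = cnj (\<Sum>k\<in>K. cnj (c k) * fcoeff f k)"
      by (simp only: Bochner_Integration.integral_cnj fp)
    finally show ?thesis by simp
  qed
  have mp: "(\<integral>x. mode k x * cnj (p x) \<partial>cell_measure) = (if k \<in> K then cnj (c k) else 0)" for k
  proof -
    have "mode k x * cnj (p x) = (\<Sum>l\<in>K. cnj (c l) * (mode k x * cnj (mode l x)))" for x
      by (simp add: p_def sum_distrib_left mult_ac)
    then have "(\<integral>x. mode k x * cnj (p x) \<partial>cell_measure) = (\<integral>x. (\<Sum>l\<in>K. cnj (c l) * (mode k x * cnj (mode l x))) \<partial>cell_measure)"
      by simp
    also have "\<dots> = (\<Sum>l\<in>K. \<integral>x. cnj (c l) * (mode k x * cnj (mode l x)) \<partial>cell_measure)"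
      by (intro Bochner_Integration.integral_sum integrable_mult_right int)
    also have "\<dots> = (\<Sum>l\<in>K. if k = l then cnj (c l) else 0)"
      by (intro sum.cong) (simp_all add: integral_mode_cnj_mode)
    finally show ?thesis using K by simp
  qed
  have pp: "(\<integral>x. p x * cnj (p x) \<partial>cell_measure) = (\<Sum>k\<in>K. c k * cnj (c k))"
  proof -
    have "p x * cnj (p x) = (\<Sum>k\<in>K. c k * (mode k x * cnj (p x)))" for x
      by (simp add: p_def[of x] sum_distrib_right mult_ac)
    then have "(\<integral>x. p x * cnj (p x) \<partial>cell_measure) = (\<integral>x. (\<Sum>k\<in>K. c k * (mode k x * cnj (p x))) \<partial>cell_measure)"
      by simp
    also have "\<dots> = (\<Sum>k\<in>K. \<integral>x. c k * (mode k x * cnj (p x)) \<partial>cell_measure)"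
      by (intro Bochner_Integration.integral_sum integrable_mult_right int)
    finally show ?thesis by (simp add: mp)
  qed
  have "complex_of_real ((cmod (f x - p x))\<^sup>2) =
      f x * cnj (f x) - f x * cnj (p x) - p x * cnj (f x) + p x * cnj (p x)" for x
    by (simp only: complex_norm_square complex_cnj_diff) (simp add: algebra_simps)
  then have "complex_of_real (\<integral>x. (cmod (f x - p x))\<^sup>2 \<partial>cell_measure) =
      (\<integral>x. f x * cnj (f x) - f x * cnj (p x) - p x * cnj (f x) + p x * cnj (p x) \<partial>cell_measure)"
    by (simp flip: integral_complex_of_real)
  also have "\<dots> = (\<integral>x. f x * cnj (f x) \<partial>cell_measure) - (\<integral>x. f x * cnj (p x) \<partial>cell_measure)
      - (\<integral>x. p x * cnj (f x) \<partial>cell_measure) + (\<integral>x. p x * cnj (p x) \<partial>cell_measure)"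
    using integrable_L2_mult[OF f L2_cell_cnj[OF f]] integrable_L2_mult[OF f L2_cell_cnj[OF p]]
      integrable_L2_mult[OF p L2_cell_cnj[OF f]] integrable_L2_mult[OF p L2_cell_cnj[OF p]]
    by simp
  also have "(\<integral>x. f x * cnj (f x) \<partial>cell_measure) = of_real (\<integral>x. (cmod (f x))\<^sup>2 \<partial>cell_measure)"
    by (simp flip: integral_complex_of_real complex_norm_square)
  finally have "complex_of_real (\<integral>x. (cmod (f x - p x))\<^sup>2 \<partial>cell_measure) =
      of_real (\<integral>x. (cmod (f x))\<^sup>2 \<partial>cell_measure) - (\<Sum>k\<in>K. cnj (c k) * fcoeff f k)
        - (\<Sum>k\<in>K. c k * cnj (fcoeff f k)) + (\<Sum>k\<in>K. c k * cnj (c k))"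
    unfolding fp pf pp .
  moreover have "(\<Sum>k\<in>K. complex_of_real ((cmod (fcoeff f k - c k))\<^sup>2)) =
      (\<Sum>k\<in>K. complex_of_real ((cmod (fcoeff f k))\<^sup>2)) - (\<Sum>k\<in>K. cnj (c k) * fcoeff f k)
        - (\<Sum>k\<in>K. c k * cnj (fcoeff f k)) + (\<Sum>k\<in>K. c k * cnj (c k))"
    unfolding complex_norm_square sum_subtractf[symmetric] sum.distrib[symmetric]
    by (intro sum.cong refl) (simp add: algebra_simps)
  ultimately show ?thesis
    unfolding p_def[symmetric] of_real_add of_real_diff of_real_sum by simp
qed

text \<open>Once \<open>freqs n\<close> contains the frequencies of an approximating polynomial, the
  Fourier sum over \<open>freqs n\<close> approximates at least as well.\<close>

lemma L2_dist_fourier_sum_tendsto: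
  assumes f: "trig_approximable f"
  shows "(\<lambda>N. L2_dist f (fourier_sum N f)) \<longlonglongrightarrow> 0"
proof -
  have L: "L2_cell f" using f by (simp add: trig_approximable_def)
  have "(\<lambda>N. \<integral>x. (cmod (f x - fourier_sum N f x))\<^sup>2 \<partial>cell_measure) \<longlonglongrightarrow> 0"
  proof (rule LIMSEQ_I)
    fix e :: real assume "e > 0"
    then obtain p where p: "trig_poly p" "(\<integral>x. (cmod (f x - p x))\<^sup>2 \<partial>cell_measure) < e"
      using f unfolding trig_approximable_def by blast
    obtain K c where K: "finite K" and pc: "p = (\<lambda>x. \<Sum>k\<in>K. c k * mode k x)"
      using p(1) unfolding trig_poly_def by blast
    obtain N where N: "\<And>n. n \<ge> N \<Longrightarrow> K \<subseteq> freqs n"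
      using subset_freqs[OF K] by blast
    define d where "d k = (if k \<in> K then c k else 0)" for k
    have "(\<integral>x. (cmod (f x - fourier_sum n f x))\<^sup>2 \<partial>cell_measure) < e" if "n \<ge> N" for n
    proof -
      have pd: "p x = (\<Sum>k\<in>freqs n. d k * mode k x)" for x
        unfolding pc d_def using N[OF that] by (intro sum.mono_neutral_cong_left) auto
      have "(\<integral>x. (cmod (f x - fourier_sum n f x))\<^sup>2 \<partial>cell_measure) =
         (\<integral>x. (cmod (f x))\<^sup>2 \<partial>cell_measure) - (\<Sum>k\<in>freqs n. (cmod (fcoeff f k))\<^sup>2)"
        using L2_error_trig_sum[OF L finite_freqs[of n], of "fcoeff f"]
        unfolding of_real_eq_iff fourier_sum_def by simp
      also have "\<dots> \<le> (\<integral>x. (cmod (f x - p x))\<^sup>2 \<partial>cell_measure)"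
        unfolding pd using L2_error_trig_sum[OF L finite_freqs[of n], of d]
        unfolding of_real_eq_iff by (simp add: sum_nonneg)
      finally show ?thesis using p(2) by simp
    qed
    then show "\<exists>N. \<forall>n\<ge>N. norm ((\<integral>x. (cmod (f x - fourier_sum n f x))\<^sup>2 \<partial>cell_measure) - 0) < e"
      by auto
  qed
  then show ?thesis
    unfolding L2_dist_def using tendsto_real_sqrt by fastforce
qed

lemma L2_dist_zero_fourier_sum_le:
  assumes "L2_cell f"
  shows "L2_dist (fourier_sum N f) (\<lambda>_. 0) \<le> L2_dist f (\<lambda>_. 0)"
proof -
  \<comment> \<open>The error identity is used for the zero function with the coefficients of
    \<open>f\<close>, which computes the norm of the partial sum.\<close>
  have z: "L2_cell (\<lambda>_. 0)" by (simp add: L2_cell_def)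
  have z0: "fcoeff (\<lambda>_. 0) k = 0" for k by (simp add: fcoeff_def)
  have "(\<integral>x. (cmod (fourier_sum N f x))\<^sup>2 \<partial>cell_measure) = (\<Sum>k\<in>freqs N. (cmod (fcoeff f k))\<^sup>2)"
    using L2_error_trig_sum[OF z finite_freqs[of N], of "fcoeff f"]
    unfolding of_real_eq_iff fourier_sum_def by (simp add: z0)
  also have "\<dots> \<le> (\<integral>x. (cmod (f x))\<^sup>2 \<partial>cell_measure)"
  proof -
    have "0 \<le> (\<integral>x. (cmod (f x - (\<Sum>k\<in>freqs N. fcoeff f k * mode k x)))\<^sup>2 \<partial>cell_measure)"
      by simp
    then show ?thesis
      using L2_error_trig_sum[OF assms finite_freqs[of N], of "fcoeff f"]
      unfolding of_real_eq_iff by simp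
  qed
  finally show ?thesis by (simp add: L2_dist_def)
qed

section \<open>Weak gradients of \<open>H\<^sup>L\<close> fields\<close>

lemma summable_on_int_powr:
  assumes "s > 1"
  shows "(\<lambda>n::int. (1 + (real_of_int n)\<^sup>2) powr (- (s/2))) summable_on UNIV"
proof -
  define h where "h x = (1 + x\<^sup>2) powr (- (s/2))" for x :: real
  have nat: "(\<lambda>n::nat. h (real n)) summable_on UNIV"
  proof -
    \<comment> \<open>The comparison fails at \<open>n = 0\<close>, where the right side is
      \<open>0 powr (- s) = 0\<close> and the left side is 1.\<close>
    have "h (real n) \<le> real n powr (- s)" if "n \<ge> 1" for n
    proof -
      have "h (real n) \<le> ((real n)\<^sup>2) powr (- (s/2))"
        unfolding h_def using that assms by (intro powr_mono2') auto
      also have "\<dots> = real n powr (- s)"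
        using that by (simp add: powr_powr flip: powr_numeral)
      finally show ?thesis .
    qed
    then have "summable (\<lambda>n. h (real n))"
      using assms
      by (intro summable_comparison_test_ev[OF _ iffD2[OF summable_real_powr_iff[of "- s"]]]
            eventually_sequentiallyI[of 1]) (auto simp: h_def)
    then show ?thesis
      by (subst summable_on_UNIV_nonneg_real_iff) (auto simp: h_def)
  qed
  have "(\<lambda>n. h (real_of_int n)) summable_on range int"
    using nat by (subst summable_on_reindex) (auto simp: o_def inj_on_def)
  moreover have "(\<lambda>n. h (real_of_int n)) summable_on range (\<lambda>n. - int n)"
    using nat by (subst summable_on_reindex) (auto simp: o_def inj_on_def h_def)
  moreover have "range int \<union> range (\<lambda>n. - int n) = UNIV"
    by (auto simp: image_iff) (metis int_cases2)
  ultimately show ?thesis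
    using summable_on_union unfolding h_def by metis
qed

definition bracket :: "int \<times> int \<Rightarrow> real" where
  "bracket k = 1 + real_of_int ((fst k)\<^sup>2 + (snd k)\<^sup>2)"

lemma bracket_ge_1: "1 \<le> bracket k"
  by (simp add: bracket_def)

text \<open>From \<open>(1 + a) * (1 + b) \<le> (1 + a + b)^2\<close> the sum over the lattice is
  dominated by a product of two sums over the integers whose terms decay like
  \<open>\<bar>n\<bar> powr (- s)\<close>.\<close>

lemma summable_on_bracket_powr:
  assumes "s > 1"
  shows "(\<lambda>k. bracket k powr (- s)) summable_on UNIV"
proof -
  define h where "h n = (1 + (real_of_int n)\<^sup>2) powr (- (s/2))" for n :: int
  have h: "h summable_on UNIV"
    unfolding h_def by (rule summable_on_int_powr[OF assms])
  have "(\<lambda>(a, b). h a * h b) summable_on (UNIV \<times> UNIV)"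
  proof (rule summable_on_SigmaI)
    show "((\<lambda>b. case (a, b) of (a, b) \<Rightarrow> h a * h b) has_sum (h a * infsum h UNIV)) UNIV" for a
      using has_sum_cmult_right[OF has_sum_infsum[OF h]] by simp
    show "(\<lambda>a. h a * infsum h UNIV) summable_on UNIV"
      by (rule summable_on_cmult_left[OF h])
  qed (auto simp: h_def)
  then have "(\<lambda>k. h (fst k) * h (snd k)) summable_on UNIV"
    by (simp add: case_prod_unfold)
  then show ?thesis
  proof (rule summable_on_comparison_test)
    fix k :: "int \<times> int"
    define a b where "a = (real_of_int (fst k))\<^sup>2" and "b = (real_of_int (snd k))\<^sup>2"
    have ab: "a \<ge> 0" "b \<ge> 0" by (auto simp: a_def b_def)
    have "(1 + a) * (1 + b) \<le> (1 + a + b)\<^sup>2"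
      using ab by (simp add: power2_eq_square algebra_simps)
    then have "((1 + a + b)\<^sup>2) powr (- (s/2)) \<le> ((1 + a) * (1 + b)) powr (- (s/2))"
      using ab assms by (intro powr_mono2') (auto intro!: mult_pos_pos)
    also have "((1 + a + b)\<^sup>2) powr (- (s/2)) = bracket k powr (- s)"
      using ab by (simp add: powr_powr bracket_def a_def b_def add.assoc flip: powr_numeral)
    also have "((1 + a) * (1 + b)) powr (- (s/2)) = h (fst k) * h (snd k)"
      using ab by (simp add: powr_mult h_def a_def b_def)
    finally show "bracket k powr (- s) \<le> h (fst k) * h (snd k)" .
  qed auto
qed

lemma freq_sq_le_bracket: "(freq k j)\<^sup>2 \<le> bracket k"
  by (simp add: freq_def bracket_def)

text \<open>AM-GM splits \<open>|k\<^sub>j| |c\<^sub>k|\<close> into a part controlled by the \<open>H\<^sup>L\<close> norm and the lattice sum of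
  \<open>(1 + |k|\<^sup>2)\<^bsup>1 - L\<^esup>\<close>, which converges precisely when \<open>L > 2\<close>.\<close>

lemma summable_on_freq_mult:
  fixes c :: "int \<times> int \<Rightarrow> real"
  assumes L: "L > 2" and c: "\<And>k. c k \<ge> 0"
    and sum: "(\<lambda>k. bracket k powr L * (c k)\<^sup>2) summable_on UNIV"
  shows "(\<lambda>k. \<bar>freq k j\<bar> * c k) summable_on UNIV"
proof -
  have "(\<lambda>k. bracket k powr L * (c k)\<^sup>2 + bracket k powr (- (L - 1))) summable_on UNIV"
    using L by (intro summable_on_add sum summable_on_bracket_powr) auto
  then show ?thesis
  proof (rule summable_on_comparison_test)
    fix k
    define w where "w = bracket k"
    have w: "w \<ge> 1" by (simp add: w_def bracket_ge_1)
    define x y where "x = \<bar>freq k j\<bar> * w powr (- (L/2))" and "y = w powr (L/2) * c k"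
    have "\<bar>freq k j\<bar> * c k = x * y"
      using w by (simp add: x_def y_def powr_minus field_simps)
    also have "\<dots> \<le> y\<^sup>2 + x\<^sup>2"
    proof -
      have "x \<ge> 0" "y \<ge> 0" using c by (auto simp: x_def y_def)
      then show ?thesis
        using sum_squares_bound[of x y] mult_nonneg_nonneg[of x y] by linarith
    qed
    also have "y\<^sup>2 = w powr L * (c k)\<^sup>2"
      using w by (simp add: y_def power_mult_distrib powr_powr flip: powr_numeral)
    also have "x\<^sup>2 \<le> w powr (- (L - 1))"
    proof -
      have "x\<^sup>2 = (freq k j)\<^sup>2 * w powr (- L)"
        using w by (simp add: x_def power_mult_distrib powr_powr flip: powr_numeral)
      also have "\<dots> \<le> w powr 1 * w powr (- L)"
        using freq_sq_le_bracket[of k j] w by (intro mult_right_mono) (auto simp: w_def)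
      also have "\<dots> = w powr (- (L - 1))"
        unfolding powr_add[symmetric] by simp
      finally show ?thesis .
    qed
    finally show "\<bar>freq k j\<bar> * c k \<le> bracket k powr L * (c k)\<^sup>2 + bracket k powr (- (L - 1))"
      by (simp add: w_def)
  qed (use c in auto)
qed

text \<open>Links unconditional sums over the lattice with the partial sums over squares.\<close>

lemma filterlim_freqs: "filterlim freqs (finite_subsets_at_top UNIV) sequentially"
  unfolding filterlim_iff eventually_finite_subsets_at_top
proof (intro allI impI)
  fix P :: "(int \<times> int) set \<Rightarrow> bool"
  assume "\<exists>X. finite X \<and> X \<subseteq> UNIV \<and> (\<forall>Y. finite Y \<and> X \<subseteq> Y \<and> Y \<subseteq> UNIV \<longrightarrow> P Y)"
  then obtain X where X: "finite X" "\<And>Y. finite Y \<Longrightarrow> X \<subseteq> Y \<Longrightarrow> P Y" by auto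
  obtain N where "\<And>n. n \<ge> N \<Longrightarrow> X \<subseteq> freqs n"
    using subset_freqs[OF X(1)] by blast
  then show "\<forall>\<^sub>F n in sequentially. P (freqs n)"
    using X(2) by (intro eventually_sequentiallyI[of N]) auto
qed

text \<open>The derivative is the real part of the termwise differentiated Fourier series, and the
  sum \<open>C\<close> of the moduli of its coefficients bounds it everywhere. Integration by parts
  holds for each partial sum; in the limit the left side is controlled in \<open>L^2\<close> and the
  right side by dominated convergence.\<close>

lemma ex_bounded_weak_derivative:
  fixes f :: "real^2 \<Rightarrow> real"
  assumes f: "L2_cell (\<lambda>x. of_real (f x))"
    and sum: "(\<lambda>k. \<bar>freq k j\<bar> * cmod (fcoeff (\<lambda>x. of_real (f x)) k)) summable_on UNIV"
  obtains g :: "real^2 \<Rightarrow> real" and C where "g \<in> borel_measurable cell_measure" "\<And>x. \<bar>g x\<bar> \<le> C"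
    "\<And>\<phi>. test_fun \<phi> \<Longrightarrow>
      (\<integral>x. f x * pderiv2 j \<phi> x \<partial>cell_measure) = - (\<integral>x. g x * \<phi> x \<partial>cell_measure)"
proof -
  let ?F = "\<lambda>x. complex_of_real (f x)"
  define a where "a k = 2 * pi * \<i> * freq k j * fcoeff ?F k" for k
  define C where "C = infsum (\<lambda>k. cmod (a k)) UNIV"
  have na: "cmod (a k) = 2 * pi * (\<bar>freq k j\<bar> * cmod (fcoeff ?F k))" for k
    by (simp add: a_def norm_mult)
  have asum: "(\<lambda>k. cmod (a k)) summable_on UNIV"
    unfolding na by (rule summable_on_cmult_right[OF sum])
  define P where "P N x = (\<Sum>k\<in>freqs N. a k * mode k x)" for N x
  define G where "G x = infsum (\<lambda>k. a k * mode k x) UNIV" for x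
  have abs: "(\<lambda>k. cmod (a k * mode k x)) summable_on UNIV" for x
    using asum by (simp add: norm_mult)
  have lim: "(\<lambda>N. P N x) \<longlonglongrightarrow> G x" for x
    unfolding P_def G_def
    by (rule filterlim_compose[OF infsum_tendsto[OF abs_summable_summable[OF abs]] filterlim_freqs])
  have Pb: "cmod (P N x) \<le> C" for N x
  proof -
    have "cmod (P N x) \<le> (\<Sum>k\<in>freqs N. cmod (a k))"
      unfolding P_def by (rule order_trans[OF norm_sum]) (simp add: norm_mult)
    also have "\<dots> \<le> C"
      unfolding C_def using asum by (intro finite_sum_le_infsum) auto
    finally show ?thesis .
  qed
  have Gb: "cmod (G x) \<le> C" for x
    using Lim_bounded[OF tendsto_norm[OF lim], of 0] Pb by blast
  have Pm: "P N \<in> borel_measurable cell_measure" for N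
    unfolding P_def[abs_def] by (intro measurable_cell_continuous continuous_intros)
  have Gm: "G \<in> borel_measurable cell_measure"
    by (rule borel_measurable_LIMSEQ_metric[OF Pm lim])
  have Gint: "integrable cell_measure G"
    using Gb Gm by (intro cell.integrable_const_bound[where B = C]) auto
  show thesis
  proof (rule that[of "\<lambda>x. Re (G x)" C])
    show "(\<lambda>x. Re (G x)) \<in> borel_measurable cell_measure"
      using Gm by auto
    show "\<bar>Re (G x)\<bar> \<le> C" for x
      using abs_Re_le_cmod[of "G x"] Gb[of x] by linarith
    fix \<phi> assume \<phi>: "test_fun \<phi>"
    note c\<phi> = test_fun_continuous[OF \<phi>] and cd = test_fun_derivative(2)[OF \<phi>, of j]
    have cc: "continuous_on UNIV (\<lambda>x. complex_of_real (\<phi> x))"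
      "continuous_on UNIV (\<lambda>x. complex_of_real (pderiv2 j \<phi> x))"
      by (intro continuous_intros c\<phi> cd)+
    have parts: "(\<integral>x. fourier_sum N ?F x * of_real (pderiv2 j \<phi> x) \<partial>cell_measure) =
       - (\<integral>x. P N x * of_real (\<phi> x) \<partial>cell_measure)" for N
    proof -
      have "(\<integral>x. fourier_sum N ?F x * of_real (pderiv2 j \<phi> x) \<partial>cell_measure) =
         (\<integral>x. (\<Sum>k\<in>freqs N. fcoeff ?F k * (mode k x * of_real (pderiv2 j \<phi> x))) \<partial>cell_measure)"
        by (simp add: fourier_sum_def sum_distrib_right mult.assoc)
      also have "\<dots> = (\<Sum>k\<in>freqs N. fcoeff ?F k * (\<integral>x. mode k x * of_real (pderiv2 j \<phi> x) \<partial>cell_measure))"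
        by (subst Bochner_Integration.integral_sum)
          (auto intro!: integrable_cell_continuous continuous_intros cc)
      also have "\<dots> = - (\<Sum>k\<in>freqs N. a k * (\<integral>x. mode k x * of_real (\<phi> x) \<partial>cell_measure))"
        unfolding sum_negf[symmetric]
        by (intro sum.cong refl) (simp add: integral_mode_parts[OF \<phi>] a_def)
      also have "(\<Sum>k\<in>freqs N. a k * (\<integral>x. mode k x * of_real (\<phi> x) \<partial>cell_measure)) =
          (\<integral>x. (\<Sum>k\<in>freqs N. a k * (mode k x * of_real (\<phi> x))) \<partial>cell_measure)"
        by (subst Bochner_Integration.integral_sum)
          (auto intro!: integrable_cell_continuous continuous_intros cc)
      also have "\<dots> = (\<integral>x. P N x * of_real (\<phi> x) \<partial>cell_measure)"
        by (simp add: P_def sum_distrib_right mult.assoc)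
      finally show ?thesis .
    qed
    have 1: "(\<lambda>N. - (\<integral>x. P N x * of_real (\<phi> x) \<partial>cell_measure)) \<longlonglongrightarrow>
        - (\<integral>x. G x * of_real (\<phi> x) \<partial>cell_measure)"
    proof (intro tendsto_minus integral_dominated_convergence[where w = "\<lambda>x. C * \<bar>\<phi> x\<bar>"])
      show "(\<lambda>x. G x * of_real (\<phi> x)) \<in> borel_measurable cell_measure"
        using Gm measurable_cell_continuous[OF c\<phi>] by auto
      show "(\<lambda>x. P N x * of_real (\<phi> x)) \<in> borel_measurable cell_measure" for N
        using Pm measurable_cell_continuous[OF c\<phi>] by auto
      show "integrable cell_measure (\<lambda>x. C * \<bar>\<phi> x\<bar>)"
        using integrable_cell_continuous[OF c\<phi>] by auto
      show "AE x in cell_measure. (\<lambda>N. P N x * of_real (\<phi> x)) \<longlonglongrightarrow> G x * of_real (\<phi> x)"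
        by (intro AE_I2 tendsto_intros lim)
      show "AE x in cell_measure. norm (P N x * of_real (\<phi> x)) \<le> C * \<bar>\<phi> x\<bar>" for N
        by (intro AE_I2) (simp add: norm_mult mult_right_mono Pb)
    qed
    \<comment> \<open>The partial sums of \<open>f\<close> itself converge in \<open>L^2\<close>,
      which suffices by Cauchy--Schwarz against the fixed derivative of
      \<open>\<phi>\<close>.\<close>
    have 2: "(\<lambda>N. \<integral>x. fourier_sum N ?F x * of_real (pderiv2 j \<phi> x) \<partial>cell_measure) \<longlonglongrightarrow>
        (\<integral>x. ?F x * of_real (pderiv2 j \<phi> x) \<partial>cell_measure)"
    proof -
      let ?D = "L2_dist (\<lambda>x. of_real (pderiv2 j \<phi> x)) (\<lambda>_. 0)"
      have LD: "L2_cell (\<lambda>x. of_real (pderiv2 j \<phi> x))"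
        by (rule L2_cell_continuous[OF cc(2)])
      have "cmod ((\<integral>x. fourier_sum N ?F x * of_real (pderiv2 j \<phi> x) \<partial>cell_measure) -
          (\<integral>x. ?F x * of_real (pderiv2 j \<phi> x) \<partial>cell_measure)) \<le> L2_dist ?F (fourier_sum N ?F) * ?D" for N
      proof -
        have "(\<integral>x. fourier_sum N ?F x * of_real (pderiv2 j \<phi> x) \<partial>cell_measure) -
          (\<integral>x. ?F x * of_real (pderiv2 j \<phi> x) \<partial>cell_measure) =
          - (\<integral>x. (?F x - fourier_sum N ?F x) * of_real (pderiv2 j \<phi> x) \<partial>cell_measure)"
          using integrable_L2_mult[OF L2_cell_fourier_sum[of N ?F] LD] integrable_L2_mult[OF f LD]
          by (simp add: left_diff_distrib)
        then show ?thesis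
          using norm_integral_L2_mult_le[OF L2_cell_diff[OF f L2_cell_fourier_sum[of N ?F]] LD]
          by (simp add: L2_dist_def)
      qed
      moreover have "(\<lambda>N. L2_dist ?F (fourier_sum N ?F) * ?D) \<longlonglongrightarrow> 0"
        using tendsto_mult_left_zero[OF L2_dist_fourier_sum_tendsto[OF trig_approximable_real[OF f]]] .
      ultimately have "(\<lambda>N. (\<integral>x. fourier_sum N ?F x * of_real (pderiv2 j \<phi> x) \<partial>cell_measure) -
          (\<integral>x. ?F x * of_real (pderiv2 j \<phi> x) \<partial>cell_measure)) \<longlonglongrightarrow> 0"
        by (rule Lim_null_comparison[OF always_eventually, OF allI])
      then show ?thesis by (rule LIM_zero_cancel)
    qed
    have "(\<integral>x. ?F x * of_real (pderiv2 j \<phi> x) \<partial>cell_measure) = - (\<integral>x. G x * of_real (\<phi> x) \<partial>cell_measure)"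
      using LIMSEQ_unique[OF 2[unfolded parts] 1] .
    \<comment> \<open>The series \<open>G\<close> is handled as a complex function; since
      \<open>f\<close> and \<open>\<phi>\<close> are real, taking real parts keeps the
      identity.\<close>
    then have "Re (complex_of_real (\<integral>x. f x * pderiv2 j \<phi> x \<partial>cell_measure)) =
        - Re (\<integral>x. G x * of_real (\<phi> x) \<partial>cell_measure)"
      unfolding of_real_mult[symmetric] integral_complex_of_real by simp
    also have "Re (\<integral>x. G x * of_real (\<phi> x) \<partial>cell_measure) = (\<integral>x. Re (G x * of_real (\<phi> x)) \<partial>cell_measure)"
      by (rule integral_Re[symmetric], rule integrable_cell_mult_continuous[OF Gint cc(1)])
    finally show "(\<integral>x. f x * pderiv2 j \<phi> x \<partial>cell_measure) = - (\<integral>x. Re (G x) * \<phi> x \<partial>cell_measure)"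
      by simp
  qed
qed

text \<open>The property under the choice operator of \<open>weak_grad\<close>. Existence has to be
  established before anything can be said about the chosen gradient.\<close>

definition is_weak_grad :: "field \<Rightarrow> (real^2 \<Rightarrow> real^2^2) \<Rightarrow> bool" where
  "is_weak_grad v G \<longleftrightarrow> (\<forall>i j. integrable cell_measure (\<lambda>x. G x $ i $ j)) \<and>
     (\<forall>\<phi> i j. test_fun \<phi> \<longrightarrow>
        (\<integral>x. v x $ i * pderiv2 j \<phi> x \<partial>cell_measure) = - (\<integral>x. G x $ i $ j * \<phi> x \<partial>cell_measure))"

text \<open>Modes are admissible test functions, so two weak gradients have the same Fourier
  coefficients entry by entry.\<close>

lemma is_weak_grad_unique:
  assumes "is_weak_grad v G" "is_weak_grad v G'"
  shows "AE x in cell_measure. G x $ i $ j = G' x $ i $ j"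
proof -
  have int: "integrable cell_measure (\<lambda>x. G x $ i $ j)" "integrable cell_measure (\<lambda>x. G' x $ i $ j)"
    using assms unfolding is_weak_grad_def by simp_all
  have "AE x in cell_measure. G x $ i $ j - G' x $ i $ j = 0"
  proof (rule AE_zero_if_trig_coeffs_zero)
    fix k b
    have "(\<integral>x. G x $ i $ j * trig k b x \<partial>cell_measure) = (\<integral>x. G' x $ i $ j * trig k b x \<partial>cell_measure)"
    proof -
      have "- (\<integral>x. G x $ i $ j * trig k b x \<partial>cell_measure) = - (\<integral>x. G' x $ i $ j * trig k b x \<partial>cell_measure)"
        using assms test_fun_trig[of k b] unfolding is_weak_grad_def by simp
      then show ?thesis by simp
    qed
    moreover have "integrable cell_measure (\<lambda>x. G x $ i $ j * trig k b x)"
      "integrable cell_measure (\<lambda>x. G' x $ i $ j * trig k b x)"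
      by (intro integrable_cell_mult_continuous int continuous_intros)+
    ultimately show "(\<integral>x. (G x $ i $ j - G' x $ i $ j) * trig k b x \<partial>cell_measure) = 0"
      by (simp add: left_diff_distrib)
  qed (use int in auto)
  then show ?thesis by simp
qed

lemma is_weak_grad_scaleR:
  assumes "is_weak_grad v G"
  shows "is_weak_grad (\<lambda>x. c *\<^sub>R v x) (\<lambda>x. c *\<^sub>R G x)"
  using assms by (simp add: is_weak_grad_def mult.assoc)

lemma is_weak_grad_weak_grad:
  assumes "is_weak_grad v G"
  shows "is_weak_grad v (weak_grad v)"
  using someI[of "is_weak_grad v", OF assms] unfolding is_weak_grad_def weak_grad_def .

lemma L2field_component:
  assumes "L2field u"
  shows "L2_cell (\<lambda>x. of_real (u x $ i))"
  unfolding L2_cell_def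
proof
  have um: "u \<in> borel_measurable cell_measure" using assms by (simp add: L2field_def)
  have m: "(\<lambda>x. u x $ i) \<in> borel_measurable cell_measure"
    by (rule measurable_compose[OF um, of "\<lambda>y. y $ i" borel])
      (intro borel_measurable_continuous_onI continuous_intros)
  then show m': "(\<lambda>x. complex_of_real (u x $ i)) \<in> borel_measurable cell_measure" by auto
  show "integrable cell_measure (\<lambda>x. (cmod (of_real (u x $ i)))\<^sup>2)"
  proof (rule Bochner_Integration.integrable_bound)
    show "integrable cell_measure (\<lambda>x. (norm (u x))\<^sup>2)" using assms by (simp add: L2field_def)
    show "(\<lambda>x. (cmod (of_real (u x $ i)))\<^sup>2) \<in> borel_measurable cell_measure"
      using m by auto
    show "AE x in cell_measure. norm ((cmod (of_real (u x $ i)))\<^sup>2) \<le> norm ((norm (u x))\<^sup>2)"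
      by (intro AE_I2) (simp add: abs_le_square_iff[symmetric] component_le_norm_cart)
  qed
qed

lemma fourier_coeff_eq: "fourier_coeff u k j = fcoeff (\<lambda>x. of_real (u x $ j)) k"
  by (simp add: fourier_coeff_def fcoeff_def mode_def cis_cnj phase_def freq_def sum_2)

lemma HL_bounded_weak_grad:
  assumes L: "L > 2" and v: "v \<in> HL L"
  obtains G C where "is_weak_grad v G" "\<And>x i j. \<bar>G x $ i $ j\<bar> \<le> C"
proof -
  have L2: "L2_cell (\<lambda>x. of_real (v x $ i))" for i
    using v L2field_component by (auto simp: HL_def Hsp_def)
  \<comment> \<open>Naming the joint property lets \<open>metis\<close> choose derivatives and
    bounds for all pairs of indices at once.\<close>
  define W where "W i j g C \<longleftrightarrow> g \<in> borel_measurable cell_measure \<and> (\<forall>x. \<bar>g x\<bar> \<le> C) \<and>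
      (\<forall>\<phi>. test_fun \<phi> \<longrightarrow>
        (\<integral>x. v x $ i * pderiv2 j \<phi> x \<partial>cell_measure) = - (\<integral>x. g x * \<phi> x \<partial>cell_measure))"
    for i j and g :: "real^2 \<Rightarrow> real" and C :: real
  have "\<exists>g C. W i j g C" for i j
  proof -
    have "(\<lambda>k. bracket k powr L * (cmod (fcoeff (\<lambda>x. of_real (v x $ i)) k))\<^sup>2) summable_on UNIV"
    proof (rule summable_on_comparison_test)
      show "(\<lambda>k. bracket k powr L * (\<Sum>j\<in>UNIV. (cmod (fourier_coeff v k j))\<^sup>2)) summable_on UNIV"
        using v by (simp add: HL_def bracket_def)
      show "bracket k powr L * (cmod (fcoeff (\<lambda>x. of_real (v x $ i)) k))\<^sup>2 \<le>
          bracket k powr L * (\<Sum>j\<in>UNIV. (cmod (fourier_coeff v k j))\<^sup>2)" for k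
        unfolding fourier_coeff_eq[symmetric]
        by (intro mult_left_mono member_le_sum) auto
    qed auto
    then have "(\<lambda>k. \<bar>freq k j\<bar> * cmod (fcoeff (\<lambda>x. of_real (v x $ i)) k)) summable_on UNIV"
      by (intro summable_on_freq_mult[OF L]) auto
    then show ?thesis
    proof (rule ex_bounded_weak_derivative[OF L2])
      fix g C
      assume "g \<in> borel_measurable cell_measure" "\<And>x. \<bar>g x\<bar> \<le> C"
        "\<And>\<phi>. test_fun \<phi> \<Longrightarrow>
          (\<integral>x. v x $ i * pderiv2 j \<phi> x \<partial>cell_measure) = - (\<integral>x. g x * \<phi> x \<partial>cell_measure)"
      then show ?thesis
        by (intro exI[of _ g] exI[of _ C]) (simp add: W_def)
    qed
  qed
  then obtain g C where "\<And>i j. W i j (g i j) (C i j)"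
    by metis
  then have g: "\<And>i j. g i j \<in> borel_measurable cell_measure" "\<And>i j x. \<bar>g i j x\<bar> \<le> C i j"
    "\<And>i j \<phi>. test_fun \<phi> \<Longrightarrow>
      (\<integral>x. v x $ i * pderiv2 j \<phi> x \<partial>cell_measure) = - (\<integral>x. g i j x * \<phi> x \<partial>cell_measure)"
    by (simp_all add: W_def)
  define G :: "real^2 \<Rightarrow> real^2^2" where "G x = (\<chi> i j. g i j x)" for x
  show thesis
  \<comment> \<open>The sum of the four entry bounds is a single constant for all entries, since
    each of them is nonnegative.\<close>
  proof (rule that[of G "\<Sum>i\<in>UNIV. \<Sum>j\<in>UNIV. C i j"])
    have "integrable cell_measure (g i j)" for i j
      using g(1,2) by (intro cell.integrable_const_bound[where B = "C i j"]) auto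
    then show "is_weak_grad v G"
      using g(3) by (simp add: is_weak_grad_def G_def)
    fix x i j
    have C0: "C i j \<ge> 0" for i j using g(2)[of i j x] by linarith
    have "C i j \<le> (\<Sum>j\<in>UNIV. C i j)" using C0 by (intro member_le_sum) auto
    also have "\<dots> \<le> (\<Sum>i\<in>UNIV. \<Sum>j\<in>UNIV. C i j)"
      using C0 by (intro member_le_sum[of i UNIV "\<lambda>i. \<Sum>j\<in>UNIV. C i j"] sum_nonneg) auto
    finally show "\<bar>G x $ i $ j\<bar> \<le> (\<Sum>i\<in>UNIV. \<Sum>j\<in>UNIV. C i j)"
      using g(2)[of i j x] by (simp add: G_def)
  qed
qed

section \<open>The quadratic functional and its weakly continuous approximations\<close>

text \<open>This is \<open>nonlin\<close> with an explicit gradient in place of the chosen one, so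
  that a single bounded \<open>G\<close> can be kept while the scalar multiple of \<open>v\<close>
  varies with \<open>u\<close>.\<close>

definition quad :: "(real^2 \<Rightarrow> real^2^2) \<Rightarrow> field \<Rightarrow> real" where
  "quad G u = (\<integral>x. (\<Sum>i\<in>UNIV. \<Sum>j\<in>UNIV. G x $ i $ j * (u x $ i * u x $ j)) \<partial>cell_measure)"

abbreviation comp_coeff :: "field \<Rightarrow> 2 \<Rightarrow> int \<times> int \<Rightarrow> complex" where
  "comp_coeff u i \<equiv> fcoeff (\<lambda>x. of_real (u x $ i))"

lemma measurable_component_cell: "L2field u \<Longrightarrow> (\<lambda>x. u x $ i) \<in> borel_measurable cell_measure"
  unfolding L2field_def
  by (rule measurable_compose[of u _ borel "\<lambda>y. y $ i"])
    (auto intro: borel_measurable_continuous_onI continuous_intros)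

text \<open>The choice made for \<open>c *\<^sub>R w\<close> bears no relation to that made for
  \<open>w\<close>. Both \<open>weak_grad\<close> of the multiple and \<open>c *\<^sub>R G\<close>
  are weak gradients of it, hence equal almost everywhere, and the integral does not see the
  difference. The case \<open>c = 1\<close> identifies \<open>nonlin w\<close> with
  \<open>quad G\<close> on square-integrable fields.\<close>

lemma nonlin_scaleR:
  assumes G: "is_weak_grad w G" and u: "L2field u"
  shows "nonlin (\<lambda>x. c *\<^sub>R w x) u = c * quad G u"
proof -
  let ?w = "\<lambda>x. c *\<^sub>R w x"
  have cG: "is_weak_grad ?w (\<lambda>x. c *\<^sub>R G x)" by (rule is_weak_grad_scaleR[OF G])
  note wg = is_weak_grad_weak_grad[OF cG]
  have m: "(\<lambda>x. weak_grad ?w x $ i $ j) \<in> borel_measurable cell_measure"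
    "(\<lambda>x. G x $ i $ j) \<in> borel_measurable cell_measure" for i j
    using wg G unfolding is_weak_grad_def by (simp_all add: borel_measurable_integrable)
  note mu = measurable_component_cell[OF u]
  have ae: "AE x in cell_measure. weak_grad ?w x $ i $ j = c * G x $ i $ j" for i j
    using is_weak_grad_unique[OF wg cG, of i j] by simp
  have "nonlin ?w u = (\<integral>x. c * (\<Sum>i\<in>UNIV. \<Sum>j\<in>UNIV. G x $ i $ j * (u x $ i * u x $ j)) \<partial>cell_measure)"
    unfolding nonlin_def
  proof (rule integral_cong_AE)
    show "(\<lambda>x. \<Sum>i\<in>UNIV. \<Sum>j\<in>UNIV. weak_grad ?w x $ i $ j * (u x $ i * u x $ j))
        \<in> borel_measurable cell_measure"
      by (intro borel_measurable_sum borel_measurable_times m mu)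
    show "(\<lambda>x. c * (\<Sum>i\<in>UNIV. \<Sum>j\<in>UNIV. G x $ i $ j * (u x $ i * u x $ j)))
        \<in> borel_measurable cell_measure"
      by (intro borel_measurable_sum borel_measurable_times m mu borel_measurable_const)
    show "AE x in cell_measure. (\<Sum>i\<in>UNIV. \<Sum>j\<in>UNIV. weak_grad ?w x $ i $ j * (u x $ i * u x $ j)) =
        c * (\<Sum>i\<in>UNIV. \<Sum>j\<in>UNIV. G x $ i $ j * (u x $ i * u x $ j))"
      using ae[of 1 1] ae[of 1 2] ae[of 2 1] ae[of 2 2]
      by eventually_elim (simp add: sum_2 algebra_simps)
  qed
  then show ?thesis by (simp add: quad_def)
qed

lemma l2norm_sq: "(l2norm u)\<^sup>2 = (\<integral>x. (norm (u x))\<^sup>2 \<partial>cell_measure)"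
  by (simp add: l2norm_def l2inner_def dot_square_norm)

lemma l2norm_nonneg: "0 \<le> l2norm u"
  by (simp add: l2norm_def l2inner_def)

lemma integrable_quad:
  assumes G: "is_weak_grad w G" and C: "\<And>x i j. \<bar>G x $ i $ j\<bar> \<le> C" and u: "L2field u"
  shows "integrable cell_measure (\<lambda>x. G x $ i $ j * (u x $ i * u x $ j))"
    and "(\<integral>x. \<bar>G x $ i $ j * (u x $ i * u x $ j)\<bar> \<partial>cell_measure) \<le> C * (l2norm u)\<^sup>2"
proof -
  have C0: "C \<ge> 0" using C[of 0 1 1] by linarith
  have un: "integrable cell_measure (\<lambda>x. C * (norm (u x))\<^sup>2)"
    using u by (simp add: L2field_def)
  have m: "(\<lambda>x. G x $ i $ j) \<in> borel_measurable cell_measure"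
    using G unfolding is_weak_grad_def by (simp add: borel_measurable_integrable)
  have le: "\<bar>G x $ i $ j * (u x $ i * u x $ j)\<bar> \<le> C * (norm (u x))\<^sup>2" for x
    unfolding abs_mult power2_eq_square
    by (intro mult_mono C component_le_norm_cart) (auto simp: C0)
  show int: "integrable cell_measure (\<lambda>x. G x $ i $ j * (u x $ i * u x $ j))"
    by (rule Bochner_Integration.integrable_bound[OF un])
      (use le C0 in \<open>auto intro!: borel_measurable_times m measurable_component_cell u\<close>)
  have "(\<integral>x. \<bar>G x $ i $ j * (u x $ i * u x $ j)\<bar> \<partial>cell_measure) \<le> (\<integral>x. C * (norm (u x))\<^sup>2 \<partial>cell_measure)"
    using int le un by (intro integral_mono) auto
  then show "(\<integral>x. \<bar>G x $ i $ j * (u x $ i * u x $ j)\<bar> \<partial>cell_measure) \<le> C * (l2norm u)\<^sup>2"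
    by (simp add: l2norm_sq)
qed

lemma quad_eq_sum:
  assumes "is_weak_grad w G" "\<And>x i j. \<bar>G x $ i $ j\<bar> \<le> C" "L2field u"
  shows "quad G u = (\<Sum>i\<in>UNIV. \<Sum>j\<in>UNIV. \<integral>x. G x $ i $ j * (u x $ i * u x $ j) \<partial>cell_measure)"
  unfolding quad_def
  by (simp add: sum_2 integrable_quad(1)[OF assms])

text \<open>The factor 4 counts the entries of the gradient.\<close>

lemma abs_quad_le:
  assumes "is_weak_grad w G" "\<And>x i j. \<bar>G x $ i $ j\<bar> \<le> C" "L2field u"
  shows "\<bar>quad G u\<bar> \<le> 4 * C * (l2norm u)\<^sup>2"
proof -
  have "\<bar>\<integral>x. G x $ i $ j * (u x $ i * u x $ j) \<partial>cell_measure\<bar> \<le> C * (l2norm u)\<^sup>2" for i j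
    by (rule order_trans[OF integral_abs_bound integrable_quad(2)[OF assms]])
  from this[of 1 1] this[of 1 2] this[of 2 1] this[of 2 2] show ?thesis
    unfolding quad_eq_sum[OF assms] sum_2 by linarith
qed

text \<open>The bilinear error is telescoped so that each part contains one factor tending to 0 in
  \<open>L^2\<close>. The other factor is bounded, by Bessel's inequality where it is a partial sum,
  and the bounded weight \<open>a\<close> preserves Cauchy--Schwarz up to the factor
  \<open>C\<close>.\<close>

lemma integral_bounded_fourier_sum_tendsto:
  assumes a: "a \<in> borel_measurable cell_measure" "\<And>x. cmod (a x) \<le> C"
    and f: "trig_approximable f" and g: "trig_approximable g"
  shows "(\<lambda>N. \<integral>x. a x * (fourier_sum N f x * cnj (fourier_sum N g x)) \<partial>cell_measure) \<longlonglongrightarrow>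
     (\<integral>x. a x * (f x * cnj (g x)) \<partial>cell_measure)"
proof -
  have Lf: "L2_cell f" and Lg: "L2_cell g" using f g by (auto simp: trig_approximable_def)
  have C0: "C \<ge> 0" using a(2)[of 0] norm_ge_zero order_trans by blast
  have int: "integrable cell_measure (\<lambda>x. a x * (p x * q x))" if "L2_cell p" "L2_cell q" for p q
    using integrable_cell_mult_bounded[OF integrable_L2_mult[OF that] a(1), of C] a(2)
    by (simp add: mult.commute)
  have bound: "cmod (\<integral>x. a x * (p x * q x) \<partial>cell_measure) \<le> C * (L2_dist p (\<lambda>_. 0) * L2_dist q (\<lambda>_. 0))"
    if pq: "L2_cell p" "L2_cell q" for p q
  proof -
    have "cmod (\<integral>x. a x * (p x * q x) \<partial>cell_measure) \<le> (\<integral>x. C * (cmod (p x) * cmod (q x)) \<partial>cell_measure)"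
    proof (rule order_trans[OF integral_norm_bound], rule integral_mono)
      show "integrable cell_measure (\<lambda>x. cmod (a x * (p x * q x)))" using int[OF pq] by auto
      show "integrable cell_measure (\<lambda>x. C * (cmod (p x) * cmod (q x)))"
        using integrable_norm[OF integrable_L2_mult[OF pq]] by (simp add: norm_mult)
      show "cmod (a x * (p x * q x)) \<le> C * (cmod (p x) * cmod (q x))" for x
        unfolding norm_mult by (intro mult_right_mono a(2)) auto
    qed
    also have "\<dots> \<le> C * (L2_dist p (\<lambda>_. 0) * L2_dist q (\<lambda>_. 0))"
      using Cauchy_Schwarz_cell[OF pq] C0 by (simp add: mult_left_mono)
    finally show ?thesis .
  qed
  define R where "R N = C * (L2_dist f (fourier_sum N f) * L2_dist g (\<lambda>_. 0)) +
      C * (L2_dist f (\<lambda>_. 0) * L2_dist g (fourier_sum N g))" for N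
  have "cmod ((\<integral>x. a x * (fourier_sum N f x * cnj (fourier_sum N g x)) \<partial>cell_measure) -
     (\<integral>x. a x * (f x * cnj (g x)) \<partial>cell_measure)) \<le> R N" for N
  proof -
    let ?p = "\<lambda>x. f x - fourier_sum N f x" and ?q = "\<lambda>x. g x - fourier_sum N g x"
    note L = L2_cell_fourier_sum[of N f] L2_cell_cnj[OF L2_cell_fourier_sum[of N g]] L2_cell_cnj[OF Lg]
      L2_cell_diff[OF Lf L2_cell_fourier_sum[of N f]] L2_cell_cnj[OF L2_cell_diff[OF Lg L2_cell_fourier_sum[of N g]]]
    \<comment> \<open>First \<open>f\<close> is exchanged against the full \<open>g\<close>, then
      \<open>g\<close> against the partial sum of \<open>f\<close>; only the latter needs Bessel's
      inequality.\<close>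
    have e: "a x * (fourier_sum N f x * cnj (fourier_sum N g x)) =
       a x * (f x * cnj (g x)) - a x * (?p x * cnj (g x)) - a x * (fourier_sum N f x * cnj (?q x))" for x
      by (simp add: algebra_simps)
    have "(\<integral>x. a x * (fourier_sum N f x * cnj (fourier_sum N g x)) \<partial>cell_measure) =
      (\<integral>x. a x * (f x * cnj (g x)) \<partial>cell_measure) - (\<integral>x. a x * (?p x * cnj (g x)) \<partial>cell_measure)
      - (\<integral>x. a x * (fourier_sum N f x * cnj (?q x)) \<partial>cell_measure)"
      unfolding e
      using int[OF Lf L(3)] int[OF L(4,3)] int[OF L(1,5)]
      by (subst Bochner_Integration.integral_diff Bochner_Integration.integrable_diff; simp)+
    then have "(\<integral>x. a x * (fourier_sum N f x * cnj (fourier_sum N g x)) \<partial>cell_measure) -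
        (\<integral>x. a x * (f x * cnj (g x)) \<partial>cell_measure) =
      - ((\<integral>x. a x * (?p x * cnj (g x)) \<partial>cell_measure) + (\<integral>x. a x * (fourier_sum N f x * cnj (?q x)) \<partial>cell_measure))"
      by simp
    then have "cmod ((\<integral>x. a x * (fourier_sum N f x * cnj (fourier_sum N g x)) \<partial>cell_measure) -
        (\<integral>x. a x * (f x * cnj (g x)) \<partial>cell_measure)) =
      cmod ((\<integral>x. a x * (?p x * cnj (g x)) \<partial>cell_measure) + (\<integral>x. a x * (fourier_sum N f x * cnj (?q x)) \<partial>cell_measure))"
      by (simp only: norm_minus_cancel)
    also have "\<dots> \<le> C * (L2_dist ?p (\<lambda>_. 0) * L2_dist (\<lambda>x. cnj (g x)) (\<lambda>_. 0)) +
        C * (L2_dist (fourier_sum N f) (\<lambda>_. 0) * L2_dist (\<lambda>x. cnj (?q x)) (\<lambda>_. 0))"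
      by (rule order_trans[OF norm_triangle_ineq add_mono[OF bound[OF L(4,3)] bound[OF L(1,5)]]])
    also have "\<dots> \<le> R N"
    proof -
      have 1: "L2_dist ?p (\<lambda>_. 0) = L2_dist f (fourier_sum N f)"
        "L2_dist (\<lambda>x. cnj (g x)) (\<lambda>_. 0) = L2_dist g (\<lambda>_. 0)"
        by (simp_all add: L2_dist_def)
      have 2: "L2_dist (\<lambda>x. cnj (?q x)) (\<lambda>_. 0) = L2_dist g (fourier_sum N g)"
        unfolding L2_dist_def complex_cnj_zero diff_zero complex_mod_cnj ..
      show ?thesis
        unfolding 1 2 R_def
        by (intro add_left_mono mult_left_mono mult_right_mono L2_dist_zero_fourier_sum_le Lf L2_dist_nonneg C0)
    qed
    finally show ?thesis .
  qed
  moreover have "R \<longlonglongrightarrow> 0"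
  proof -
    have "(\<lambda>N. C * (L2_dist f (fourier_sum N f) * L2_dist g (\<lambda>_. 0)) +
      C * (L2_dist f (\<lambda>_. 0) * L2_dist g (fourier_sum N g))) \<longlonglongrightarrow> C * (0 * L2_dist g (\<lambda>_. 0)) + C * (L2_dist f (\<lambda>_. 0) * 0)"
      by (intro tendsto_intros L2_dist_fourier_sum_tendsto f g)
    then show ?thesis by (simp add: R_def[abs_def])
  qed
  ultimately have "(\<lambda>N. (\<integral>x. a x * (fourier_sum N f x * cnj (fourier_sum N g x)) \<partial>cell_measure) -
     (\<integral>x. a x * (f x * cnj (g x)) \<partial>cell_measure)) \<longlonglongrightarrow> 0"
    by (rule Lim_null_comparison[OF always_eventually, OF allI])
  then show ?thesis by (rule LIM_zero_cancel)
qed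

text \<open>The form \<open>quad G\<close> at the Fourier partial sums of \<open>u\<close>,
  multiplied out: a finite polynomial in the coefficients of \<open>u\<close>, with constants
  depending on \<open>G\<close> only. Single terms may be complex, hence the real parts.\<close>

definition quad_approx :: "nat \<Rightarrow> (real^2 \<Rightarrow> real^2^2) \<Rightarrow> field \<Rightarrow> real" where
  "quad_approx N G u = (\<Sum>i\<in>UNIV. \<Sum>j\<in>UNIV. \<Sum>k\<in>freqs N. \<Sum>l\<in>freqs N.
     Re (comp_coeff u i k * cnj (comp_coeff u j l) *
       (\<integral>x. of_real (G x $ i $ j) * (mode k x * cnj (mode l x)) \<partial>cell_measure)))"

lemma quad_approx_tendsto:
  assumes G: "is_weak_grad w G" and C: "\<And>x i j. \<bar>G x $ i $ j\<bar> \<le> C" and u: "L2field u"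
  shows "(\<lambda>N. quad_approx N G u) \<longlonglongrightarrow> quad G u"
  unfolding quad_eq_sum[OF assms] quad_approx_def
proof (intro tendsto_sum)
  fix i j :: 2
  let ?f = "\<lambda>x. complex_of_real (u x $ i)" and ?g = "\<lambda>x. complex_of_real (u x $ j)"
  let ?a = "\<lambda>x. complex_of_real (G x $ i $ j)"
  have Gi: "integrable cell_measure (\<lambda>x. G x $ i $ j)"
    using G unfolding is_weak_grad_def by simp
  then have Gm: "?a \<in> borel_measurable cell_measure"
    by (auto dest: borel_measurable_integrable)
  have int: "integrable cell_measure (\<lambda>x. ?a x * (mode k x * cnj (mode l x)))" for k l
    by (rule integrable_cell_mult_continuous) (use Gi in \<open>auto intro!: continuous_intros\<close>)
  have "(\<integral>x. ?a x * (fourier_sum N ?f x * cnj (fourier_sum N ?g x)) \<partial>cell_measure) =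
     (\<Sum>k\<in>freqs N. \<Sum>l\<in>freqs N. comp_coeff u i k * cnj (comp_coeff u j l) *
       (\<integral>x. ?a x * (mode k x * cnj (mode l x)) \<partial>cell_measure))" for N
  proof -
    have "?a x * (fourier_sum N ?f x * cnj (fourier_sum N ?g x)) =
      (\<Sum>k\<in>freqs N. \<Sum>l\<in>freqs N. comp_coeff u i k * cnj (comp_coeff u j l) * (?a x * (mode k x * cnj (mode l x))))" for x
      unfolding fourier_sum_def cnj_sum
      by (subst sum_product) (simp add: sum_distrib_left mult_ac)
    then show ?thesis
      using int by (simp add: Bochner_Integration.integral_sum Bochner_Integration.integrable_sum)
  qed
  moreover have "(\<lambda>N. Re (\<integral>x. ?a x * (fourier_sum N ?f x * cnj (fourier_sum N ?g x)) \<partial>cell_measure)) \<longlonglongrightarrow>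
     Re (\<integral>x. ?a x * (?f x * cnj (?g x)) \<partial>cell_measure)"
    by (intro tendsto_Re integral_bounded_fourier_sum_tendsto[OF Gm, of C] trig_approximable_real
        L2field_component u) (simp add: C)
  moreover have "?a x * (?f x * cnj (?g x)) = complex_of_real (G x $ i $ j * (u x $ i * u x $ j))" for x
    by simp
  ultimately show "(\<lambda>N. \<Sum>k\<in>freqs N. \<Sum>l\<in>freqs N.
     Re (comp_coeff u i k * cnj (comp_coeff u j l) * (\<integral>x. ?a x * (mode k x * cnj (mode l x)) \<partial>cell_measure)))
    \<longlonglongrightarrow> (\<integral>x. G x $ i $ j * (u x $ i * u x $ j) \<partial>cell_measure)"
    by (simp only: Re_sum integral_complex_of_real Re_complex_of_real)
qed

section \<open>Fourier coefficients as weakly continuous functionals\<close>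

text \<open>The Leray projection of the field \<open>trig k b\<close> in direction \<open>j\<close>; for \<open>k = 0\<close> the quotient
  is \<open>0 / 0 = 0\<close>, as it should be.\<close>

definition leray :: "2 \<Rightarrow> int \<times> int \<Rightarrow> real \<Rightarrow> field" where
  "leray j k b x = trig k b x *\<^sub>R
     (axis j 1 - (freq k j / (\<Sum>i\<in>UNIV. (freq k i)\<^sup>2)) *\<^sub>R (\<chi> i. freq k i))"

text \<open>The amplitude \<open>a\<close> is orthogonal to the frequency vector. Integration by
  parts against a gradient produces exactly this scalar product as a factor.\<close>

lemma leray_in_Hsp: "leray j k b \<in> Hsp"
proof -
  define a where "a = axis j 1 - (freq k j / (\<Sum>i\<in>UNIV. (freq k i)\<^sup>2)) *\<^sub>R (\<chi> i. freq k i)"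
  have l: "leray j k b = (\<lambda>x. trig k b x *\<^sub>R a)" by (auto simp: leray_def a_def)
  have ak: "(\<Sum>i\<in>UNIV. a $ i * freq k i) = 0"
  proof (cases "(\<Sum>i\<in>UNIV. (freq k i)\<^sup>2) = 0")
    case True
    then have "freq k i = 0" for i by (simp add: sum_nonneg_eq_0_iff)
    then show ?thesis by simp
  next
    case False
    have "(\<Sum>i\<in>UNIV. a $ i * freq k i) = (\<Sum>i\<in>UNIV. axis j 1 $ i * freq k i)
        - (freq k j / (\<Sum>i\<in>UNIV. (freq k i)\<^sup>2)) * (\<Sum>i\<in>UNIV. (freq k i)\<^sup>2)"
      by (simp add: a_def left_diff_distrib sum_subtractf sum_distrib_left power2_eq_square mult.assoc)
    also have "\<dots> = 0"
      using False by (simp add: axis_def if_distrib[of "\<lambda>x. x * _"] cong: if_cong)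
    finally show ?thesis .
  qed
  have "L2field (leray j k b)"
    unfolding L2field_def
  proof (intro conjI)
    show "periodic (leray j k b)"
      using trig_periodic[of k b] by (simp add: l periodic_def)
    have c: "continuous_on UNIV (leray j k b)" unfolding l by (intro continuous_intros)
    then show "leray j k b \<in> borel_measurable cell_measure" by (rule measurable_cell_continuous)
    show "integrable cell_measure (\<lambda>x. (norm (leray j k b x))\<^sup>2)"
      by (intro integrable_cell_continuous continuous_intros c)
  qed
  moreover have "div_free (leray j k b)"
    unfolding div_free_def
  proof (intro allI impI)
    fix \<phi> assume \<phi>: "test_fun \<phi>"
    note cont = test_fun_derivative(2)[OF \<phi>]
    have "(\<integral>x. (\<Sum>i\<in>UNIV. leray j k b x $ i * pderiv2 i \<phi> x) \<partial>cell_measure) =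
       (\<integral>x. (\<Sum>i\<in>UNIV. a $ i * (trig k b x * pderiv2 i \<phi> x)) \<partial>cell_measure)"
      by (simp add: l mult_ac)
    also have "\<dots> = (\<Sum>i\<in>UNIV. a $ i * (\<integral>x. trig k b x * pderiv2 i \<phi> x \<partial>cell_measure))"
      by (subst Bochner_Integration.integral_sum)
        (auto intro!: integrable_cell_continuous continuous_intros cont)
    also have "\<dots> = (\<Sum>i\<in>UNIV. a $ i * freq k i) * (- 2 * pi * (\<integral>x. trig k (b + pi/2) x * \<phi> x \<partial>cell_measure))"
      unfolding integral_trig_parts[OF \<phi>] sum_distrib_right by (intro sum.cong refl) simp
    finally show "(\<integral>x. (\<Sum>i\<in>UNIV. leray j k b x $ i * pderiv2 i \<phi> x) \<partial>cell_measure) = 0"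
      by (simp add: ak)
  qed
  ultimately show ?thesis by (simp add: Hsp_def)
qed

lemma integrable_component_trig:
  assumes "L2field u"
  shows "integrable cell_measure (\<lambda>x. u x $ i * trig k b x)"
proof -
  have "integrable cell_measure (\<lambda>x. Re (of_real (u x $ i) * of_real 1))"
    using integrable_L2_mult[OF L2field_component[OF assms] L2_cell_continuous[OF continuous_on_const]]
    by (rule integrable_Re)
  then show ?thesis
    by (intro integrable_cell_mult_continuous continuous_intros) simp
qed

text \<open>The projection removes a multiple of a gradient mode, and a divergence-free
  \<open>u\<close> is orthogonal to gradients. Hence pairing \<open>u\<close> with a single
  component of a mode can be tested within \<open>Hsp\<close>.\<close>

lemma l2inner_leray:
  assumes u: "u \<in> Hsp"
  shows "l2inner u (leray j k b) = (\<integral>x. u x $ j * trig k b x \<partial>cell_measure)"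
proof -
  have L: "L2field u" and div: "div_free u" using u by (auto simp: Hsp_def)
  define c where "c = freq k j / (\<Sum>i\<in>UNIV. (freq k i)\<^sup>2)"
  define D where "D x = (\<Sum>i\<in>UNIV. freq k i * (u x $ i * trig k b x))" for x
  have Di: "integrable cell_measure D"
    unfolding D_def[abs_def] by (intro Bochner_Integration.integrable_sum integrable_mult_right integrable_component_trig L)
  \<comment> \<open>The offset \<open>b - pi/2\<close> is chosen so that differentiation brings it
    to \<open>b\<close>.\<close>
  have "(\<integral>x. (\<Sum>i\<in>UNIV. u x $ i * pderiv2 i (trig k (b - pi/2)) x) \<partial>cell_measure) = 0"
    using div test_fun_trig unfolding div_free_def by blast
  also have "(\<lambda>x. \<Sum>i\<in>UNIV. u x $ i * pderiv2 i (trig k (b - pi/2)) x) = (\<lambda>x. 2 * pi * D x)"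
    by (simp add: pderiv2_trig D_def sum_distrib_left mult_ac)
  finally have D0: "(\<integral>x. D x \<partial>cell_measure) = 0" by simp
  have e: "u x \<bullet> leray j k b x = u x $ j * trig k b x - c * D x" for x
  proof -
    have "u x \<bullet> (\<chi> i. freq k i) * trig k b x = D x"
      by (simp add: D_def inner_vec_def sum_distrib_left sum_distrib_right mult_ac)
    then show ?thesis
      by (simp add: leray_def c_def[symmetric] inner_diff_right inner_axis algebra_simps)
  qed
  show ?thesis
    unfolding l2inner_def e using Di integrable_component_trig[OF L] by (simp add: D0)
qed

text \<open>The conjugate mode has imaginary part \<open>- sin\<close>, which is the cosine with
  offset \<open>pi/2\<close>.\<close>

lemma comp_coeff_eq_l2inner:
  assumes u: "u \<in> Hsp"
  shows "comp_coeff u j k = Complex (l2inner u (leray j k 0)) (l2inner u (leray j k (pi/2)))"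
proof -
  have e: "of_real (u x $ j) * cnj (mode k x) = Complex (u x $ j * trig k 0 x) (u x $ j * trig k (pi/2) x)" for x
    by (simp add: mode_def trig_def complex_eq_iff cos_add)
  show ?thesis
    unfolding fcoeff_def e l2inner_leray[OF u]
    by (rule integral_Complex) (use u in \<open>auto simp: Hsp_def intro!: integrable_component_trig\<close>)
qed

lemma topspace_H_weak: "topspace H_weak = Hsp"
proof -
  \<comment> \<open>Any member of \<open>Hsp\<close> would do: with \<open>U = UNIV\<close> its
    subbasic set is all of \<open>Hsp\<close>.\<close>
  have "Hsp = {u \<in> Hsp. l2inner u (leray 1 0 0) \<in> UNIV}" by simp
  then have "Hsp \<subseteq> \<Union>{{u \<in> Hsp. l2inner u g \<in> U} | g U. g \<in> Hsp \<and> open U}"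
    using leray_in_Hsp open_UNIV by blast
  then show ?thesis
    unfolding H_weak_def topology_generated_by_topspace by blast
qed

lemma continuous_map_l2inner:
  assumes "g \<in> Hsp"
  shows "continuous_map H_weak euclideanreal (\<lambda>u. l2inner u g)"
  unfolding continuous_map_def topspace_H_weak
proof (intro conjI allI impI)
  fix U :: "real set" assume "openin euclideanreal U"
  then have "open U" by simp
  then show "openin H_weak {u \<in> Hsp. l2inner u g \<in> U}"
    unfolding H_weak_def using assms by (intro topology_generated_by_Basis) blast
qed auto

text \<open>With real and imaginary parts multiplied out, weak continuity and Borel measurability
  can be read off as closure under real sums and products.\<close>

lemma quad_approx_eq:
  assumes "u \<in> Hsp"
  shows "quad_approx N G u = (\<Sum>i\<in>UNIV. \<Sum>j\<in>UNIV. \<Sum>k\<in>freqs N. \<Sum>l\<in>freqs N.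
    (let m = (\<integral>x. of_real (G x $ i $ j) * (mode k x * cnj (mode l x)) \<partial>cell_measure);
         a = (\<lambda>u. l2inner u (leray i k 0)); a' = (\<lambda>u. l2inner u (leray i k (pi/2)));
         b = (\<lambda>u. l2inner u (leray j l 0)); b' = (\<lambda>u. l2inner u (leray j l (pi/2)))
     in (a u * b u + a' u * b' u) * Re m - (a' u * b u - a u * b' u) * Im m))"
  unfolding quad_approx_def comp_coeff_eq_l2inner[OF assms] Let_def
  by (simp only: times_complex.sel complex.sel cnj.sel mult_minus_right diff_minus_eq_add
      uminus_add_conv_diff minus_mult_left[symmetric])

lemma continuous_map_quad_approx: "continuous_map H_weak euclideanreal (quad_approx N G)"
proof (rule continuous_map_eq)
  show "continuous_map H_weak euclideanreal (\<lambda>u. \<Sum>i\<in>UNIV. \<Sum>j\<in>UNIV. \<Sum>k\<in>freqs N. \<Sum>l\<in>freqs N.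
    (let m = (\<integral>x. of_real (G x $ i $ j) * (mode k x * cnj (mode l x)) \<partial>cell_measure);
         a = (\<lambda>u. l2inner u (leray i k 0)); a' = (\<lambda>u. l2inner u (leray i k (pi/2)));
         b = (\<lambda>u. l2inner u (leray j l 0)); b' = (\<lambda>u. l2inner u (leray j l (pi/2)))
     in (a u * b u + a' u * b' u) * Re m - (a' u * b u - a u * b' u) * Im m))"
    unfolding Let_def
    by (intro continuous_map_sum finite_freqs finite_class.finite_UNIV continuous_map_diff continuous_map_add
        continuous_map_real_mult_right continuous_map_real_mult continuous_map_l2inner leray_in_Hsp)
qed (simp only: topspace_H_weak quad_approx_eq)

section \<open>Borel measurability on \<open>H\<close>\<close>

lemma L2_dist_component_le:
  assumes "L2field u"
  shows "L2_dist (\<lambda>x. of_real (u x $ i)) (\<lambda>_. 0) \<le> l2norm u"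
proof -
  have "(\<integral>x. (cmod (of_real (u x $ i) - 0))\<^sup>2 \<partial>cell_measure) \<le> (\<integral>x. (norm (u x))\<^sup>2 \<partial>cell_measure)"
    using assms L2field_component[OF assms, of i] unfolding L2field_def L2_cell_def
    by (intro integral_mono) (auto simp: abs_le_square_iff[symmetric] component_le_norm_cart)
  then show ?thesis
    by (simp add: L2_dist_def l2norm_def l2inner_def dot_square_norm)
qed

lemma L2field_diff:
  assumes "L2field u" "L2field w"
  shows "L2field (w - u)"
  unfolding L2field_def
proof (intro conjI)
  show "periodic (w - u)" using assms by (simp add: L2field_def periodic_def)
  show m: "w - u \<in> borel_measurable cell_measure"
    using assms unfolding L2field_def fun_diff_def by (intro borel_measurable_diff) auto
  have eq: "(norm ((w - u) x))\<^sup>2 = (\<Sum>i\<in>UNIV. (cmod (of_real (w x $ i) - of_real (u x $ i)))\<^sup>2)" for x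
    by (simp add: norm_vec_def L2_set_def sum_nonneg flip: of_real_diff)
  show "integrable cell_measure (\<lambda>x. (norm ((w - u) x))\<^sup>2)"
    unfolding eq
    using L2_cell_diff[OF L2field_component[OF assms(2)] L2field_component[OF assms(1)]]
    by (intro Bochner_Integration.integrable_sum) (simp add: L2_cell_def)
qed

lemma integrable_inner_L2field:
  assumes "L2field u" "L2field g"
  shows "integrable cell_measure (\<lambda>x. u x $ i * g x $ i)"
  using integrable_Re[OF integrable_L2_mult[OF L2field_component[OF assms(1)] L2field_component[OF assms(2)]]]
  by simp

lemma l2inner_eq_sum:
  assumes "L2field u" "L2field g"
  shows "l2inner u g = (\<Sum>i\<in>UNIV. \<integral>x. u x $ i * g x $ i \<partial>cell_measure)"
  unfolding l2inner_def inner_vec_def inner_real_def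
  by (rule Bochner_Integration.integral_sum) (rule integrable_inner_L2field[OF assms])

text \<open>Cauchy--Schwarz is applied to each component separately, whence the factor 2; this is
  enough for continuity.\<close>

lemma abs_l2inner_le:
  assumes "L2field u" "L2field g"
  shows "\<bar>l2inner u g\<bar> \<le> 2 * l2norm u * l2norm g"
proof -
  have "\<bar>\<integral>x. u x $ i * g x $ i \<partial>cell_measure\<bar> \<le> l2norm u * l2norm g" for i
  proof -
    have "\<bar>\<integral>x. u x $ i * g x $ i \<partial>cell_measure\<bar>
        = cmod (\<integral>x. of_real (u x $ i) * of_real (g x $ i) \<partial>cell_measure)"
      unfolding of_real_mult[symmetric] integral_complex_of_real by simp
    also have "\<dots> \<le> l2norm u * l2norm g"
      by (rule order_trans[OF norm_integral_L2_mult_le])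
        (use assms in \<open>auto intro!: L2field_component mult_mono L2_dist_component_le L2_dist_nonneg l2norm_nonneg\<close>)
    finally show ?thesis .
  qed
  from this[of 1] this[of 2] show ?thesis
    unfolding l2inner_eq_sum[OF assms] sum_2 by linarith
qed

text \<open>Pairing with \<open>g\<close> is continuous for the norm, so preimages of open sets are
  among the generators of \<open>H_borel\<close>.\<close>

lemma measurable_l2inner:
  assumes M: "borel_prob_H M" and g: "L2field g"
  shows "(\<lambda>u. l2inner u g) \<in> borel_measurable M"
proof (rule borel_measurableI)
  fix S :: "real set" assume "open S"
  have "H_open {u \<in> Hsp. l2inner u g \<in> S}"
    unfolding H_open_def
  proof (intro conjI ballI)
    fix u assume "u \<in> {u \<in> Hsp. l2inner u g \<in> S}"
    then have u: "u \<in> Hsp" "l2inner u g \<in> S" by auto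
    obtain e where e: "e > 0" "\<And>y. \<bar>y - l2inner u g\<bar> < e \<Longrightarrow> y \<in> S"
      using \<open>open S\<close> u(2) unfolding open_dist dist_real_def by blast
    \<comment> \<open>The summand 1 keeps the denominator positive when \<open>g\<close> has norm
      0.\<close>
    define d where "d = e / (2 * l2norm g + 1)"
    have d: "d > 0" using e(1) l2norm_nonneg[of g] by (simp add: d_def)
    have "w \<in> {u \<in> Hsp. l2inner u g \<in> S}" if w: "w \<in> Hsp" "l2norm (w - u) < d" for w
    proof -
      have Lu: "L2field u" and Lw: "L2field w" using u w by (auto simp: Hsp_def)
      have "l2inner (w - u) g = l2inner w g - l2inner u g"
        unfolding l2inner_eq_sum[OF L2field_diff[OF Lu Lw] g] l2inner_eq_sum[OF Lu g] l2inner_eq_sum[OF Lw g]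
        using integrable_inner_L2field[OF Lu g] integrable_inner_L2field[OF Lw g]
        by (simp add: sum_2 left_diff_distrib)
      then have "\<bar>l2inner w g - l2inner u g\<bar> \<le> 2 * l2norm (w - u) * l2norm g"
        using abs_l2inner_le[OF L2field_diff[OF Lu Lw] g] by simp
      also have "\<dots> \<le> l2norm (w - u) * (2 * l2norm g + 1)"
        using l2norm_nonneg[of "w - u"] by (simp add: algebra_simps)
      also have "\<dots> < d * (2 * l2norm g + 1)"
        using w(2) l2norm_nonneg[of g] by (intro mult_strict_right_mono) auto
      also have "\<dots> = e"
        using l2norm_nonneg[of g] by (simp add: d_def)
      finally show ?thesis using e(2) w(1) by simp
    qed
    then show "\<exists>d>0. \<forall>w\<in>Hsp. l2norm (w - u) < d \<longrightarrow> w \<in> {u \<in> Hsp. l2inner u g \<in> S}"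
      using d by blast
  qed auto
  then have "{u \<in> Hsp. l2inner u g \<in> S} \<in> H_borel"
    unfolding H_borel_def by (intro sigma_sets.Basic) simp
  moreover have "(\<lambda>u. l2inner u g) -` S \<inter> space M = {u \<in> Hsp. l2inner u g \<in> S}"
    using M by (auto simp: borel_prob_H_def)
  ultimately show "(\<lambda>u. l2inner u g) -` S \<inter> space M \<in> sets M"
    using M by (simp add: borel_prob_H_def)
qed

lemma measurable_quad_approx:
  assumes M: "borel_prob_H M"
  shows "quad_approx N G \<in> borel_measurable M"
proof -
  have sp: "space M = Hsp" using M by (simp add: borel_prob_H_def)
  have L: "L2field (leray j k b)" for j k b using leray_in_Hsp by (auto simp: Hsp_def)
  show ?thesis
    apply (subst measurable_cong[OF quad_approx_eq])
    unfolding sp Let_def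
     apply assumption
    by (intro borel_measurable_sum borel_measurable_diff borel_measurable_add
        borel_measurable_times borel_measurable_const measurable_l2inner[OF M L])
qed

text \<open>Measurability is inherited from the finite-frequency approximations, which converge at
  every point of \<open>Hsp\<close>.\<close>

lemma measurable_quad:
  assumes M: "borel_prob_H M" and G: "is_weak_grad w G" "\<And>x i j. \<bar>G x $ i $ j\<bar> \<le> C"
  shows "quad G \<in> borel_measurable M"
proof (rule borel_measurable_LIMSEQ_metric)
  show "quad_approx N G \<in> borel_measurable M" for N
    by (rule measurable_quad_approx[OF M])
  show "(\<lambda>N. quad_approx N G u) \<longlonglongrightarrow> quad G u" if "u \<in> space M" for u
    using that M by (intro quad_approx_tendsto[OF G]) (auto simp: borel_prob_H_def Hsp_def)
qed

section \<open>Passage to the limit in the statistical solution\<close>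

text \<open>By completeness of Lebesgue measure, a change on a null set of times preserves
  measurability. The energy bound holds for almost every time only, so the integrals over phase
  space are identified up to such sets.\<close>

lemma measurable_lebesgue_on_AE:
  fixes f g :: "'a::euclidean_space \<Rightarrow> 'b::euclidean_space"
  assumes S: "S \<in> sets lebesgue" and f: "f \<in> borel_measurable (lebesgue_on S)"
    and ae: "AE x in lebesgue_on S. f x = g x"
  shows "g \<in> borel_measurable (lebesgue_on S)"
proof -
  have "(\<lambda>x. if x \<in> S then f x else 0) \<in> borel_measurable lebesgue"
    using S f by (simp add: borel_measurable_if)
  moreover have "AE x in lebesgue. (if x \<in> S then f x else 0) = (if x \<in> S then g x else 0)"
    using ae S by (auto simp: AE_restrict_space_iff elim: eventually_mono)
  ultimately have "(\<lambda>x. if x \<in> S then g x else 0) \<in> borel_measurable lebesgue"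
    by (rule borel_measurable_AE)
  then show ?thesis
    using S by (simp add: borel_measurable_if)
qed

lemma AE_lebesgue_on_subset:
  assumes "AE x in lebesgue_on A. P x" "A \<in> sets lebesgue" "B \<in> sets lebesgue" "B \<subseteq> A"
  shows "AE x in lebesgue_on B. P x"
proof -
  have "AE x in lebesgue. x \<in> A \<longrightarrow> P x"
    using assms(1,2) by (simp add: AE_restrict_space_iff)
  then have "AE x in lebesgue. x \<in> B \<longrightarrow> P x"
    by eventually_elim (use assms(4) in blast)
  then show ?thesis
    using assms(3) by (simp add: AE_restrict_space_iff)
qed

lemma borel_prob_H_D:
  assumes "borel_prob_H M"
  shows "prob_space M" "space M = Hsp"
  using assms by (auto simp: borel_prob_H_def)

lemma L2field_Hsp: "u \<in> Hsp \<Longrightarrow> L2field u"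
  by (simp add: Hsp_def)

lemma integrable_quad_energy:
  assumes M: "borel_prob_H M" and G: "is_weak_grad w G" "\<And>x i j. \<bar>G x $ i $ j\<bar> \<le> C"
    and E: "(\<integral>\<^sup>+u. ennreal ((l2norm u)\<^sup>2) \<partial>M) \<le> ennreal E" "E \<ge> 0"
  shows "integrable M (quad G)" "(\<integral>u. \<bar>quad G u\<bar> \<partial>M) \<le> (4 * C + 1) * E"
proof -
  \<comment> \<open>The summand 1 makes the constant positive even for \<open>C = 0\<close>, so one
    may divide by it and compare directly with the energy.\<close>
  define c where "c = 4 * C + 1"
  have c: "c > 0" using G(2)[of 0 1 1] by (simp add: c_def)
  have m: "quad G \<in> borel_measurable M" by (rule measurable_quad[OF M G])
  have le: "\<bar>quad G u\<bar> / c \<le> (l2norm u)\<^sup>2" if "u \<in> space M" for u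
  proof -
    have "\<bar>quad G u\<bar> \<le> 4 * C * (l2norm u)\<^sup>2"
      using that M by (intro abs_quad_le[OF G] L2field_Hsp) (simp add: borel_prob_H_def)
    also have "\<dots> \<le> c * (l2norm u)\<^sup>2"
      by (intro mult_right_mono) (auto simp: c_def)
    finally show ?thesis using c by (simp add: field_simps)
  qed
  have nn: "(\<integral>\<^sup>+u. ennreal (norm (\<bar>quad G u\<bar> / c)) \<partial>M) \<le> ennreal E"
    using c le by (intro order_trans[OF nn_integral_mono E(1)]) (auto intro!: ennreal_leI)
  have int: "integrable M (\<lambda>u. \<bar>quad G u\<bar> / c)"
    using m nn by (intro integrableI_bounded) (auto simp: less_top[symmetric] top_unique)
  then have "integrable M (\<lambda>u. c * (\<bar>quad G u\<bar> / c))"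
    by (rule integrable_mult_right)
  then have abs: "integrable M (\<lambda>u. \<bar>quad G u\<bar>)" using c by simp
  then show "integrable M (quad G)"
    using m by (simp add: integrable_abs_iff)
  have "ennreal (\<integral>u. \<bar>quad G u\<bar> / c \<partial>M) \<le> ennreal E"
    using nn c by (subst nn_integral_eq_integral[symmetric, OF int]) auto
  then have "(\<integral>u. \<bar>quad G u\<bar> / c \<partial>M) \<le> E"
    using E(2) by (simp add: ennreal_le_iff)
  then show "(\<integral>u. \<bar>quad G u\<bar> \<partial>M) \<le> (4 * C + 1) * E"
    using c by (simp add: c_def field_simps)
qed

section \<open>Measurability in time of the quadratic term\<close>

definition clip :: "real \<Rightarrow> real \<Rightarrow> real" where
  "clip m x = max (- m) (min m x)"

lemma abs_clip_le: "m \<ge> 0 \<Longrightarrow> \<bar>clip m x\<bar> \<le> m"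
  by (auto simp: clip_def)

lemma abs_clip_le_abs: "m \<ge> 0 \<Longrightarrow> \<bar>clip m x\<bar> \<le> \<bar>x\<bar>"
  by (auto simp: clip_def)

lemma clip_tendsto: "(\<lambda>m. clip (real m) x) \<longlonglongrightarrow> x"
proof (rule tendsto_eventually)
  obtain n :: nat where "\<bar>x\<bar> \<le> n" using real_arch_simple by blast
  then show "\<forall>\<^sub>F m in sequentially. clip (real m) x = x"
    by (intro eventually_sequentiallyI[of n]) (auto simp: clip_def)
qed

lemma continuous_clip: "continuous_on UNIV (clip m)"
  unfolding clip_def by (intro continuous_intros)

definition C_b_measurable :: "real \<Rightarrow> (real \<Rightarrow> field measure) \<Rightarrow> bool" where
  "C_b_measurable T \<mu> \<longleftrightarrow> (\<forall>t\<in>{0..T}. borel_prob_H (\<mu> t)) \<and>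
     (\<forall>\<phi>. continuous_map H_weak euclideanreal \<phi> \<and> bounded (\<phi> ` Hsp) \<longrightarrow>
        (\<lambda>t. \<integral>u. \<phi> u \<partial>\<mu> t) \<in> borel_measurable (lebesgue_on {0..T}))"

text \<open>Clipping is continuous, so the clipped approximations are bounded and weakly continuous
  and condition (i) applies. With \<open>m\<close> fixed, the constant \<open>B * m\<close>
  dominates on every probability space, and the limit in \<open>N\<close> holds at each time of the
  interval.\<close>

lemma measurable_integral_clip_quad:
  fixes \<psi> :: "real \<Rightarrow> real"
  assumes \<mu>: "C_b_measurable T \<mu>" and v: "v \<in> Hsp"
    and G: "is_weak_grad w G" "\<And>x i j. \<bar>G x $ i $ j\<bar> \<le> C"
    and \<psi>: "continuous_on UNIV \<psi>" "\<And>x. \<bar>\<psi> x\<bar> \<le> B" and m: "m \<ge> 0"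
  shows "(\<lambda>s. \<integral>u. \<psi> (l2inner u v) * clip m (quad G u) \<partial>\<mu> s) \<in> borel_measurable (lebesgue_on {0..T})"
proof (rule borel_measurable_LIMSEQ_metric)
  have B: "B \<ge> 0" using \<psi>(2)[of 0] by linarith
  have \<psi>m: "\<psi> \<in> borel_measurable borel" by (rule borel_measurable_continuous_onI[OF \<psi>(1)])
  have cm: "clip m \<in> borel_measurable borel" by (rule borel_measurable_continuous_onI[OF continuous_clip])
  have bnd: "\<bar>\<psi> a * clip m b\<bar> \<le> B * m" for a b
    unfolding abs_mult by (intro mult_mono \<psi>(2) abs_clip_le m B) auto
  show "(\<lambda>s. \<integral>u. \<psi> (l2inner u v) * clip m (quad_approx N G u) \<partial>\<mu> s) \<in> borel_measurable (lebesgue_on {0..T})" for N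
  proof -
    have "continuous_map H_weak euclideanreal (\<lambda>u. \<psi> (l2inner u v))"
      using continuous_map_compose[OF continuous_map_l2inner[OF v], of euclideanreal \<psi>] \<psi>(1)
      by (simp add: o_def)
    moreover have "continuous_map H_weak euclideanreal (\<lambda>u. clip m (quad_approx N G u))"
      using continuous_map_compose[OF continuous_map_quad_approx, of euclideanreal "clip m"] continuous_clip
      by (simp add: o_def)
    ultimately have "continuous_map H_weak euclideanreal (\<lambda>u. \<psi> (l2inner u v) * clip m (quad_approx N G u))"
      by (rule continuous_map_real_mult)
    moreover have "bounded ((\<lambda>u. \<psi> (l2inner u v) * clip m (quad_approx N G u)) ` Hsp)"
      using bnd by (auto simp: bounded_iff intro!: exI[of _ "B * m"])
    ultimately show ?thesis using \<mu> unfolding C_b_measurable_def by blast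
  qed
  fix s assume "s \<in> space (lebesgue_on {0..T})"
  then have M: "borel_prob_H (\<mu> s)" using \<mu> by (simp add: C_b_measurable_def)
  interpret prob_space "\<mu> s" by (rule borel_prob_H_D(1)[OF M])
  note meas = measurable_l2inner[OF M L2field_Hsp[OF v]] measurable_quad[OF M G] measurable_quad_approx[OF M]
  show "(\<lambda>N. \<integral>u. \<psi> (l2inner u v) * clip m (quad_approx N G u) \<partial>\<mu> s) \<longlonglongrightarrow>
      (\<integral>u. \<psi> (l2inner u v) * clip m (quad G u) \<partial>\<mu> s)"
  proof (rule integral_dominated_convergence[where w = "\<lambda>_. B * m"])
    show "(\<lambda>u. \<psi> (l2inner u v) * clip m (quad G u)) \<in> borel_measurable (\<mu> s)"
      by (intro borel_measurable_times measurable_compose[OF _ \<psi>m] measurable_compose[OF _ cm] meas)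
    show "(\<lambda>u. \<psi> (l2inner u v) * clip m (quad_approx N G u)) \<in> borel_measurable (\<mu> s)" for N
      by (intro borel_measurable_times measurable_compose[OF _ \<psi>m] measurable_compose[OF _ cm] meas)
    show "AE u in \<mu> s. (\<lambda>N. \<psi> (l2inner u v) * clip m (quad_approx N G u)) \<longlonglongrightarrow>
        \<psi> (l2inner u v) * clip m (quad G u)"
    proof (rule AE_I2)
      fix u assume "u \<in> space (\<mu> s)"
      then have "L2field u" using borel_prob_H_D(2)[OF M] L2field_Hsp by simp
      then have "(\<lambda>N. clip m (quad_approx N G u)) \<longlonglongrightarrow> clip m (quad G u)"
        using continuous_on_tendsto_compose[OF continuous_clip quad_approx_tendsto[OF G]] by simp
      then show "(\<lambda>N. \<psi> (l2inner u v) * clip m (quad_approx N G u)) \<longlonglongrightarrow>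
        \<psi> (l2inner u v) * clip m (quad G u)"
        by (intro tendsto_intros)
    qed
    show "AE u in \<mu> s. norm (\<psi> (l2inner u v) * clip m (quad_approx N G u)) \<le> B * m" for N
      using bnd by simp
  qed simp
qed

text \<open>As the clipping level grows, \<open>B * \<bar>quad G u\<bar>\<close> is the dominating
  function. It is integrable for almost every time only, so the limit is identified up to a null
  set.\<close>

lemma measurable_integral_quad:
  fixes \<psi> :: "real \<Rightarrow> real"
  assumes \<mu>: "C_b_measurable T \<mu>" and v: "v \<in> Hsp"
    and G: "is_weak_grad w G" "\<And>x i j. \<bar>G x $ i $ j\<bar> \<le> C"
    and \<psi>: "continuous_on UNIV \<psi>" "\<And>x. \<bar>\<psi> x\<bar> \<le> B"
    and int: "AE s in lebesgue_on {0..T}. integrable (\<mu> s) (quad G)"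
  shows "(\<lambda>s. \<integral>u. \<psi> (l2inner u v) * quad G u \<partial>\<mu> s) \<in> borel_measurable (lebesgue_on {0..T})"
proof (rule measurable_lebesgue_on_AE)
  let ?f = "\<lambda>m s. \<integral>u. \<psi> (l2inner u v) * clip (real m) (quad G u) \<partial>\<mu> s"
  have B: "B \<ge> 0" using \<psi>(2)[of 0] by linarith
  have \<psi>m: "\<psi> \<in> borel_measurable borel" by (rule borel_measurable_continuous_onI[OF \<psi>(1)])
  have cm: "clip m \<in> borel_measurable borel" for m by (rule borel_measurable_continuous_onI[OF continuous_clip])
  \<comment> \<open>\<open>lim\<close> of a sequence of measurable functions is measurable whether
    or not the sequence converges, so the exceptional times do no harm.\<close>
  show "(\<lambda>s. lim (\<lambda>m. ?f m s)) \<in> borel_measurable (lebesgue_on {0..T})"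
    by (intro borel_measurable_lim_metric measurable_integral_clip_quad[OF \<mu> v G \<psi>]) auto
  have "AE s in lebesgue_on {0..T}. s \<in> {0..T}"
    by (rule AE_I2) simp
  with int show "AE s in lebesgue_on {0..T}. lim (\<lambda>m. ?f m s) = (\<integral>u. \<psi> (l2inner u v) * quad G u \<partial>\<mu> s)"
  proof eventually_elim
    case (elim s)
    then have M: "borel_prob_H (\<mu> s)" using \<mu> by (simp add: C_b_measurable_def)
    note meas = measurable_l2inner[OF M L2field_Hsp[OF v]] measurable_quad[OF M G]
    have "(\<lambda>m. ?f m s) \<longlonglongrightarrow> (\<integral>u. \<psi> (l2inner u v) * quad G u \<partial>\<mu> s)"
    proof (rule integral_dominated_convergence[where w = "\<lambda>u. B * \<bar>quad G u\<bar>"])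
      show "(\<lambda>u. \<psi> (l2inner u v) * quad G u) \<in> borel_measurable (\<mu> s)"
        by (intro borel_measurable_times measurable_compose[OF _ \<psi>m] meas)
      show "(\<lambda>u. \<psi> (l2inner u v) * clip (real m) (quad G u)) \<in> borel_measurable (\<mu> s)" for m
        by (intro borel_measurable_times measurable_compose[OF _ \<psi>m] measurable_compose[OF _ cm] meas)
      show "integrable (\<mu> s) (\<lambda>u. B * \<bar>quad G u\<bar>)" using elim by auto
      show "AE u in \<mu> s. (\<lambda>m. \<psi> (l2inner u v) * clip (real m) (quad G u)) \<longlonglongrightarrow> \<psi> (l2inner u v) * quad G u"
        by (intro AE_I2 tendsto_intros clip_tendsto)
      show "AE u in \<mu> s. norm (\<psi> (l2inner u v) * clip (real m) (quad G u)) \<le> B * \<bar>quad G u\<bar>" for m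
        unfolding real_norm_def abs_mult
        by (intro AE_I2 mult_mono \<psi>(2) abs_clip_le_abs B) auto
    qed
    then show ?case by (rule limI)
  qed
qed simp

section \<open>Compactly supported truncations of class \<open>C^1\<close>\<close>

definition cutoff :: "real \<Rightarrow> real" where
  "cutoff r = (max 0 (1 - r\<^sup>2))\<^sup>2"

definition cutoff' :: "real \<Rightarrow> real" where
  "cutoff' r = - 4 * r * max 0 (1 - r\<^sup>2)"

text \<open>Squaring removes the kink of the positive part at 0. This makes the explicit bump
  \<open>cutoff\<close> continuously differentiable at \<open>\<bar>r\<bar> = 1\<close>.\<close>

lemma has_real_derivative_max_zero_sq:
  "((\<lambda>y. (max 0 y)\<^sup>2) has_real_derivative 2 * max 0 y) (at (y::real))"
proof (cases "y = 0")
  case True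
  \<comment> \<open>The difference quotient at 0 is either \<open>h\<close> or 0.\<close>
  have "((\<lambda>h. ((max 0 (0 + h))\<^sup>2 - (max 0 0)\<^sup>2) / h) \<longlongrightarrow> (0::real)) (at 0)"
  proof (rule Lim_null_comparison)
    show "\<forall>\<^sub>F h in at 0. norm (((max 0 (0 + h))\<^sup>2 - (max 0 0)\<^sup>2) / h) \<le> \<bar>h::real\<bar>"
      by (rule always_eventually) (auto simp: max_def power2_eq_square)
    show "((\<lambda>h. \<bar>h::real\<bar>) \<longlongrightarrow> 0) (at 0)"
      by (rule tendsto_rabs_zero) simp
  qed
  then show ?thesis
    using True by (simp add: DERIV_def)
next
  case False
  show ?thesis
  proof (cases "y > 0")
    case True
    have "((\<lambda>y. y\<^sup>2) has_real_derivative 2 * max 0 y) (at y)"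
      using True by (auto intro!: derivative_eq_intros)
    then show ?thesis
      by (rule has_field_derivative_transform_within_open[of _ _ _ "{0<..}"]) (use True in auto)
  next
    assume "\<not> y > 0"
    then have "y < 0" using False by simp
    have "((\<lambda>y. 0) has_real_derivative 2 * max 0 y) (at y)"
      using \<open>y < 0\<close> by simp
    then show ?thesis
      by (rule has_field_derivative_transform_within_open[of _ _ _ "{..<0}"]) (use \<open>y < 0\<close> in auto)
  qed
qed

lemma has_real_derivative_cutoff: "(cutoff has_real_derivative cutoff' r) (at r)"
proof -
  have "((\<lambda>r. 1 - r\<^sup>2) has_real_derivative - (2 * r)) (at r)"
    by (auto intro!: derivative_eq_intros)
  from DERIV_chain2[OF has_real_derivative_max_zero_sq this] show ?thesis
    by (simp add: cutoff_def[abs_def] cutoff'_def mult_ac)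
qed

lemma continuous_cutoff [continuous_intros]: "continuous_on S f \<Longrightarrow> continuous_on S (\<lambda>x. cutoff (f x))"
  unfolding cutoff_def by (intro continuous_intros)

lemma continuous_cutoff' [continuous_intros]: "continuous_on S f \<Longrightarrow> continuous_on S (\<lambda>x. cutoff' (f x))"
  unfolding cutoff'_def by (intro continuous_intros)

lemma cutoff_bounds: "0 \<le> cutoff r" "cutoff r \<le> 1" "\<bar>cutoff' r\<bar> \<le> 4"
proof -
  have m: "0 \<le> max 0 (1 - r\<^sup>2)" "max 0 (1 - r\<^sup>2) \<le> 1" by auto
  show "0 \<le> cutoff r" by (simp add: cutoff_def)
  show "cutoff r \<le> 1" unfolding cutoff_def using m by (intro power_le_one) auto
  show "\<bar>cutoff' r\<bar> \<le> 4"
  proof (cases "\<bar>r\<bar> \<le> 1")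
    case True
    then show ?thesis
      using mult_mono[OF True m(2)] m(1) by (simp add: cutoff'_def abs_mult)
  next
    case False
    then have "1 \<le> r\<^sup>2" using abs_le_square_iff[of 1 r] by simp
    then show ?thesis by (simp add: cutoff'_def max_def)
  qed
qed

lemma cutoff_zero: "\<bar>r\<bar> > 1 \<Longrightarrow> cutoff r = 0"
  using abs_le_square_iff[of 1 r] by (simp add: cutoff_def max_def)

lemma cutoff_tendsto: "(\<lambda>n. cutoff (x / real (Suc n))) \<longlonglongrightarrow> 1"
proof -
  have "(\<lambda>n. x / real (Suc n)) \<longlonglongrightarrow> 0"
    using tendsto_mult[OF tendsto_const[of x] LIMSEQ_inverse_real_of_nat] by (simp add: divide_inverse)
  from continuous_on_tendsto_compose[OF continuous_cutoff[OF continuous_on_id, of UNIV] this]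
  show ?thesis by (simp add: cutoff_def)
qed

text \<open>The window widens with \<open>n\<close>; \<open>Suc n\<close> avoids the scale
  0.\<close>

definition truncate :: "nat \<Rightarrow> (real \<Rightarrow> real) \<Rightarrow> real \<Rightarrow> real" where
  "truncate n h x = h x * cutoff (x / real (Suc n))"

definition truncate' :: "nat \<Rightarrow> (real \<Rightarrow> real) \<Rightarrow> (real \<Rightarrow> real) \<Rightarrow> real \<Rightarrow> real" where
  "truncate' n h h' x = h' x * cutoff (x / real (Suc n)) + h x * (cutoff' (x / real (Suc n)) / real (Suc n))"

lemma C1c_truncate:
  assumes h: "\<And>x. (h has_real_derivative h' x) (at x)" and h': "continuous_on UNIV h'"
  shows "C1c 1 (\<lambda>y. truncate n h (y 0)) (\<lambda>y j. truncate' n h h' (y 0))"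
  unfolding C1c_def
proof (intro conjI allI impI)
  have hc: "continuous_on UNIV h"
    using h by (intro continuous_at_imp_continuous_on) (auto intro: DERIV_isCont)
  have der: "(truncate n h has_real_derivative truncate' n h h' x) (at x)" for x
  proof -
    have "((\<lambda>x. x / real (Suc n)) has_real_derivative 1 / real (Suc n)) (at x)"
      by (auto intro!: derivative_eq_intros)
    from DERIV_mult[OF h DERIV_chain2[OF has_real_derivative_cutoff this]] show ?thesis
      by (simp add: truncate_def[abs_def] truncate'_def algebra_simps)
  qed
  have cont: "continuous_on UNIV (truncate' n h h')"
    unfolding truncate'_def by (intro continuous_intros h' hc) auto
  fix y :: "nat \<Rightarrow> real" and j :: nat
  assume yj: "vec_k 1 y \<and> j < 1"
  show "((\<lambda>r. truncate n h ((y(j := r)) 0)) has_real_derivative truncate' n h h' (y 0)) (at (y j))"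
    using der yj by simp
  fix e :: real assume "e > 0"
  then obtain d where "d > 0" "\<And>x. \<bar>x - y 0\<bar> < d \<Longrightarrow> \<bar>truncate' n h h' x - truncate' n h h' (y 0)\<bar> < e"
    using cont unfolding continuous_on_iff dist_real_def by (metis UNIV_I)
  then show "\<exists>d>0. \<forall>z. vec_k 1 z \<and> (\<forall>i<1. \<bar>z i - y i\<bar> < d) \<longrightarrow>
      \<bar>truncate' n h h' (z 0) - truncate' n h h' (y 0)\<bar> < e"
    by auto
next
  show "\<exists>R. \<forall>y. vec_k 1 y \<and> (\<exists>i<1. R < \<bar>y i\<bar>) \<longrightarrow> truncate n h (y 0) = 0"
    \<comment> \<open>The cut-off vanishes beyond \<open>\<bar>r\<bar> = 1\<close>, so the rescaled
      one vanishes beyond \<open>Suc n\<close>.\<close>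
    by (intro exI[of _ "real (Suc n)"]) (auto simp: truncate_def cutoff_zero abs_divide)
qed

section \<open>Evolution of bounded functions of one pairing\<close>

lemma stat_solD:
  assumes "stat_sol L T \<mu>bar \<mu>"
  shows "\<forall>t\<in>{0..T}. borel_prob_H (\<mu> t)" "\<mu> 0 = \<mu>bar" "C_b_measurable T \<mu>"
    "AE t in lebesgue_on {0..T}.
        (\<integral>\<^sup>+u. ennreal ((l2norm u)^2) \<partial>\<mu> t) \<le> (\<integral>\<^sup>+u. ennreal ((l2norm u)^2) \<partial>\<mu>bar)"
    "\<forall>k \<phi> D g. C1c k \<phi> D \<and> (\<forall>j<k. g j \<in> HL L) \<longrightarrow>
        (\<forall>t' t. 0 \<le> t' \<and> t' \<le> t \<and> t \<le> T \<longrightarrow>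
          (\<integral>u. cyl k \<phi> g u \<partial>\<mu> t) = (\<integral>u. cyl k \<phi> g u \<partial>\<mu> t') +
            (\<integral>s\<in>{t'..t}. (\<integral>u. nonlin (cyl_deriv k D g u) u \<partial>\<mu> s) \<partial>lebesgue))"
  using assms unfolding stat_sol_def C_b_measurable_def
  by - (elim conjE, (intro conjI)?, assumption+)+

text \<open>For a cylinder function of the single pairing with \<open>v\<close>, the derivative
  field is \<open>v\<close> times a scalar that depends on \<open>u\<close> but not on
  \<open>x\<close>. Hence \<open>nonlin_scaleR\<close> applies for each \<open>u\<close> separately
  and \<open>G\<close> stays fixed.\<close>

lemma stat_sol_scalar:
  assumes S: "stat_sol L T \<mu>bar \<mu>" and v: "v \<in> HL L" and t: "0 \<le> t" "t \<le> T"
    and G: "is_weak_grad v G"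
    and h: "\<And>x. (h has_real_derivative h' x) (at x)" and h': "continuous_on UNIV h'"
  shows "(\<integral>u. truncate n h (l2inner u v) \<partial>\<mu> t) = (\<integral>u. truncate n h (l2inner u v) \<partial>\<mu>bar) +
     (\<integral>s. (\<integral>u. truncate' n h h' (l2inner u v) * quad G u \<partial>\<mu> s) \<partial>lebesgue_on {0..t})"
proof -
  let ?D = "\<lambda>y (j::nat). truncate' n h h' (y (0::nat))"
  have "(\<integral>u. cyl 1 (\<lambda>y. truncate n h (y 0)) (\<lambda>_. v) u \<partial>\<mu> t) =
      (\<integral>u. cyl 1 (\<lambda>y. truncate n h (y 0)) (\<lambda>_. v) u \<partial>\<mu> 0) +
      (\<integral>s\<in>{0..t}. (\<integral>u. nonlin (cyl_deriv 1 ?D (\<lambda>_. v) u) u \<partial>\<mu> s) \<partial>lebesgue)"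
  proof -
    from stat_solD(5)[OF S, rule_format, of 1 "\<lambda>y. truncate n h (y 0)" ?D "\<lambda>_. v" 0 t]
    show ?thesis using C1c_truncate[OF h h', where n = n] v t by simp
  qed
  moreover have "\<mu> 0 = \<mu>bar" by (rule stat_solD(2)[OF S])
  moreover have "cyl 1 (\<lambda>y. truncate n h (y 0)) (\<lambda>_. v) u = truncate n h (l2inner u v)" for u
    by (simp add: cyl_def coords_def)
  moreover have "(\<integral>u. nonlin (cyl_deriv 1 ?D (\<lambda>_. v) u) u \<partial>\<mu> s) =
      (\<integral>u. truncate' n h h' (l2inner u v) * quad G u \<partial>\<mu> s)" if "s \<in> {0..t}" for s
  proof (rule Bochner_Integration.integral_cong[OF refl])
    fix u assume "u \<in> space (\<mu> s)"
    moreover have "borel_prob_H (\<mu> s)" using stat_solD(1)[OF S] that t by simp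
    ultimately have "L2field u" by (simp add: borel_prob_H_def L2field_Hsp)
    moreover have "cyl_deriv 1 ?D (\<lambda>_. v) u = (\<lambda>x. truncate' n h h' (l2inner u v) *\<^sub>R v x)"
      by (simp add: cyl_deriv_def coords_def)
    ultimately show "nonlin (cyl_deriv 1 ?D (\<lambda>_. v) u) u = truncate' n h h' (l2inner u v) * quad G u"
      using nonlin_scaleR[OF G] by simp
  qed
  then have "(\<integral>s\<in>{0..t}. (\<integral>u. nonlin (cyl_deriv 1 ?D (\<lambda>_. v) u) u \<partial>\<mu> s) \<partial>lebesgue) =
     (\<integral>s\<in>{0..t}. (\<integral>u. truncate' n h h' (l2inner u v) * quad G u \<partial>\<mu> s) \<partial>lebesgue)"
    by (intro set_lebesgue_integral_cong) auto
  ultimately show ?thesis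
    by (simp add: integral_restrict_space set_lebesgue_integral_def)
qed

text \<open>Differentiating the rescaled cut-off yields the factor \<open>1 / (n + 1)\<close>, so
  the surplus term of the product rule disappears.\<close>

lemma truncate_tendsto:
  assumes "\<And>x. \<bar>h x\<bar> \<le> 1"
  shows "(\<lambda>n. truncate n h x) \<longlonglongrightarrow> h x" "(\<lambda>n. truncate' n h h' x) \<longlonglongrightarrow> h' x"
proof -
  show "(\<lambda>n. truncate n h x) \<longlonglongrightarrow> h x"
    using tendsto_mult[OF tendsto_const[of "h x"] cutoff_tendsto[of x]] by (simp add: truncate_def)
  have "(\<lambda>n. h x * (cutoff' (x / real (Suc n)) / real (Suc n))) \<longlonglongrightarrow> 0"
  proof (rule Lim_null_comparison)
    show "\<forall>\<^sub>F n in sequentially. norm (h x * (cutoff' (x / real (Suc n)) / real (Suc n))) \<le> 4 * inverse (real (Suc n))"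
    proof (rule always_eventually, rule allI)
      fix n
      have "\<bar>h x\<bar> * (\<bar>cutoff' (x / real (Suc n))\<bar> * inverse (real (Suc n))) \<le> 1 * (4 * inverse (real (Suc n)))"
        by (intro mult_mono assms cutoff_bounds) auto
      then show "norm (h x * (cutoff' (x / real (Suc n)) / real (Suc n))) \<le> 4 * inverse (real (Suc n))"
        by (simp add: abs_mult divide_inverse)
    qed
    show "(\<lambda>n. 4 * inverse (real (Suc n))) \<longlonglongrightarrow> 0"
      using tendsto_mult[OF tendsto_const[of 4] LIMSEQ_inverse_real_of_nat] by simp
  qed
  from tendsto_add[OF tendsto_mult[OF tendsto_const[of "h' x"] cutoff_tendsto[of x]] this]
  show "(\<lambda>n. truncate' n h h' x) \<longlonglongrightarrow> h' x"
    by (simp add: truncate'_def)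
qed

text \<open>The 5 is 1 from \<open>h'\<close> times the cut-off plus 4 from the derivative of the
  cut-off, uniformly in \<open>n\<close>.\<close>

lemma truncate_bounds:
  assumes "\<And>x. \<bar>h x\<bar> \<le> 1" "\<And>x. \<bar>h' x\<bar> \<le> 1"
  shows "\<bar>truncate n h x\<bar> \<le> 1" "\<bar>truncate' n h h' x\<bar> \<le> 5"
proof -
  note c = cutoff_bounds[of "x / real (Suc n)"]
  show "\<bar>truncate n h x\<bar> \<le> 1"
    unfolding truncate_def abs_mult using mult_mono[OF assms(1)[of x] c(2)] c(1) by simp
  have 1: "\<bar>h' x * cutoff (x / real (Suc n))\<bar> \<le> 1"
    unfolding abs_mult using mult_mono[OF assms(2)[of x] c(2)] c(1) by simp
  have "\<bar>cutoff' (x / real (Suc n)) / real (Suc n)\<bar> \<le> 4 / 1"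
    unfolding abs_divide by (intro frac_le c(3)) auto
  then have 2: "\<bar>h x * (cutoff' (x / real (Suc n)) / real (Suc n))\<bar> \<le> 4"
    unfolding abs_mult using mult_mono[OF assms(1)[of x]] by fastforce
  from 1 2 show "\<bar>truncate' n h h' x\<bar> \<le> 5"
    unfolding truncate'_def by linarith
qed

text \<open>Two dominated limits remove the cut-off: within phase space by
  \<open>5 * \<bar>quad G u\<bar>\<close>, and in time by the constant
  \<open>5 * ((4 * C + 1) * E)\<close> with \<open>E\<close> the initial energy. Integrability in
  time is part of the conclusion because the cosine and sine identities are later joined into one
  complex integral.\<close>

lemma stat_sol_bounded_scalar:
  assumes S: "stat_sol L T \<mu>bar \<mu>" and v: "v \<in> HL L" and t: "0 \<le> t" "t \<le> T"
    and fin: "(\<integral>\<^sup>+u. ennreal ((l2norm u)^2) \<partial>\<mu>bar) < \<infinity>"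
    and G: "is_weak_grad v G" "\<And>x i j. \<bar>G x $ i $ j\<bar> \<le> C"
    and h: "\<And>x. (h has_real_derivative h' x) (at x)" and h': "continuous_on UNIV h'"
    and b: "\<And>x. \<bar>h x\<bar> \<le> 1" "\<And>x. \<bar>h' x\<bar> \<le> 1"
  shows "AE s in lebesgue_on {0..t}. integrable (\<mu> s) (quad G)"
    and "integrable (lebesgue_on {0..t}) (\<lambda>s. \<integral>u. h' (l2inner u v) * quad G u \<partial>\<mu> s)"
    and "(\<integral>u. h (l2inner u v) \<partial>\<mu> t) = (\<integral>u. h (l2inner u v) \<partial>\<mu>bar) +
     (\<integral>s. (\<integral>u. h' (l2inner u v) * quad G u \<partial>\<mu> s) \<partial>lebesgue_on {0..t})"
proof -
  let ?J = "lebesgue_on {0..t}"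
  have vH: "v \<in> Hsp" using v by (simp add: HL_def)
  have P: "borel_prob_H (\<mu> s)" if "s \<in> {0..T}" for s using stat_solD(1)[OF S] that by simp
  note P0 = stat_solD(2)[OF S]
  note Cb = stat_solD(3)[OF S]
  have hc: "continuous_on UNIV h"
    using h by (intro continuous_at_imp_continuous_on) (auto intro: DERIV_isCont)
  obtain E where E: "(\<integral>\<^sup>+u. ennreal ((l2norm u)^2) \<partial>\<mu>bar) = ennreal E" "E \<ge> 0"
    using fin by (cases "\<integral>\<^sup>+u. ennreal ((l2norm u)^2) \<partial>\<mu>bar" rule: ennreal_cases) auto
  have "AE s in lebesgue_on {0..T}. (\<integral>\<^sup>+u. ennreal ((l2norm u)^2) \<partial>\<mu> s) \<le> ennreal E"
    using stat_solD(4)[OF S] unfolding E(1) .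
  moreover have "AE s in lebesgue_on {0..T}. s \<in> {0..T}" by (rule AE_I2) simp
  ultimately have good: "AE s in lebesgue_on {0..T}. s \<in> {0..T} \<and>
      integrable (\<mu> s) (quad G) \<and> (\<integral>u. \<bar>quad G u\<bar> \<partial>\<mu> s) \<le> (4 * C + 1) * E"
    by eventually_elim (use integrable_quad_energy[OF P G _ E(2)] in blast)
  then have goodT: "AE s in lebesgue_on {0..T}. integrable (\<mu> s) (quad G)"
    by eventually_elim simp
  have goodJ: "AE s in ?J. s \<in> {0..T} \<and>
      integrable (\<mu> s) (quad G) \<and> (\<integral>u. \<bar>quad G u\<bar> \<partial>\<mu> s) \<le> (4 * C + 1) * E"
    using t by (intro AE_lebesgue_on_subset[OF good]) auto
  then show "AE s in ?J. integrable (\<mu> s) (quad G)"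
    by eventually_elim simp
  interpret J: finite_measure ?J
    by (rule finite_measure_lebesgue_on) simp
  define A where "A \<psi> s = (\<integral>u. \<psi> (l2inner u v) * quad G u \<partial>\<mu> s)" for \<psi> s
  \<comment> \<open>The bound 5 covers both the truncated derivatives and \<open>h'\<close> itself,
    so measurability and domination are proved once for all of them.\<close>
  have Am: "A \<psi> \<in> borel_measurable ?J" if "continuous_on UNIV \<psi>" "\<And>x. \<bar>\<psi> x\<bar> \<le> 5" for \<psi>
  proof -
    have "A \<psi> \<in> borel_measurable (lebesgue_on {0..T})"
      unfolding A_def by (rule measurable_integral_quad[OF Cb vH G that goodT])
    then show ?thesis
      by (rule measurable_restrict_mono) (use t in auto)
  qed
  have Ab: "AE s in ?J. \<bar>A \<psi> s\<bar> \<le> 5 * ((4 * C + 1) * E)" if \<psi>: "continuous_on UNIV \<psi>" "\<And>x. \<bar>\<psi> x\<bar> \<le> 5" for \<psi>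
    using goodJ
  proof eventually_elim
    case (elim s)
    then have M: "borel_prob_H (\<mu> s)" and q: "integrable (\<mu> s) (quad G)" using P by auto
    have le: "\<bar>\<psi> (l2inner u v) * quad G u\<bar> \<le> 5 * \<bar>quad G u\<bar>" for u
      unfolding abs_mult by (intro mult_right_mono \<psi>(2)) auto
    have int: "integrable (\<mu> s) (\<lambda>u. \<psi> (l2inner u v) * quad G u)"
    proof (rule Bochner_Integration.integrable_bound)
      show "integrable (\<mu> s) (\<lambda>u. 5 * \<bar>quad G u\<bar>)" using q by auto
      show "(\<lambda>u. \<psi> (l2inner u v) * quad G u) \<in> borel_measurable (\<mu> s)"
        by (intro borel_measurable_times measurable_quad[OF M G]
            measurable_compose[OF measurable_l2inner[OF M L2field_Hsp[OF vH]]]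
            borel_measurable_continuous_onI \<psi>(1))
    qed (use le in auto)
    have "\<bar>A \<psi> s\<bar> \<le> (\<integral>u. \<bar>\<psi> (l2inner u v) * quad G u\<bar> \<partial>\<mu> s)"
      unfolding A_def by (rule integral_abs_bound)
    also have "\<dots> \<le> (\<integral>u. 5 * \<bar>quad G u\<bar> \<partial>\<mu> s)"
      using int q le by (intro integral_mono) auto
    also have "\<dots> \<le> 5 * ((4 * C + 1) * E)"
      using elim by simp
    finally show ?case .
  qed
  have b5: "\<bar>h' x\<bar> \<le> 5" for x using b(2)[of x] by linarith
  show "integrable ?J (\<lambda>s. \<integral>u. h' (l2inner u v) * quad G u \<partial>\<mu> s)"
    unfolding A_def[symmetric]
    by (rule J.integrable_const_bound[where B = "5 * ((4 * C + 1) * E)", OF _ Am[OF h' b5]])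
      (simp only: real_norm_def Ab[OF h' b5])
  let ?c = "\<lambda>n. truncate' n h h'"
  have cc: "continuous_on UNIV (?c n)" for n
    unfolding truncate'_def by (intro continuous_intros h' hc) simp_all
  have ct: "continuous_on UNIV (truncate n h)" for n
    unfolding truncate_def by (intro continuous_intros hc) simp_all
  note cb = truncate_bounds[OF b]
  \<comment> \<open>The outer limit is in time; its pointwise hypothesis is a second dominated
    convergence, under \<open>\<mu> s\<close>, at the times of finite energy.\<close>
  have lim_A: "(\<lambda>n. \<integral>s. A (?c n) s \<partial>?J) \<longlonglongrightarrow> (\<integral>s. A h' s \<partial>?J)"
  proof (rule integral_dominated_convergence[where w = "\<lambda>_. 5 * ((4 * C + 1) * E)"])
    show "A h' \<in> borel_measurable ?J" by (rule Am[OF h' b5])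
    show "A (?c n) \<in> borel_measurable ?J" for n by (rule Am[OF cc cb(2)])
    show "AE s in ?J. norm (A (?c n) s) \<le> 5 * ((4 * C + 1) * E)" for n
      using Ab[OF cc cb(2), of n] by simp
    show "AE s in ?J. (\<lambda>n. A (?c n) s) \<longlonglongrightarrow> A h' s"
      using goodJ
    proof eventually_elim
      case (elim s)
      then have M: "borel_prob_H (\<mu> s)" and q: "integrable (\<mu> s) (quad G)" using P by auto
      note meas = measurable_quad[OF M G] measurable_compose[OF measurable_l2inner[OF M L2field_Hsp[OF vH]]]
      show ?case
        unfolding A_def
      proof (rule integral_dominated_convergence[where w = "\<lambda>u. 5 * \<bar>quad G u\<bar>"])
        show "(\<lambda>u. h' (l2inner u v) * quad G u) \<in> borel_measurable (\<mu> s)"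
          by (intro borel_measurable_times meas borel_measurable_continuous_onI h')
        show "(\<lambda>u. ?c n (l2inner u v) * quad G u) \<in> borel_measurable (\<mu> s)" for n
          by (intro borel_measurable_times meas borel_measurable_continuous_onI cc)
        show "integrable (\<mu> s) (\<lambda>u. 5 * \<bar>quad G u\<bar>)" using q by auto
        show "AE u in \<mu> s. (\<lambda>n. ?c n (l2inner u v) * quad G u) \<longlonglongrightarrow> h' (l2inner u v) * quad G u"
          by (intro AE_I2 tendsto_mult truncate_tendsto(2) b(1) tendsto_const)
        show "AE u in \<mu> s. norm (?c n (l2inner u v) * quad G u) \<le> 5 * \<bar>quad G u\<bar>" for n
          unfolding real_norm_def abs_mult by (intro AE_I2 mult_right_mono cb(2)) auto
      qed
    qed
  qed simp
  \<comment> \<open>Stated for an arbitrary measure since it is needed both at time \<open>t\<close>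
    and for the initial distribution, with domination by 1.\<close>
  have lim_h: "(\<lambda>n. \<integral>u. truncate n h (l2inner u v) \<partial>M) \<longlonglongrightarrow> (\<integral>u. h (l2inner u v) \<partial>M)"
    if M: "borel_prob_H M" for M
  proof -
    interpret prob_space M by (rule borel_prob_H_D(1)[OF M])
    note meas = measurable_compose[OF measurable_l2inner[OF M L2field_Hsp[OF vH]]]
    show ?thesis
    proof (rule integral_dominated_convergence[where w = "\<lambda>_. 1"])
      show "(\<lambda>u. h (l2inner u v)) \<in> borel_measurable M"
        by (intro meas borel_measurable_continuous_onI hc)
      show "(\<lambda>u. truncate n h (l2inner u v)) \<in> borel_measurable M" for n
        by (intro meas borel_measurable_continuous_onI ct)
      show "AE u in M. (\<lambda>n. truncate n h (l2inner u v)) \<longlonglongrightarrow> h (l2inner u v)"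
        by (intro AE_I2 truncate_tendsto(1) b(1))
      show "AE u in M. norm (truncate n h (l2inner u v)) \<le> 1" for n
        using cb(1) by simp
    qed simp
  qed
  have "(\<lambda>n. (\<integral>u. truncate n h (l2inner u v) \<partial>\<mu>bar) + (\<integral>s. A (?c n) s \<partial>?J)) \<longlonglongrightarrow>
      (\<integral>u. h (l2inner u v) \<partial>\<mu>bar) + (\<integral>s. A h' s \<partial>?J)"
    using P[of 0] P0 t by (intro tendsto_add lim_A lim_h) simp
  then have "(\<lambda>n. \<integral>u. truncate n h (l2inner u v) \<partial>\<mu> t) \<longlonglongrightarrow>
      (\<integral>u. h (l2inner u v) \<partial>\<mu>bar) + (\<integral>s. A h' s \<partial>?J)"
    unfolding stat_sol_scalar[OF S v t G(1) h h'] A_def .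
  from LIMSEQ_unique[OF lim_h[OF P] this] t
  show "(\<integral>u. h (l2inner u v) \<partial>\<mu> t) = (\<integral>u. h (l2inner u v) \<partial>\<mu>bar) +
     (\<integral>s. (\<integral>u. h' (l2inner u v) * quad G u \<partial>\<mu> s) \<partial>?J)"
    by (simp add: A_def)
qed

lemma integral_cis_l2inner:
  assumes M: "borel_prob_H M" and v: "v \<in> Hsp"
  shows "(\<integral>u. cis (l2inner u v) \<partial>M) = Complex (\<integral>u. cos (l2inner u v) \<partial>M) (\<integral>u. sin (l2inner u v) \<partial>M)"
proof -
  interpret prob_space M by (rule borel_prob_H_D(1)[OF M])
  note m = measurable_l2inner[OF M L2field_Hsp[OF v]]
  have "integrable M (\<lambda>u. cos (l2inner u v))" "integrable M (\<lambda>u. sin (l2inner u v))"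
    using m by (auto intro!: integrable_const_bound[where B = 1])
  moreover have "cis x = Complex (cos x) (sin x)" for x by (simp add: complex_eq_iff)
  ultimately show ?thesis by (simp add: integral_Complex(1))
qed

theorem mainTheorem4:
  fixes L T :: real and \<mu>bar :: "field measure" and \<mu> :: "real \<Rightarrow> field measure"
  assumes "L > 2"
    and "borel_prob_H \<mu>bar"
    and "(\<integral>\<^sup>+u. ennreal ((l2norm u)^2) \<partial>\<mu>bar) < \<infinity>"
    and "stat_sol L T \<mu>bar \<mu>"
    and "v \<in> HL L"
    and "0 \<le> t" and "t \<le> T"
  shows "(\<integral>u. cis (l2inner u v) \<partial>\<mu> t) =
           (\<integral>u. cis (l2inner u v) \<partial>\<mu>bar) +
           (\<integral>s\<in>{0..t}. (\<integral>u. \<i> * complex_of_real (nonlin v u) * cis (l2inner u v) \<partial>\<mu> s) \<partial>lebesgue)"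
proof -
  note S = assms(4) and v = assms(5) and t = assms(6,7)
  let ?J = "lebesgue_on {0..t}"
  have vH: "v \<in> Hsp" using v by (simp add: HL_def)
  have P: "borel_prob_H (\<mu> s)" if "s \<in> {0..T}" for s using stat_solD(1)[OF S] that by simp
  obtain G C where G: "is_weak_grad v G" "\<And>x i j. \<bar>G x $ i $ j\<bar> \<le> C"
    using HL_bounded_weak_grad[OF assms(1) v] by blast
  \<comment> \<open>These come from \<open>cos' = - sin\<close> and \<open>sin' = cos\<close>, and
    they are the real and imaginary parts of the target because
    \<open>\<i> * cis x = Complex (- sin x) (cos x)\<close>.\<close>
  define c s where "c r = (\<integral>u. - sin (l2inner u v) * quad G u \<partial>\<mu> r)"
    and "s r = (\<integral>u. cos (l2inner u v) * quad G u \<partial>\<mu> r)" for r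
  have cos_eq: "integrable ?J c" "(\<integral>u. cos (l2inner u v) \<partial>\<mu> t) = (\<integral>u. cos (l2inner u v) \<partial>\<mu>bar) + (\<integral>r. c r \<partial>?J)"
    and good: "AE r in ?J. integrable (\<mu> r) (quad G)"
    unfolding c_def[abs_def]
    by (rule stat_sol_bounded_scalar[OF S v t assms(3) G DERIV_cos]; (intro continuous_intros)?; simp)+
  have sin_eq: "integrable ?J s" "(\<integral>u. sin (l2inner u v) \<partial>\<mu> t) = (\<integral>u. sin (l2inner u v) \<partial>\<mu>bar) + (\<integral>r. s r \<partial>?J)"
    unfolding s_def[abs_def]
    by (rule stat_sol_bounded_scalar[OF S v t assms(3) G DERIV_sin]; (intro continuous_intros)?; simp)+
  have "AE r in ?J. r \<in> {0..t}" by (rule AE_I2) simp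
  with good have ae: "AE r in ?J. Complex (c r) (s r) =
      (\<integral>u. \<i> * complex_of_real (nonlin v u) * cis (l2inner u v) \<partial>\<mu> r)"
  proof eventually_elim
    case (elim r)
    then have M: "borel_prob_H (\<mu> r)" using P t by auto
    note m = measurable_l2inner[OF M L2field_Hsp[OF vH]] measurable_quad[OF M G]
    have "\<i> * complex_of_real (nonlin v u) * cis (l2inner u v) =
        Complex (- sin (l2inner u v) * quad G u) (cos (l2inner u v) * quad G u)" if "u \<in> space (\<mu> r)" for u
    proof -
      \<comment> \<open>The scaling lemma with factor 1 replaces the chosen gradient of
        \<open>v\<close> by the bounded one.\<close>
      have "nonlin v u = quad G u"
        using that nonlin_scaleR[OF G(1), of u 1] M by (simp add: borel_prob_H_def L2field_Hsp)
      then show ?thesis by (simp add: complex_eq_iff)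
    qed
    then have "(\<integral>u. \<i> * complex_of_real (nonlin v u) * cis (l2inner u v) \<partial>\<mu> r) =
        (\<integral>u. Complex (- sin (l2inner u v) * quad G u) (cos (l2inner u v) * quad G u) \<partial>\<mu> r)"
      by (intro Bochner_Integration.integral_cong) auto
    also have "\<dots> = Complex (c r) (s r)"
      unfolding c_def s_def
    proof (rule integral_Complex(1))
      have bnd: "\<bar>sin x * y\<bar> \<le> \<bar>y\<bar>" "\<bar>cos x * y\<bar> \<le> \<bar>y\<bar>" for x y :: real
        using mult_right_mono[OF abs_sin_le_one[of x], of "\<bar>y\<bar>"] mult_right_mono[OF abs_cos_le_one[of x], of "\<bar>y\<bar>"]
        by (auto simp: abs_mult)
      show "integrable (\<mu> r) (\<lambda>u. - sin (l2inner u v) * quad G u)"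
        by (rule Bochner_Integration.integrable_bound[OF elim(1)]) (use m bnd in auto)
      show "integrable (\<mu> r) (\<lambda>u. cos (l2inner u v) * quad G u)"
        by (rule Bochner_Integration.integrable_bound[OF elim(1)]) (use m bnd in auto)
    qed
    finally show ?case by simp
  qed
  \<comment> \<open>The complex integrand agrees with this function for almost every time only;
    completeness of Lebesgue measure then transfers measurability to it.\<close>
  have meas: "(\<lambda>r. Complex (c r) (s r)) \<in> borel_measurable ?J"
    using integral_Complex(2)[OF cos_eq(1) sin_eq(1)] by (rule borel_measurable_integrable)
  have "(\<integral>r\<in>{0..t}. (\<integral>u. \<i> * complex_of_real (nonlin v u) * cis (l2inner u v) \<partial>\<mu> r) \<partial>lebesgue) =
      (\<integral>r. (\<integral>u. \<i> * complex_of_real (nonlin v u) * cis (l2inner u v) \<partial>\<mu> r) \<partial>?J)"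
    by (simp add: integral_restrict_space set_lebesgue_integral_def)
  also have "\<dots> = (\<integral>r. Complex (c r) (s r) \<partial>?J)"
    by (rule sym, rule integral_cong_AE[OF meas measurable_lebesgue_on_AE[OF _ meas ae] ae]) simp
  also have "\<dots> = Complex (\<integral>r. c r \<partial>?J) (\<integral>r. s r \<partial>?J)"
    by (rule integral_Complex(1)[OF cos_eq(1) sin_eq(1)])
  finally show ?thesis
    using cos_eq(2) sin_eq(2) t P[of t] assms(2)
    by (simp add: integral_cis_l2inner vH complex_eq_iff)
qed

end
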